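(* Let $A\in\mathbb{R}^{n\times n}$ be a balanceable matrix and let $\epsilon\in(0,1)$. Osborne's algorithm with arbitrary (and potentially changing) orderings of the updates across cycles, implemented inexactly as described in the context (with suitable absolute constants in the $\Theta(\cdot)$ accuracies), finds an $\epsilon$-balancing of $A$ after $O\big(\frac{m\log\kappa}{\epsilon}\min\{\frac1\epsilon,d\}\big)$ arithmetic operations over $O\big(\log\frac{n\kappa}{\epsilon}\big)$-bit numbers, where the constants in $O(\cdot)$ are absolute.
   Context: Throughout $n\ge 2$ and $A\in\mathbb{R}^{n\times n}$ has nonnegative entries and zero diagonal. $G_A$ is the directed graph on $[n]=\{1,\dots,n\}$ with edge set $\{(i,j):A_{ij}\ne0\}$. $A$ is called balanceable if $G_A$ is strongly connected. Parameters: $m$ is the number of nonzero entries of $A$; $\kappa=\big(\sum_{i,j}A_{ij}\big)/\min_{(i,j):A_{ij}\ne0}A_{ij}$; $d$ is the diameter of $G_A$ (the maximum over ordered pairs $(i,j)$ of the length of a shortest directed path from $i$ to $j$). For $u\in\mathbb{R}^n$, let $\mathbb{D}(e^{u})$ be the diagonal matrix with entries $e^{u^{(1)}},\dots,e^{u^{(n)}}$ and $M(u)=\mathbb{D}(e^u)A\,\mathbb{D}(e^{-u})$, with $j$-th row and column sums $r_j(u)=\sum_i M(u)_{ji}$, $c_j(u)=\sum_i M(u)_{ij}$. $\mathbb{D}(e^u)$ is an $\epsilon$-balancing of $A$ if $\sum_{j}|r_j(u)-c_j(u)|\le\epsilon\sum_{i,j}M(u)_{ij}$. Osborne's algorithm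 with arbitrary orderings: start from $u=\mathbf 0$; in each cycle $k=0,1,2,\dots$ an arbitrary permutation $\pi_k$ of $[n]$ is given, and for $j=\pi_k(1),\dots,\pi_k(n)$ in this order the $j$-th coordinate of the current vector $u$ is replaced by $u^{(j)}+\frac12\log c_j(u)-\frac12\log r_j(u)$ (all other coordinates unchanged). Inexact implementation for target accuracy $\epsilon\in(0,1)$: (i) preprocess $A$ by computing $\{\log A_{ij}\}_{(i,j):A_{ij}\ne0}$ to additive accuracy $\gamma=\Theta(\epsilon/n)$; (ii) truncate the iterates of the algorithm entrywise to additive accuracy $\gamma'=\Theta(\epsilon^2)$; (iii) compute each update entrywise to additive accuracy $\gamma'$, accessing $A$ only through the truncated values of $\log A_{ij}$ from (i), where $\log r_j(u)$ and $\log c_j(u)$ are evaluated as log-sum-exp expressions of the numbers $u^{(j)}-u^{(i)}+\log A_{ji}$, respectively $u^{(i)}-u^{(j)}+\log A_{ij}$; (iv) after each completed cycle, check whether the current iterate is $\bar\epsilon$-balanced for $\bar\epsilon=\Theta(\epsilon)$, by computing an estimate $\hat g$ of $g=\sum_j|r_j(u)-c_j(u)|/\sum_{i,j}M(u)_{ij}$ with $\frac g2-\frac{\bar\epsilon}2\le\hat g\le 2g+\frac{\bar\epsilon}{2}$ and terminating when $\hat g$ falls below a threshold of order $\bar\epsilon$.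
   Formalization: The bit bound is false for matrices of arbitrary scale, so the stored logarithms are those of A_ij/s, and the bit bound is claimed for s between the smallest nonzero entry and the sum of entries (s=1 is the literal description); exp and log count as single arithmetic operations. *)

theory Defs
  imports
    "Jordan_Normal_Form.Matrix"
    "HOL-Library.Float"
    "HOL-Library.State_Monad"
    "HOL-Library.While_Combinator"
begin

text \<open>
  Indices run over \<open>{0..<n}\<close> instead of \<open>{1..n}\<close>. A vector of \<open>\<real>\<^sup>n\<close> is a function
  \<open>nat \<Rightarrow> real\<close> of which only the values at \<open>i < n\<close> matter.
\<close>

section \<open>Matrix balancing\<close>

definition edges :: "nat \<Rightarrow> real mat \<Rightarrow> (nat \<times> nat) set" where
  "edges n A = {(i, j). i < n \<and> j < n \<and> A $$ (i, j) \<noteq> 0}"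

definition balanceable :: "nat \<Rightarrow> real mat \<Rightarrow> bool" where
  "balanceable n A \<longleftrightarrow> (\<forall>i<n. \<forall>j<n. (i, j) \<in> (edges n A)\<^sup>*)"

definition entry_sum :: "nat \<Rightarrow> real mat \<Rightarrow> real" where
  "entry_sum n A = (\<Sum>i<n. \<Sum>j<n. A $$ (i, j))"

definition min_entry :: "nat \<Rightarrow> real mat \<Rightarrow> real" where
  "min_entry n A = Min ((\<lambda>e. A $$ e) ` edges n A)"

definition kappa :: "nat \<Rightarrow> real mat \<Rightarrow> real" where
  "kappa n A = entry_sum n A / min_entry n A"

definition path_dist :: "nat \<Rightarrow> real mat \<Rightarrow> nat \<Rightarrow> nat \<Rightarrow> nat" where
  "path_dist n A i j = (LEAST l. (i, j) \<in> edges n A ^^ l)"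

definition graph_diameter :: "nat \<Rightarrow> real mat \<Rightarrow> nat" where
  "graph_diameter n A = Max ((\<lambda>(i, j). path_dist n A i j) ` ({..<n} \<times> {..<n}))"

definition scaled :: "nat \<Rightarrow> real mat \<Rightarrow> (nat \<Rightarrow> real) \<Rightarrow> real mat" where
  "scaled n A u = mat_diag n (\<lambda>i. exp (u i)) * A * mat_diag n (\<lambda>i. exp (- u i))"

definition row_sum :: "nat \<Rightarrow> real mat \<Rightarrow> nat \<Rightarrow> real" where
  "row_sum n M j = (\<Sum>i<n. M $$ (j, i))"

definition col_sum :: "nat \<Rightarrow> real mat \<Rightarrow> nat \<Rightarrow> real" where
  "col_sum n M j = (\<Sum>i<n. M $$ (i, j))"

definition l1_imbalance :: "nat \<Rightarrow> real mat \<Rightarrow> real" where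
  "l1_imbalance n M = (\<Sum>j<n. \<bar>row_sum n M j - col_sum n M j\<bar>)"

text \<open>\<open>eps_balancing n A \<epsilon> u\<close>: the diagonal matrix with entries \<open>exp (u i)\<close> is an \<open>\<epsilon>\<close>-balancing.\<close>

definition eps_balancing :: "nat \<Rightarrow> real mat \<Rightarrow> real \<Rightarrow> (nat \<Rightarrow> real) \<Rightarrow> bool" where
  "eps_balancing n A \<epsilon> u \<longleftrightarrow>
     l1_imbalance n (scaled n A u) \<le> \<epsilon> * entry_sum n (scaled n A u)"

definition rel_imbalance :: "nat \<Rightarrow> real mat \<Rightarrow> (nat \<Rightarrow> real) \<Rightarrow> real" where
  "rel_imbalance n A u = l1_imbalance n (scaled n A u) / entry_sum n (scaled n A u)"


section \<open>Accuracy requirements on an inexact implementation\<close>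

text \<open>
  \<open>L i j\<close> stands for the stored approximation of \<open>ln (A $$ (i, j) / s)\<close>. The scale \<open>s > 0\<close> is
  a normalisation of the input: \<open>s = 1\<close> means that \<open>A\<close> is used as given. Balancing does not
  depend on \<open>s\<close>, but the magnitude of the stored logarithms does.
\<close>

definition log_row :: "nat \<Rightarrow> real mat \<Rightarrow> (nat \<Rightarrow> nat \<Rightarrow> real) \<Rightarrow> (nat \<Rightarrow> real) \<Rightarrow> nat \<Rightarrow> real" where
  "log_row n A L u j = ln (\<Sum>i\<in>{i. (j, i) \<in> edges n A}. exp (u j - u i + L j i))"

definition log_col :: "nat \<Rightarrow> real mat \<Rightarrow> (nat \<Rightarrow> nat \<Rightarrow> real) \<Rightarrow> (nat \<Rightarrow> real) \<Rightarrow> nat \<Rightarrow> real" where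
  "log_col n A L u j = ln (\<Sum>i\<in>{i. (i, j) \<in> edges n A}. exp (u i - u j + L i j))"

text \<open>
  \<open>y\<close> is the update computed to accuracy \<open>\<gamma>'\<close>, and \<open>z\<close> its truncation to accuracy \<open>\<gamma>'\<close>.
\<close>

definition inexact_update ::
  "nat \<Rightarrow> real mat \<Rightarrow> (nat \<Rightarrow> nat \<Rightarrow> real) \<Rightarrow> real \<Rightarrow> nat \<Rightarrow> (nat \<Rightarrow> real) \<Rightarrow> (nat \<Rightarrow> real) \<Rightarrow> bool" where
  "inexact_update n A L \<gamma>' j u v \<longleftrightarrow>
     (\<exists>y z. \<bar>y - (u j + log_col n A L u j / 2 - log_row n A L u j / 2)\<bar> \<le> \<gamma>' \<and>
            \<bar>z - y\<bar> \<le> \<gamma>' \<and> v = u(j := z))"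

fun inexact_sweep ::
  "nat \<Rightarrow> real mat \<Rightarrow> (nat \<Rightarrow> nat \<Rightarrow> real) \<Rightarrow> real \<Rightarrow> nat list \<Rightarrow> (nat \<Rightarrow> real) \<Rightarrow> (nat \<Rightarrow> real) \<Rightarrow> bool" where
  "inexact_sweep n A L \<gamma>' [] u v \<longleftrightarrow> v = u"
| "inexact_sweep n A L \<gamma>' (j # js) u v \<longleftrightarrow>
     (\<exists>w. inexact_update n A L \<gamma>' j u w \<and> inexact_sweep n A L \<gamma>' js w v)"

text \<open>
  \<open>K\<close> cycles of an inexact implementation that did not terminate before the end of cycle \<open>K\<close>:
  \<open>U k\<close> is the iterate after \<open>k\<close> cycles, \<open>\<pi> k\<close> the ordering used in the cycle that follows,
  and \<open>g k\<close> the estimate of the imbalance of \<open>U k\<close>, computed for \<open>k \<ge> 1\<close> only. The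
  implementation terminates after cycle \<open>K\<close> iff \<open>g K \<le> \<tau>\<close>.
\<close>

definition inexact_run ::
  "nat \<Rightarrow> real mat \<Rightarrow> real \<Rightarrow> (nat \<Rightarrow> nat \<Rightarrow> nat) \<Rightarrow> real \<Rightarrow> real \<Rightarrow> real \<Rightarrow> real \<Rightarrow>
   (nat \<Rightarrow> nat \<Rightarrow> real) \<Rightarrow> (nat \<Rightarrow> nat \<Rightarrow> real) \<Rightarrow> (nat \<Rightarrow> real) \<Rightarrow> nat \<Rightarrow> bool" where
  "inexact_run n A s \<pi> \<gamma> \<gamma>' \<epsilon>b \<tau> L U g K \<longleftrightarrow>
     (\<forall>(i, j)\<in>edges n A. \<bar>L i j - ln (A $$ (i, j) / s)\<bar> \<le> \<gamma>) \<and>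
     U 0 = (\<lambda>_. 0) \<and>
     (\<forall>k<K. inexact_sweep n A L \<gamma>' (map (\<pi> k) [0..<n]) (U k) (U (Suc k))) \<and>
     (\<forall>k\<in>{1..K}. rel_imbalance n A (U k) / 2 - \<epsilon>b / 2 \<le> g k \<and>
                  g k \<le> 2 * rel_imbalance n A (U k) + \<epsilon>b / 2) \<and>
     (\<forall>k\<in>{1..<K}. \<tau> < g k)"


section \<open>An implementation in fixed-point arithmetic\<close>

text \<open>
  The state of the monad is the list of the results of all arithmetic operations performed so
  far, most recent first. Its length counts the operations, and its elements are the numbers
  on which the computation works. The elementary operations are \<open>+\<close>, \<open>-\<close>, \<open>/\<close>, \<open>max\<close>,
  absolute value, \<open>exp\<close> and \<open>ln\<close>, each rounded down to \<open>p\<close> fractional bits, and the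
  truncation of a number.
\<close>

type_synonym 'a arith = "(real list, 'a) state"

definition fx :: "nat \<Rightarrow> real \<Rightarrow> real arith" where
  "fx p x = (let y = round_down (int p) x in
     do { tr \<leftarrow> State_Monad.get; State_Monad.set (y # tr); State_Monad.return y })"

definition fadd :: "nat \<Rightarrow> real \<Rightarrow> real \<Rightarrow> real arith" where "fadd p x y = fx p (x + y)"
definition fsub :: "nat \<Rightarrow> real \<Rightarrow> real \<Rightarrow> real arith" where "fsub p x y = fx p (x - y)"
definition fdiv :: "nat \<Rightarrow> real \<Rightarrow> real \<Rightarrow> real arith" where "fdiv p x y = fx p (x / y)"
definition fmax :: "nat \<Rightarrow> real \<Rightarrow> real \<Rightarrow> real arith" where "fmax p x y = fx p (max x y)"
definition fabs :: "nat \<Rightarrow> real \<Rightarrow> real arith" where "fabs p x = fx p \<bar>x\<bar>"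
definition fexp :: "nat \<Rightarrow> real \<Rightarrow> real arith" where "fexp p x = fx p (exp x)"
definition fln :: "nat \<Rightarrow> real \<Rightarrow> real arith" where "fln p x = fx p (ln x)"
definition ftruncate :: "nat \<Rightarrow> real \<Rightarrow> real arith" where "ftruncate q x = fx q x"

fun map_arith :: "('a \<Rightarrow> 'b arith) \<Rightarrow> 'a list \<Rightarrow> 'b list arith" where
  "map_arith f [] = State_Monad.return []"
| "map_arith f (x # xs) = do { y \<leftarrow> f x; ys \<leftarrow> map_arith f xs; State_Monad.return (y # ys) }"

fun fold_arith :: "('a \<Rightarrow> 'b \<Rightarrow> 'b arith) \<Rightarrow> 'a list \<Rightarrow> 'b \<Rightarrow> 'b arith" where
  "fold_arith f [] b = State_Monad.return b"
| "fold_arith f (x # xs) b = do { c \<leftarrow> f x b; fold_arith f xs c }"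

definition fsum :: "nat \<Rightarrow> real list \<Rightarrow> real arith" where
  "fsum p xs = fold_arith (fadd p) xs 0"

definition fmaximum :: "nat \<Rightarrow> real list \<Rightarrow> real arith" where
  "fmaximum p xs = fold_arith (fmax p) (tl xs) (hd xs)"

definition sum_exp_shifted :: "nat \<Rightarrow> real \<Rightarrow> real list \<Rightarrow> real arith" where
  "sum_exp_shifted p b xs = do {
     es \<leftarrow> map_arith (\<lambda>x. do { t \<leftarrow> fsub p x b; fexp p t }) xs;
     fsum p es }"

definition log_sum_exp :: "nat \<Rightarrow> real list \<Rightarrow> real arith" where
  "log_sum_exp p xs = do {
     b \<leftarrow> fmaximum p xs;
     S \<leftarrow> sum_exp_shifted p b xs;
     l \<leftarrow> fln p S;
     fadd p b l }"

text \<open>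
  Sparse storage of \<open>A\<close>: traversing these lists involves no arithmetic operation.
\<close>

definition edge_list :: "nat \<Rightarrow> real mat \<Rightarrow> (nat \<times> nat) list" where
  "edge_list n A = filter (\<lambda>e. A $$ e \<noteq> 0) (List.product [0..<n] [0..<n])"

definition row_edges :: "nat \<Rightarrow> real mat \<Rightarrow> nat \<Rightarrow> (nat \<times> nat) list" where
  "row_edges n A j = map (\<lambda>i. (j, i)) (filter (\<lambda>i. A $$ (j, i) \<noteq> 0) [0..<n])"

definition col_edges :: "nat \<Rightarrow> real mat \<Rightarrow> nat \<Rightarrow> (nat \<times> nat) list" where
  "col_edges n A j = map (\<lambda>i. (i, j)) (filter (\<lambda>i. A $$ (i, j) \<noteq> 0) [0..<n])"

definition log_entries ::
  "nat \<Rightarrow> (nat \<Rightarrow> nat \<Rightarrow> real) \<Rightarrow> (nat \<Rightarrow> real) \<Rightarrow> (nat \<times> nat) list \<Rightarrow> real list arith" where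
  "log_entries p L u = map_arith (\<lambda>(i, j). do { t \<leftarrow> fsub p (u i) (u j); fadd p t (L i j) })"

definition fp_update ::
  "nat \<Rightarrow> real mat \<Rightarrow> nat \<Rightarrow> nat \<Rightarrow> (nat \<Rightarrow> nat \<Rightarrow> real) \<Rightarrow> nat \<Rightarrow> (nat \<Rightarrow> real) \<Rightarrow> (nat \<Rightarrow> real) arith" where
  "fp_update n A q' p L j u = do {
     cs \<leftarrow> log_entries p L u (col_edges n A j);
     lc \<leftarrow> log_sum_exp p cs;
     rs \<leftarrow> log_entries p L u (row_edges n A j);
     lr \<leftarrow> log_sum_exp p rs;
     t \<leftarrow> fsub p lc lr;
     h \<leftarrow> fdiv p t 2;
     y \<leftarrow> fadd p (u j) h;
     z \<leftarrow> ftruncate q' y;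
     State_Monad.return (u(j := z)) }"

definition fp_sweep ::
  "nat \<Rightarrow> real mat \<Rightarrow> nat \<Rightarrow> nat \<Rightarrow> (nat \<Rightarrow> nat \<Rightarrow> real) \<Rightarrow> nat list \<Rightarrow> (nat \<Rightarrow> real) \<Rightarrow> (nat \<Rightarrow> real) arith" where
  "fp_sweep n A q' p L js u = fold_arith (fp_update n A q' p L) js u"

text \<open>
  Both sums in the relative imbalance are divided by the (approximately) largest entry.
\<close>

definition fp_estimate ::
  "nat \<Rightarrow> real mat \<Rightarrow> nat \<Rightarrow> (nat \<Rightarrow> nat \<Rightarrow> real) \<Rightarrow> (nat \<Rightarrow> real) \<Rightarrow> real arith" where
  "fp_estimate n A p L u = do {
     xs \<leftarrow> log_entries p L u (edge_list n A);
     b \<leftarrow> fmaximum p xs;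
     S \<leftarrow> sum_exp_shifted p b xs;
     ds \<leftarrow> map_arith (\<lambda>j. do {
       rs \<leftarrow> log_entries p L u (row_edges n A j);
       r \<leftarrow> sum_exp_shifted p b rs;
       cs \<leftarrow> log_entries p L u (col_edges n A j);
       c \<leftarrow> sum_exp_shifted p b cs;
       t \<leftarrow> fsub p r c;
       fabs p t }) [0..<n];
     D \<leftarrow> fsum p ds;
     fdiv p D S }"

definition fp_logs :: "real mat \<Rightarrow> real \<Rightarrow> nat \<Rightarrow> nat \<Rightarrow> nat \<Rightarrow> real" where
  "fp_logs A s q i j = round_down (int q) (ln (A $$ (i, j) / s))"

text \<open>
  A state consists of the number of completed cycles, the current iterate, the termination
  flag and the list of results of all operations. The fixed-point estimate is compared with
  \<open>round_down p \<tau>\<close>, which for a number with \<open>p\<close> fractional bits amounts to comparing with \<open>\<tau>\<close>.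
\<close>

type_synonym fp_state = "nat \<times> (nat \<Rightarrow> real) \<times> bool \<times> real list"

definition fp_init :: "nat \<Rightarrow> real mat \<Rightarrow> real \<Rightarrow> nat \<Rightarrow> nat \<Rightarrow> real \<Rightarrow> fp_state" where
  "fp_init n A s q p \<tau> =
     (0, \<lambda>_. 0, False,
      round_down (int p) \<tau> # map (\<lambda>(i, j). fp_logs A s q i j) (edge_list n A))"

definition fp_cycle ::
  "nat \<Rightarrow> real mat \<Rightarrow> real \<Rightarrow> (nat \<Rightarrow> nat \<Rightarrow> nat) \<Rightarrow> nat \<Rightarrow> nat \<Rightarrow> nat \<Rightarrow> real \<Rightarrow> fp_state \<Rightarrow> fp_state" where
  "fp_cycle n A s \<pi> q q' p \<tau> = (\<lambda>(k, u, halted, tr).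
     let L = fp_logs A s q;
         ((v, stop), tr') = run_state (do {
           v \<leftarrow> fp_sweep n A q' p L (map (\<pi> k) [0..<n]) u;
           g \<leftarrow> fp_estimate n A p L v;
           t \<leftarrow> fsub p g (round_down (int p) \<tau>);
           State_Monad.return (v, t \<le> 0) }) tr
     in (Suc k, v, stop, tr'))"

definition fp_osborne ::
  "nat \<Rightarrow> real mat \<Rightarrow> real \<Rightarrow> (nat \<Rightarrow> nat \<Rightarrow> nat) \<Rightarrow> nat \<Rightarrow> nat \<Rightarrow> nat \<Rightarrow> real \<Rightarrow> fp_state option" where
  "fp_osborne n A s \<pi> q q' p \<tau> =
     while_option (\<lambda>(k, u, halted, tr). \<not> halted) (fp_cycle n A s \<pi> q q' p \<tau>) (fp_init n A s q p \<tau>)"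

definition fp_iterate ::
  "nat \<Rightarrow> real mat \<Rightarrow> real \<Rightarrow> (nat \<Rightarrow> nat \<Rightarrow> nat) \<Rightarrow> nat \<Rightarrow> nat \<Rightarrow> nat \<Rightarrow> real \<Rightarrow> nat \<Rightarrow> nat \<Rightarrow> real" where
  "fp_iterate n A s \<pi> q q' p \<tau> k =
     fst (snd ((fp_cycle n A s \<pi> q q' p \<tau> ^^ k) (fp_init n A s q p \<tau>)))"

definition fp_estimates ::
  "nat \<Rightarrow> real mat \<Rightarrow> real \<Rightarrow> (nat \<Rightarrow> nat \<Rightarrow> nat) \<Rightarrow> nat \<Rightarrow> nat \<Rightarrow> nat \<Rightarrow> real \<Rightarrow> nat \<Rightarrow> real" where
  "fp_estimates n A s \<pi> q q' p \<tau> k =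
     fst (run_state (fp_estimate n A p (fp_logs A s q) (fp_iterate n A s \<pi> q q' p \<tau> k)) [])"

text \<open>
  The number of fractional bits that suffices for accuracy \<open>\<delta>\<close>; for \<open>\<delta> \<le> 1\<close>, the
  resulting accuracy \<open>1 / 2 ^ frac_bits \<delta>\<close> lies between \<open>\<delta> / 2\<close> and \<open>\<delta>\<close>.
\<close>

definition frac_bits :: "real \<Rightarrow> nat" where
  "frac_bits \<delta> = nat \<lceil>log 2 (1 / \<delta>)\<rceil>"

text \<open>
  Fixed-point numbers of \<open>O(b)\<close> bits: a signed integer of \<open>b\<close> bits and at most \<open>b\<close> binary places.
\<close>

definition bit_number :: "nat \<Rightarrow> real \<Rightarrow> bool" where
  "bit_number b x \<longleftrightarrow> (\<exists>(k::int) (e::nat). \<bar>k\<bar> < 2 ^ b \<and> e \<le> b \<and> x = real_of_int k / 2 ^ e)"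

end

theory Submission
  imports Defs
begin

text \<open>
  Write \<open>S(u)\<close> (called \<open>mass\<close> below) for the sum of the entries of the scaled matrix and \<open>r\<close>,
  \<open>c\<close> for the row and column sum that an update equalises. An exact update lowers \<open>S\<close> by
  \<open>(sqrt r - sqrt c)\<^sup>2\<close>, and the entries of that row and column change by \<open>\<bar>r - c\<bar>\<close> in total.
  A small error \<open>\<eta>\<close> in the update contributes only to second order, at most \<open>\<eta>\<^sup>2 (r + c)\<close>.

  The order of the updates is irrelevant for the following reason. Whatever imbalance a row had
  at the start of a sweep is either still there when its turn comes, or was removed by earlier
  updates, which had to move at least that much weight. So the imbalance at the start is at most
  twice the sum \<open>F\<close> of the \<open>\<bar>r - c\<bar>\<close> met during the sweep, and Cauchy-Schwarz bounds \<open>F\<^sup>2\<close> by a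
  constant times \<open>S\<close> times the decrease of \<open>S\<close> (\<open>sweep_estimates\<close>, \<open>mass_after_sweep\<close>). Hence a
  sweep that starts with relative imbalance \<open>g\<close> lowers \<open>ln S\<close> by at least \<open>g\<^sup>2 / 800\<close>, provided the
  update errors are at most \<open>g / 200\<close>; while the algorithm runs, \<open>g\<close> is of order at least \<open>\<epsilon>\<close>.

  Two facts about \<open>S\<close> bound the number of sweeps (\<open>cycles_bound\<close>). First, \<open>S\<close> never falls below the
  smallest nonzero entry, so that \<open>ln S\<close> can decrease by \<open>ln \<kappa>\<close> only; this gives the factor
  \<open>1 / \<epsilon>\<^sup>2\<close>. Second, \<open>ln S\<close> is convex and its gradient is the normalised imbalance, and a bound on
  \<open>S(u)\<close> confines the differences \<open>u i - u j\<close> to \<open>O(d ln \<kappa>)\<close>, one factor \<open>ln \<kappa>\<close> for each edge of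
  a path. So the remaining gap in \<open>ln S\<close> is \<open>O(g d ln \<kappa>)\<close> (\<open>ln_mass_gap_le\<close>), and a quantity
  \<open>x\<close> with \<open>x' \<le> x - a x\<^sup>2\<close> has \<open>1 / x\<close> growing linearly; this gives the factor \<open>d / \<epsilon>\<close>.

  For the fixed-point program, addition, subtraction and maximum of numbers on the grid
  \<open>2\<^bsup>-p\<^esup> \<int>\<close> are exact, so that, apart from the prescribed truncation,
  rounding errors come only from \<open>exp\<close>, \<open>ln\<close> and division. Shifting by the maximum keeps all
  arguments of \<open>exp\<close> nonpositive, and the arguments of \<open>ln\<close> and the divisor in the estimate at
  least \<open>1\<close>, where these operations are stable; the errors are then polynomial in \<open>n\<close> times \<open>2\<^bsup>-p\<^esup>\<close>
  (\<open>computes_fp_update\<close>, \<open>computes_fp_estimate\<close>). The bit length follows because one update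
  increases the largest \<open>\<bar>u i\<bar>\<close> by at most an additive amount (\<open>exact_update_bound\<close>), so that all
  numbers remain polynomial in \<open>n\<close>, \<open>\<kappa>\<close> and \<open>1 / \<epsilon>\<close>.
\<close>

section \<open>Inequalities for exponentials, logarithms and quotients\<close>

lemma half_le_ln_2: "1 / 2 \<le> ln (2::real)"
  using ln_add_one_self_le_self2[of "- 1 / 2"] by (simp add: ln_div)

lemma exp_minus_one_abs_le:
  fixes x :: real assumes "\<bar>x\<bar> \<le> 1/4" shows "\<bar>exp x - 1\<bar> \<le> 2 * \<bar>x\<bar>"
proof (cases "x \<ge> 0")
  case True
  have "exp x \<le> 1 + x + x\<^sup>2" using exp_bound[of x] True assms by auto
  moreover have "x\<^sup>2 \<le> x * 1" unfolding power2_eq_square using True assms by (intro mult_left_mono) auto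
  moreover have "1 + x \<le> exp x" by (rule exp_ge_add_one_self)
  ultimately show ?thesis using True by (auto simp: abs_if)
next
  case False
  then have "exp x \<le> 1" by simp
  moreover have "1 + x \<le> exp x" by (rule exp_ge_add_one_self)
  ultimately show ?thesis using False by linarith
qed

lemma exp_plus_exp_minus_le:
  fixes x :: real assumes "\<bar>x\<bar> \<le> 1/4" shows "exp x + exp (- x) \<le> 2 + 2 * x\<^sup>2"
proof -
  have *: "exp y + exp (- y) \<le> 2 + 2 * y\<^sup>2" if "0 \<le> y" "y \<le> 1/4" for y :: real
  proof -
    have e: "exp y - 1 \<le> y * (5/4)" "0 \<le> exp y - 1"
    proof -
      have "exp y \<le> 1 + y + y\<^sup>2" using exp_bound[of y] that by auto
      moreover have "y\<^sup>2 \<le> y * (1/4)" unfolding power2_eq_square using that by (intro mult_left_mono) auto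
      ultimately show "exp y - 1 \<le> y * (5/4)" by simp
      show "0 \<le> exp y - 1" using that by simp
    qed
    have "exp y + exp (- y) - 2 = exp (- y) * (exp y - 1)\<^sup>2"
      by (simp add: power2_eq_square algebra_simps flip: exp_add)
    also have "\<dots> \<le> 1 * (y * (5/4))\<^sup>2"
      using e that by (intro mult_mono power_mono) auto
    also have "\<dots> \<le> 2 * y\<^sup>2" by (simp add: power2_eq_square)
    finally show ?thesis by simp
  qed
  show ?thesis using *[of x] *[of "- x"] assms by (cases "x \<ge> 0") auto
qed

text \<open>
  Scaling a row of sum \<open>r\<close> by \<open>f\<close> and the column of sum \<open>c\<close> by \<open>1 / f\<close> makes both sums equal to
  \<open>sqrt (r c)\<close> when \<open>\<eta> = 0\<close>. The error \<open>\<eta>\<close> turns them into \<open>sqrt (r c)\<close> times \<open>exp \<eta>\<close> and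
  \<open>exp (- \<eta>)\<close>, whose first-order terms cancel in the sum. The three parts bound the new total, the
  amount of weight that moves, and the imbalance in terms of the decrease.
\<close>

lemma rescaled_pair:
  fixes r c \<eta> :: real
  assumes "r > 0" "c > 0" "\<bar>\<eta>\<bar> \<le> 1/4"
  defines "f \<equiv> exp (ln c / 2 - ln r / 2 + \<eta>)"
  shows "f * r + c / f \<le> r + c - (sqrt r - sqrt c)\<^sup>2 + \<eta>\<^sup>2 * (r + c)"
    and "\<bar>f * r - r\<bar> + \<bar>c / f - c\<bar> \<le> \<bar>r - c\<bar> + 2 * \<bar>\<eta>\<bar> * (r + c)"
    and "(r - c)\<^sup>2 \<le> 2 * (sqrt r - sqrt c)\<^sup>2 * (r + c)"
proof -
  define a b where "a = sqrt r" and "b = sqrt c"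
  have ab: "a > 0" "b > 0" "r = a\<^sup>2" "c = b\<^sup>2" using assms by (auto simp: a_def b_def)
  have f: "f = b / a * exp \<eta>"
    unfolding f_def ab using ab(1,2) by (simp add: exp_add exp_diff ln_realpow)
  have fr: "f * r = a * b * exp \<eta>" unfolding f ab using ab(1,2) by (simp add: power2_eq_square)
  have cf: "c / f = a * b * exp (- \<eta>)"
    unfolding f ab using ab(1,2) by (simp add: power2_eq_square exp_minus field_simps)
  have ab2: "2 * (a * b) \<le> r + c" using sum_squares_bound[of a b] ab by simp
  have "a * b * (exp \<eta> + exp (- \<eta>)) \<le> a * b * (2 + 2 * \<eta>\<^sup>2)"
    using exp_plus_exp_minus_le[OF assms(3)] ab by (intro mult_left_mono) auto
  also have "\<dots> = 2 * (a * b) + \<eta>\<^sup>2 * (2 * (a * b))" by (simp add: algebra_simps)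
  also have "\<dots> \<le> 2 * (a * b) + \<eta>\<^sup>2 * (r + c)" using ab2 by (intro add_left_mono mult_left_mono) auto
  finally show "f * r + c / f \<le> r + c - (sqrt r - sqrt c)\<^sup>2 + \<eta>\<^sup>2 * (r + c)"
    unfolding fr cf a_def[symmetric] b_def[symmetric] by (simp add: ab power2_eq_square algebra_simps)
  have e: "\<bar>exp \<eta> - 1\<bar> \<le> 2 * \<bar>\<eta>\<bar>" "\<bar>exp (- \<eta>) - 1\<bar> \<le> 2 * \<bar>\<eta>\<bar>"
    using exp_minus_one_abs_le[of \<eta>] exp_minus_one_abs_le[of "- \<eta>"] assms(3) by auto
  have "f * r - r = a * (b - a) + (a * b) * (exp \<eta> - 1)"
    unfolding fr by (simp add: ab power2_eq_square algebra_simps)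
  then have "\<bar>f * r - r\<bar> \<le> a * \<bar>b - a\<bar> + (a * b) * \<bar>exp \<eta> - 1\<bar>"
    using abs_triangle_ineq[of "a * (b - a)" "(a * b) * (exp \<eta> - 1)"] ab(1,2) by (simp add: abs_mult)
  moreover have "c / f - c = b * (a - b) + (a * b) * (exp (- \<eta>) - 1)"
    unfolding cf by (simp add: ab power2_eq_square algebra_simps)
  then have "\<bar>c / f - c\<bar> \<le> b * \<bar>b - a\<bar> + (a * b) * \<bar>exp (- \<eta>) - 1\<bar>"
    using abs_triangle_ineq[of "b * (a - b)" "(a * b) * (exp (- \<eta>) - 1)"] ab(1,2)
    by (simp add: abs_mult abs_minus_commute)
  moreover have "(a * b) * \<bar>exp \<eta> - 1\<bar> \<le> (a * b) * (2 * \<bar>\<eta>\<bar>)"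
    "(a * b) * \<bar>exp (- \<eta>) - 1\<bar> \<le> (a * b) * (2 * \<bar>\<eta>\<bar>)"
    using e ab(1,2) by (auto intro!: mult_left_mono)
  moreover have "a * \<bar>b - a\<bar> + b * \<bar>b - a\<bar> = \<bar>r - c\<bar>"
  proof -
    have "r - c = (a + b) * (a - b)" by (simp add: ab power2_eq_square algebra_simps)
    then have "\<bar>r - c\<bar> = (a + b) * \<bar>a - b\<bar>" using ab(1,2) by (simp add: abs_mult)
    then show ?thesis by (simp add: algebra_simps abs_minus_commute)
  qed
  moreover have "2 * ((a * b) * (2 * \<bar>\<eta>\<bar>)) \<le> 2 * \<bar>\<eta>\<bar> * (r + c)"
    using mult_left_mono[OF ab2, of "2 * \<bar>\<eta>\<bar>"] by (simp add: algebra_simps)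
  ultimately show "\<bar>f * r - r\<bar> + \<bar>c / f - c\<bar> \<le> \<bar>r - c\<bar> + 2 * \<bar>\<eta>\<bar> * (r + c)"
    by linarith
  have "(r - c)\<^sup>2 = (a - b)\<^sup>2 * (a + b)\<^sup>2" by (simp add: ab power2_eq_square algebra_simps)
  also have "\<dots> \<le> (a - b)\<^sup>2 * (2 * (r + c))"
    using sum_squares_bound[of a b] by (intro mult_left_mono) (auto simp: ab power2_eq_square algebra_simps)
  finally show "(r - c)\<^sup>2 \<le> 2 * (sqrt r - sqrt c)\<^sup>2 * (r + c)"
    unfolding a_def b_def by (simp add: algebra_simps)
qed

text \<open>
  Cauchy-Schwarz in the form that lets \<open>F\<^sup>2 \<le> 2 D B\<close> accumulate along a sweep.
\<close>

lemma square_sum_le: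
  fixes x y :: real
  assumes "x\<^sup>2 \<le> 2 * d * b" "y\<^sup>2 \<le> 2 * e * c" "0 \<le> x" "0 \<le> y" "0 \<le> b" "0 \<le> c" "0 \<le> d" "0 \<le> e"
  shows "(x + y)\<^sup>2 \<le> 2 * (d + e) * (b + c)"
proof -
  have "(x * y)\<^sup>2 \<le> (2 * d * b) * (2 * e * c)"
    unfolding power_mult_distrib using assms by (intro mult_mono) auto
  also have "\<dots> = 4 * ((d * c) * (e * b))" by simp
  also have "\<dots> \<le> (d * c + e * b)\<^sup>2"
    using sum_squares_ge_zero[of "d*c - e*b" 0] by (simp add: power2_eq_square algebra_simps)
  finally have "x * y \<le> d * c + e * b"
    by (rule power2_le_imp_le) (use assms in auto)
  then show ?thesis using assms(1,2) by (simp add: power2_eq_square algebra_simps)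
qed

lemma ln_sum_perturb:
  fixes w x :: "'a \<Rightarrow> real"
  assumes "finite E" "E \<noteq> {}" "\<And>i. i \<in> E \<Longrightarrow> 0 < w i" "\<And>i. i \<in> E \<Longrightarrow> \<bar>x i - ln (w i)\<bar> \<le> \<gamma>"
  shows "\<bar>ln (\<Sum>i\<in>E. exp (x i)) - ln (\<Sum>i\<in>E. w i)\<bar> \<le> \<gamma>"
proof -
  have W: "0 < (\<Sum>i\<in>E. w i)" and X: "0 < (\<Sum>i\<in>E. exp (x i))" using assms by (auto intro!: sum_pos)
  have "exp (x i) \<le> exp \<gamma> * w i" "w i \<le> exp \<gamma> * exp (x i)" if "i \<in> E" for i
  proof -
    have "exp (x i) \<le> exp (\<gamma> + ln (w i))" "exp (ln (w i)) \<le> exp (\<gamma> + x i)"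
      using assms(4)[OF that] by (simp_all add: abs_le_iff)
    then show "exp (x i) \<le> exp \<gamma> * w i" "w i \<le> exp \<gamma> * exp (x i)"
      using assms(3)[OF that] by (simp_all add: exp_add)
  qed
  then have "(\<Sum>i\<in>E. exp (x i)) \<le> exp \<gamma> * (\<Sum>i\<in>E. w i)" "(\<Sum>i\<in>E. w i) \<le> exp \<gamma> * (\<Sum>i\<in>E. exp (x i))"
    unfolding sum_distrib_left by (auto intro: sum_mono)
  then have "ln (\<Sum>i\<in>E. exp (x i)) \<le> ln (exp \<gamma> * (\<Sum>i\<in>E. w i))"
    "ln (\<Sum>i\<in>E. w i) \<le> ln (exp \<gamma> * (\<Sum>i\<in>E. exp (x i)))"
    using W X by (simp_all del: ln_exp)
  then show ?thesis using W X by (simp add: ln_mult abs_le_iff)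
qed

lemma ln_sum_exp_range:
  fixes x :: "'a \<Rightarrow> real"
  assumes "finite E" "E \<noteq> {}" "card E \<le> n" "\<And>i. i \<in> E \<Longrightarrow> a \<le> x i \<and> x i \<le> b"
  shows "a \<le> ln (\<Sum>i\<in>E. exp (x i))" "ln (\<Sum>i\<in>E. exp (x i)) \<le> b + real n - 1"
proof -
  obtain k where k: "k \<in> E" using assms(2) by auto
  have "exp a \<le> exp (x k)" using assms(4)[OF k] by simp
  also have "\<dots> \<le> (\<Sum>i\<in>E. exp (x i))" by (rule member_le_sum) (use k assms in auto)
  finally have 1: "exp a \<le> (\<Sum>i\<in>E. exp (x i))" .
  then show "a \<le> ln (\<Sum>i\<in>E. exp (x i))" by (subst ln_ge_iff) (auto intro: less_le_trans[OF exp_gt_zero])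
  have n: "0 < real n" using assms k by (cases n) auto
  have "(\<Sum>i\<in>E. exp (x i)) \<le> real (card E) * exp b"
    using assms(4) by (intro sum_bounded_above) auto
  also have "\<dots> \<le> real n * exp b" using assms(3) by (intro mult_right_mono) auto
  finally have "ln (\<Sum>i\<in>E. exp (x i)) \<le> ln (real n * exp b)"
    using less_le_trans[OF exp_gt_zero 1] n by (subst ln_le_cancel_iff) auto
  also have "\<dots> = ln (real n) + b" using n by (simp add: ln_mult)
  finally show "ln (\<Sum>i\<in>E. exp (x i)) \<le> b + real n - 1"
    using ln_le_minus_one[OF n] by linarith
qed

text \<open>
  Discrete form of the differential inequality \<open>x' \<le> - a x\<^sup>2\<close>, that is, \<open>(1 / x)' \<ge> a\<close>.
\<close>

lemma quadratic_decrease: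
  fixes x :: "nat \<Rightarrow> real"
  assumes "\<And>k. 1 \<le> k \<Longrightarrow> k \<le> K \<Longrightarrow> 0 < x k" "0 \<le> a"
    "\<And>k. 1 \<le> k \<Longrightarrow> k < K \<Longrightarrow> x (Suc k) \<le> x k - a * (x k)\<^sup>2" "1 \<le> K"
  shows "a * (real K - 1) \<le> 1 / x K"
proof -
  have "k \<le> K \<longrightarrow> a * (real k - 1) \<le> 1 / x k" if "1 \<le> k" for k
    using that
  proof (induction k rule: dec_induct)
    case base
    then show ?case using assms(1)[of 1] assms(4) by auto
  next
    case (step k)
    show ?case
    proof
      assume k: "Suc k \<le> K"
      then have p: "0 < x k" "0 < x (Suc k)" and d: "x (Suc k) \<le> x k - a * (x k)\<^sup>2"
        using assms step by auto
      have le: "x (Suc k) \<le> x k" using d assms(2) by (smt (verit) zero_le_power2 mult_nonneg_nonneg)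
      have "a * (x k * x (Suc k)) \<le> a * (x k)\<^sup>2"
        unfolding power2_eq_square using le p assms(2) by (intro mult_left_mono) auto
      also have "\<dots> \<le> x k - x (Suc k)" using d by simp
      finally have "a \<le> 1 / x (Suc k) - 1 / x k" using p by (simp add: field_simps)
      moreover have "a * (real k - 1) \<le> 1 / x k" using step k by simp
      ultimately show "a * (real (Suc k) - 1) \<le> 1 / x (Suc k)" by (simp add: algebra_simps)
    qed
  qed
  then show ?thesis using assms(4) by blast
qed

lemma ratio_error:
  fixes D S D' S' :: real
  assumes "0 < S" "0 < S'" "0 \<le> D" "D \<le> 2 * S" "\<bar>D' - D\<bar> \<le> a * S'" "\<bar>S' - S\<bar> \<le> b * S'"
  shows "\<bar>D' / S' - D / S\<bar> \<le> a + 2 * b"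
proof -
  have "D' / S' - D / S = (D' - D) / S' + D / S * ((S - S') / S')"
    using assms(1,2) by (simp add: field_simps)
  moreover have "\<bar>(D' - D) / S'\<bar> \<le> a" using assms(2,5) by (simp add: field_simps)
  moreover have "\<bar>D / S * ((S - S') / S')\<bar> \<le> 2 * b"
  proof -
    have "\<bar>D / S\<bar> \<le> 2" using assms(1,3,4) by (simp add: field_simps)
    moreover have "\<bar>(S - S') / S'\<bar> \<le> b" using assms(2,6) by (simp add: field_simps abs_minus_commute)
    ultimately show ?thesis unfolding abs_mult by (intro mult_mono) auto
  qed
  ultimately show ?thesis by linarith
qed

section \<open>Row and column sums of a scaled matrix\<close>

locale osborne_input =
  fixes n :: nat and A :: "real mat"
  assumes n_ge_2: "n \<ge> 2"
    and carrier: "A \<in> carrier_mat n n"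
    and nonneg: "\<And>i j. i < n \<Longrightarrow> j < n \<Longrightarrow> A $$ (i, j) \<ge> 0"
    and diagonal_zero: "\<And>i. i < n \<Longrightarrow> A $$ (i, i) = 0"
    and balanceable: "balanceable n A"
begin

definition weight :: "(nat \<Rightarrow> real) \<Rightarrow> nat \<Rightarrow> nat \<Rightarrow> real" where
  "weight u i j = A $$ (i, j) * exp (u i - u j)"

definition row_mass :: "(nat \<Rightarrow> real) \<Rightarrow> nat \<Rightarrow> real" where "row_mass u j = (\<Sum>i<n. weight u j i)"

definition col_mass :: "(nat \<Rightarrow> real) \<Rightarrow> nat \<Rightarrow> real" where "col_mass u j = (\<Sum>i<n. weight u i j)"

definition mass :: "(nat \<Rightarrow> real) \<Rightarrow> real" where "mass u = (\<Sum>j<n. row_mass u j)"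

definition imbalance :: "(nat \<Rightarrow> real) \<Rightarrow> real" where "imbalance u = (\<Sum>j<n. \<bar>row_mass u j - col_mass u j\<bar>)"

lemma scaled_entry: "i < n \<Longrightarrow> j < n \<Longrightarrow> scaled n A u $$ (i, j) = weight u i j"
  unfolding scaled_def mat_diag_mult_left[OF carrier]
  by (subst mat_diag_mult_right[of _ n n]) (auto simp: weight_def exp_diff exp_minus field_simps)

lemma entry_sum_scaled: "entry_sum n (scaled n A u) = mass u"
  unfolding entry_sum_def mass_def row_mass_def by (intro sum.cong) (auto simp: scaled_entry)

lemma l1_imbalance_scaled: "l1_imbalance n (scaled n A u) = imbalance u"
  unfolding l1_imbalance_def imbalance_def row_mass_def col_mass_def row_sum_def col_sum_def
  by (intro sum.cong arg_cong[where f = abs] arg_cong2[where f = "(-)"]) (auto simp: scaled_entry)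

lemma rel_imbalance_eq: "rel_imbalance n A u = imbalance u / mass u"
  by (simp add: rel_imbalance_def entry_sum_scaled l1_imbalance_scaled)

lemma weight_nonneg: "i < n \<Longrightarrow> j < n \<Longrightarrow> 0 \<le> weight u i j"
  by (simp add: weight_def nonneg)

lemma weight_diagonal: "i < n \<Longrightarrow> weight u i i = 0"
  by (simp add: weight_def diagonal_zero)

lemma finite_edges: "finite (edges n A)"
  by (rule finite_subset[of _ "{..<n} \<times> {..<n}"]) (auto simp: edges_def)

lemma edge_pos: "(i, j) \<in> edges n A \<Longrightarrow> 0 < A $$ (i, j)"
  using nonneg[of i j] by (auto simp: edges_def)

lemma edge_bounds: "(i, j) \<in> edges n A \<Longrightarrow> i < n \<and> j < n"
  by (simp add: edges_def)

lemma out_edge: assumes "i < n" shows "\<exists>j. (i, j) \<in> edges n A"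
proof -
  obtain k where "k < n" "k \<noteq> i" using n_ge_2 by (metis One_nat_def Suc_1 Suc_le_lessD less_2_cases_iff less_trans neq0_conv zero_neq_one)
  then have "(i, k) \<in> (edges n A)\<^sup>*" "i \<noteq> k" using balanceable assms by (auto simp: balanceable_def)
  then show ?thesis by (meson converse_rtranclE)
qed

lemma in_edge: assumes "j < n" shows "\<exists>i. (i, j) \<in> edges n A"
proof -
  obtain k where "k < n" "k \<noteq> j" using n_ge_2 by (metis One_nat_def Suc_1 Suc_le_lessD less_2_cases_iff less_trans neq0_conv zero_neq_one)
  then have "(k, j) \<in> (edges n A)\<^sup>*" "k \<noteq> j" using balanceable assms by (auto simp: balanceable_def)
  then show ?thesis by (meson rtranclE)
qed

lemma edges_nonempty: "edges n A \<noteq> {}"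
  using out_edge[of 0] n_ge_2 by auto

lemma min_entry_le: "(i, j) \<in> edges n A \<Longrightarrow> min_entry n A \<le> A $$ (i, j)"
  unfolding min_entry_def using finite_edges by (intro Min_le) auto

lemma min_entry_pos: "0 < min_entry n A"
  unfolding min_entry_def using finite_edges edges_nonempty edge_pos by (subst Min_gr_iff) auto

lemma weight_le_row_mass: "i < n \<Longrightarrow> j < n \<Longrightarrow> weight u i j \<le> row_mass u i"
  unfolding row_mass_def by (rule member_le_sum[of j]) (auto simp: weight_nonneg)

lemma weight_le_col_mass: "i < n \<Longrightarrow> j < n \<Longrightarrow> weight u i j \<le> col_mass u j"
  unfolding col_mass_def by (rule member_le_sum[of i]) (auto simp: weight_nonneg)

lemma row_mass_nonneg: "i < n \<Longrightarrow> 0 \<le> row_mass u i"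
  unfolding row_mass_def by (intro sum_nonneg) (auto simp: weight_nonneg)

lemma col_mass_nonneg: "i < n \<Longrightarrow> 0 \<le> col_mass u i"
  unfolding col_mass_def by (intro sum_nonneg) (auto simp: weight_nonneg)

lemma edge_weight_pos: "(i, j) \<in> edges n A \<Longrightarrow> 0 < weight u i j"
  by (simp add: weight_def edge_pos)

lemma row_mass_pos: "i < n \<Longrightarrow> 0 < row_mass u i"
  using out_edge[of i] edge_weight_pos[of i _ u] weight_le_row_mass[of i _ u] edge_bounds by (metis less_le_trans)

lemma col_mass_pos: "i < n \<Longrightarrow> 0 < col_mass u i"
  using in_edge[of i] edge_weight_pos[of _ i u] weight_le_col_mass[of _ i u] edge_bounds by (metis less_le_trans)

lemma mass_eq_col_mass: "mass u = (\<Sum>j<n. col_mass u j)"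
  unfolding mass_def row_mass_def col_mass_def by (rule sum.swap)

lemma row_mass_le_mass: "i < n \<Longrightarrow> row_mass u i \<le> mass u"
  unfolding mass_def by (rule member_le_sum[of i]) (auto simp: row_mass_nonneg)

lemma mass_pos: "0 < mass u"
  using row_mass_pos[of 0 u] row_mass_le_mass[of 0 u] n_ge_2 by simp

lemma mass_zero: "mass (\<lambda>_. 0) = entry_sum n A"
  by (simp add: mass_def row_mass_def weight_def entry_sum_def)

text \<open>
  At a vertex \<open>i\<close> where \<open>u\<close> is maximal, the weight of any outgoing edge is at least the matrix
  entry.
\<close>

lemma min_entry_le_mass: "min_entry n A \<le> mass u"
proof -
  have "finite (u ` {..<n})" "u ` {..<n} \<noteq> {}" using n_ge_2 by (auto simp: lessThan_empty_iff)
  from Max_in[OF this] obtain i where i: "i < n" "u i = Max (u ` {..<n})" by auto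
  obtain j where j: "(i, j) \<in> edges n A" using out_edge[OF i(1)] by auto
  have jn: "j < n" using edge_bounds[OF j] by simp
  have "u j \<le> u i" unfolding i(2) using jn by (intro Max_ge) auto
  then have "A $$ (i, j) * 1 \<le> weight u i j" unfolding weight_def
    using edge_pos[OF j] by (intro mult_left_mono) auto
  then show ?thesis
    using min_entry_le[OF j] weight_le_row_mass[OF i(1) jn, of u] row_mass_le_mass[OF i(1), of u] by linarith
qed

text \<open>
  There are at least two rows, and each contains an edge. This makes \<open>ln \<kappa>\<close> large enough to
  absorb additive constants.
\<close>

lemma kappa_ge_2: "2 \<le> kappa n A"
proof -
  have "min_entry n A \<le> row_mass (\<lambda>_. 0) j" if j: "j < n" for j
  proof -
    obtain i where i: "(j, i) \<in> edges n A" using out_edge[OF j] by auto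
    have "A $$ (j, i) \<le> row_mass (\<lambda>_. 0) j"
      using weight_le_row_mass[OF j, of i "\<lambda>_. 0"] edge_bounds[OF i] by (simp add: weight_def)
    then show ?thesis using min_entry_le[OF i] by linarith
  qed
  then have "(\<Sum>j<n. min_entry n A) \<le> mass (\<lambda>_. 0)" unfolding mass_def by (intro sum_mono) auto
  moreover have "2 * min_entry n A \<le> real n * min_entry n A"
    using n_ge_2 min_entry_pos by (intro mult_right_mono) auto
  ultimately have "2 * min_entry n A \<le> entry_sum n A" by (simp add: mass_zero)
  then show ?thesis unfolding kappa_def using min_entry_pos by (simp add: field_simps)
qed

lemma ln_kappa_ge: "1 / 2 \<le> ln (kappa n A)"
proof -
  have "ln 2 \<le> ln (kappa n A)" using kappa_ge_2 by simp
  then show ?thesis using half_le_ln_2 by linarith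
qed

lemma n_le_card_edges: "n \<le> card (edges n A)"
proof -
  have "{..<n} \<subseteq> fst ` edges n A" using out_edge by force
  then have "card {..<n} \<le> card (edges n A)"
    using finite_edges by (meson card_image_le card_mono finite_imageI le_trans)
  then show ?thesis by simp
qed

lemma ln_mass_range:
  "ln (mass (\<lambda>_. 0)) - ln (mass v) \<le> ln (kappa n A)"
proof -
  have "ln (kappa n A) = ln (mass (\<lambda>_. 0)) - ln (min_entry n A)"
    unfolding kappa_def using min_entry_pos mass_pos[of "\<lambda>_. 0"] by (simp add: mass_zero ln_div)
  moreover have "ln (min_entry n A) \<le> ln (mass v)"
    using min_entry_pos min_entry_le_mass[of v] by simp
  ultimately show ?thesis by linarith
qed

section \<open>The decrease of the mass in one sweep\<close>

text \<open>
  All sources of error of an inexact update are collected in the single bound \<open>e\<close>, so that the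
  analysis of a sweep works with the exact matrix.
\<close>

definition balance_step :: "real \<Rightarrow> nat \<Rightarrow> (nat \<Rightarrow> real) \<Rightarrow> (nat \<Rightarrow> real) \<Rightarrow> bool" where
  "balance_step e j u v \<longleftrightarrow>
     (\<exists>\<eta>. \<bar>\<eta>\<bar> \<le> e \<and> v = u(j := u j + ln (col_mass u j) / 2 - ln (row_mass u j) / 2 + \<eta>))"

text \<open>
  Shifting coordinate \<open>j\<close> changes one entry of row \<open>k\<close> and one entry of column \<open>k\<close> for every
  other vertex \<open>k\<close>, and these entries make up column \<open>j\<close> and row \<open>j\<close>. All entries of a row or column
  change in the same direction, hence the absolute changes add up to the change of the sum.
\<close>

lemma coordinate_change:
  assumes j: "j < n" and v: "v = u(j := u j + t)"
  shows "row_mass v j = exp t * row_mass u j" and "col_mass v j = col_mass u j / exp t"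
    and "mass v = mass u - row_mass u j - col_mass u j + row_mass v j + col_mass v j"
    and "\<And>T. T \<subseteq> {..<n} \<Longrightarrow> j \<notin> T \<Longrightarrow>
      (\<Sum>k\<in>T. \<bar>row_mass v k - row_mass u k\<bar> + \<bar>col_mass v k - col_mass u k\<bar>)
        \<le> \<bar>row_mass v j - row_mass u j\<bar> + \<bar>col_mass v j - col_mass u j\<bar>"
proof -
  have wr: "weight v j k = exp t * weight u j k" if "k < n" for k
    using that j by (cases "k = j") (auto simp: v weight_def diagonal_zero exp_add exp_diff)
  have wc: "weight v k j = weight u k j / exp t" if "k < n" for k
    using that j by (cases "k = j") (auto simp: v weight_def diagonal_zero exp_add exp_diff)
  show R: "row_mass v j = exp t * row_mass u j"
    unfolding row_mass_def by (simp add: wr sum_distrib_left)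
  show C: "col_mass v j = col_mass u j / exp t"
    unfolding col_mass_def by (simp add: wc sum_divide_distrib)
  have other: "row_mass v k - row_mass u k = weight v k j - weight u k j" "col_mass v k - col_mass u k = weight v j k - weight u j k"
    if k: "k < n" "k \<noteq> j" for k
  proof -
    have *: "weight v k i - weight u k i = (if i = j then weight v k j - weight u k j else 0)"
      "weight v i k - weight u i k = (if i = j then weight v j k - weight u j k else 0)" for i
      using k by (auto simp: v weight_def)
    have "(\<Sum>i<n. weight v k i - weight u k i) = (\<Sum>i<n. if i = j then weight v k j - weight u k j else 0)"
      "(\<Sum>i<n. weight v i k - weight u i k) = (\<Sum>i<n. if i = j then weight v j k - weight u j k else 0)"
      by (intro sum.cong refl *)+
    then show "row_mass v k - row_mass u k = weight v k j - weight u k j" "col_mass v k - col_mass u k = weight v j k - weight u j k"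
      unfolding row_mass_def col_mass_def using j by (simp_all add: sum_subtractf)
  qed
  have dr: "(\<Sum>k<n. weight v j k - weight u j k) = row_mass v j - row_mass u j"
    and dc: "(\<Sum>k<n. weight v k j - weight u k j) = col_mass v j - col_mass u j"
    unfolding row_mass_def col_mass_def by (simp_all add: sum_subtractf)
  have jin: "j \<in> {..<n}" using j by simp
  have "mass v - mass u = (\<Sum>k<n. row_mass v k - row_mass u k)" unfolding mass_def by (simp add: sum_subtractf)
  also have "\<dots> = (row_mass v j - row_mass u j) + (\<Sum>k\<in>{..<n} - {j}. row_mass v k - row_mass u k)"
    by (rule sum.remove) (use jin in auto)
  also have "(\<Sum>k\<in>{..<n} - {j}. row_mass v k - row_mass u k) = (\<Sum>k\<in>{..<n} - {j}. weight v k j - weight u k j)"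
    by (rule sum.cong) (auto simp: other)
  also have "\<dots> = (\<Sum>k<n. weight v k j - weight u k j)"
    using sum.remove[OF _ jin, of "\<lambda>k. weight v k j - weight u k j"] j by (simp add: weight_diagonal)
  finally show "mass v = mass u - row_mass u j - col_mass u j + row_mass v j + col_mass v j"
    unfolding dc by simp
  fix T assume T: "T \<subseteq> {..<n}" "j \<notin> T"
  have sgn: "(\<Sum>k<n. \<bar>weight v j k - weight u j k\<bar>) = \<bar>row_mass v j - row_mass u j\<bar>"
    "(\<Sum>k<n. \<bar>weight v k j - weight u k j\<bar>) = \<bar>col_mass v j - col_mass u j\<bar>"
  proof -
    have "(\<Sum>k<n. \<bar>weight v j k - weight u j k\<bar>) = (\<Sum>k<n. \<bar>exp t - 1\<bar> * weight u j k)"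
    proof (intro sum.cong refl)
      fix k assume "k \<in> {..<n}"
      then have "weight v j k - weight u j k = (exp t - 1) * weight u j k" "0 \<le> weight u j k"
        using j by (auto simp: wr weight_nonneg algebra_simps)
      then show "\<bar>weight v j k - weight u j k\<bar> = \<bar>exp t - 1\<bar> * weight u j k" by (simp add: abs_mult)
    qed
    also have "\<dots> = \<bar>exp t - 1\<bar> * row_mass u j" by (simp add: row_mass_def sum_distrib_left)
    also have "\<dots> = \<bar>(exp t - 1) * row_mass u j\<bar>" using row_mass_nonneg[OF j] by (simp add: abs_mult)
    finally show "(\<Sum>k<n. \<bar>weight v j k - weight u j k\<bar>) = \<bar>row_mass v j - row_mass u j\<bar>" by (simp add: R algebra_simps)
    have "(\<Sum>k<n. \<bar>weight v k j - weight u k j\<bar>) = (\<Sum>k<n. \<bar>1 / exp t - 1\<bar> * weight u k j)"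
    proof (intro sum.cong refl)
      fix k assume "k \<in> {..<n}"
      then have "weight v k j - weight u k j = (1 / exp t - 1) * weight u k j" "0 \<le> weight u k j"
        using j by (auto simp: wc weight_nonneg algebra_simps)
      then show "\<bar>weight v k j - weight u k j\<bar> = \<bar>1 / exp t - 1\<bar> * weight u k j" by (simp add: abs_mult)
    qed
    also have "\<dots> = \<bar>1 / exp t - 1\<bar> * col_mass u j" by (simp add: col_mass_def sum_distrib_left)
    also have "\<dots> = \<bar>(1 / exp t - 1) * col_mass u j\<bar>" using col_mass_nonneg[OF j] by (simp add: abs_mult)
    finally show "(\<Sum>k<n. \<bar>weight v k j - weight u k j\<bar>) = \<bar>col_mass v j - col_mass u j\<bar>" by (simp add: C algebra_simps)
  qed
  have "(\<Sum>k\<in>T. \<bar>row_mass v k - row_mass u k\<bar> + \<bar>col_mass v k - col_mass u k\<bar>)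
      = (\<Sum>k\<in>T. \<bar>weight v k j - weight u k j\<bar> + \<bar>weight v j k - weight u j k\<bar>)"
  proof (intro sum.cong refl)
    fix k assume "k \<in> T"
    then have "k < n" "k \<noteq> j" using T by auto
    then show "\<bar>row_mass v k - row_mass u k\<bar> + \<bar>col_mass v k - col_mass u k\<bar>
        = \<bar>weight v k j - weight u k j\<bar> + \<bar>weight v j k - weight u j k\<bar>" by (simp add: other)
  qed
  also have "\<dots> \<le> (\<Sum>k<n. \<bar>weight v k j - weight u k j\<bar> + \<bar>weight v j k - weight u j k\<bar>)"
    using T by (intro sum_mono2) auto
  also have "\<dots> = \<bar>col_mass v j - col_mass u j\<bar> + \<bar>row_mass v j - row_mass u j\<bar>"
    by (simp add: sum.distrib sgn)
  finally show "(\<Sum>k\<in>T. \<bar>row_mass v k - row_mass u k\<bar> + \<bar>col_mass v k - col_mass u k\<bar>)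
        \<le> \<bar>row_mass v j - row_mass u j\<bar> + \<bar>col_mass v j - col_mass u j\<bar>" by simp
qed

lemma balance_step_estimates:
  assumes j: "j < n" and step: "balance_step e j u v" and e: "e \<le> 1/4"
  defines "b \<equiv> row_mass u j + col_mass u j" and "f \<equiv> \<bar>row_mass u j - col_mass u j\<bar>"
    and "D \<equiv> (sqrt (row_mass u j) - sqrt (col_mass u j))\<^sup>2"
  shows "mass v \<le> mass u - D + e\<^sup>2 * b" and "f\<^sup>2 \<le> 2 * D * b"
    and "\<And>T. T \<subseteq> {..<n} \<Longrightarrow> j \<notin> T \<Longrightarrow>
      (\<Sum>k\<in>T. \<bar>row_mass v k - row_mass u k\<bar> + \<bar>col_mass v k - col_mass u k\<bar>) \<le> f + 2 * e * b"
proof -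
  obtain \<eta> where \<eta>: "\<bar>\<eta>\<bar> \<le> e"
    and v: "v = u(j := u j + (ln (col_mass u j) / 2 - ln (row_mass u j) / 2 + \<eta>))"
    using step unfolding balance_step_def by (auto simp: algebra_simps)
  note cc = coordinate_change[OF j v]
  have \<eta>': "\<bar>\<eta>\<bar> \<le> 1/4" using \<eta> e by simp
  note rp = rescaled_pair[OF row_mass_pos[OF j, of u] col_mass_pos[OF j, of u] \<eta>', folded cc(1,2)]
  have b0: "0 \<le> b" using row_mass_nonneg[OF j, of u] col_mass_nonneg[OF j, of u] by (simp add: b_def)
  have "\<eta>\<^sup>2 \<le> e\<^sup>2" using \<eta> power_mono[of "\<bar>\<eta>\<bar>" e 2] by simp
  then have "\<eta>\<^sup>2 * b \<le> e\<^sup>2 * b" using b0 by (rule mult_right_mono)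
  then show "mass v \<le> mass u - D + e\<^sup>2 * b" using cc(3) rp(1) by (simp add: b_def D_def)
  show "f\<^sup>2 \<le> 2 * D * b" using rp(3) by (simp add: f_def D_def b_def)
  have "2 * \<bar>\<eta>\<bar> * b \<le> 2 * e * b" using \<eta> b0 by (intro mult_right_mono) auto
  then have X: "\<bar>row_mass v j - row_mass u j\<bar> + \<bar>col_mass v j - col_mass u j\<bar> \<le> f + 2 * e * b"
    using rp(2) by (simp add: b_def f_def)
  fix T assume "T \<subseteq> {..<n}" "j \<notin> T"
  from cc(4)[OF this] X
  show "(\<Sum>k\<in>T. \<bar>row_mass v k - row_mass u k\<bar> + \<bar>col_mass v k - col_mass u k\<bar>) \<le> f + 2 * e * b"
    by linarith
qed

fun balance_sweep :: "real \<Rightarrow> nat list \<Rightarrow> (nat \<Rightarrow> real) \<Rightarrow> (nat \<Rightarrow> real) \<Rightarrow> bool" where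
  "balance_sweep e [] u v \<longleftrightarrow> v = u"
| "balance_sweep e (j # js) u v \<longleftrightarrow> (\<exists>w. balance_step e j u w \<and> balance_sweep e js w v)"

text \<open>
  Here \<open>D\<close>, \<open>F\<close> and \<open>B\<close> are the sums of \<open>(sqrt r - sqrt c)\<^sup>2\<close>, \<open>\<bar>r - c\<bar>\<close> and \<open>r + c\<close> over the updates
  of the sweep, each term taken at the time of its update. The last two inequalities transport
  the sums at these different times back to the start: what an update changes in the rows and
  columns still to be treated is at most \<open>\<bar>r - c\<bar>\<close>, up to the error term.
\<close>

lemma sweep_estimates:
  assumes "distinct js" "set js \<subseteq> {..<n}" "balance_sweep e js u v" "0 \<le> e" "e \<le> 1/4"
  shows "\<exists>D F B. 0 \<le> D \<and> 0 \<le> F \<and> 0 \<le> B \<and> mass v \<le> mass u - D + e\<^sup>2 * B \<and> F\<^sup>2 \<le> 2 * D * B \<and>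
    B \<le> (\<Sum>j\<in>set js. row_mass u j + col_mass u j) + F + 2 * e * B \<and>
    (\<Sum>j\<in>set js. \<bar>row_mass u j - col_mass u j\<bar>) \<le> 2 * F + 2 * e * B"
  using assms(1-3)
proof (induction js arbitrary: u)
  case Nil
  then show ?case by (intro exI[of _ 0]) auto
next
  case (Cons j js)
  then obtain w where w: "balance_step e j u w" "balance_sweep e js w v" by auto
  have j: "j < n" "j \<notin> set js" and T: "set js \<subseteq> {..<n}" using Cons.prems by auto
  from Cons.IH[OF _ T w(2)] Cons.prems obtain D F B
    where DFB: "0 \<le> D" "0 \<le> F" "0 \<le> B" "mass v \<le> mass w - D + e\<^sup>2 * B" "F\<^sup>2 \<le> 2 * D * B"
      "B \<le> (\<Sum>j\<in>set js. row_mass w j + col_mass w j) + F + 2 * e * B"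
      "(\<Sum>j\<in>set js. \<bar>row_mass w j - col_mass w j\<bar>) \<le> 2 * F + 2 * e * B"
    by auto
  define b where "b = row_mass u j + col_mass u j"
  define f where "f = \<bar>row_mass u j - col_mass u j\<bar>"
  define d where "d = (sqrt (row_mass u j) - sqrt (col_mass u j))\<^sup>2"
  note est = balance_step_estimates[OF j(1) w(1) assms(5), folded b_def f_def d_def]
  have pos: "0 \<le> b" "0 \<le> f" "0 \<le> d"
    using row_mass_nonneg[OF j(1), of u] col_mass_nonneg[OF j(1), of u] by (auto simp: b_def f_def d_def)
  define X where "X = (\<Sum>k\<in>set js. \<bar>row_mass w k - row_mass u k\<bar> + \<bar>col_mass w k - col_mass u k\<bar>)"
  have X: "X \<le> f + 2 * e * b" unfolding X_def by (rule est(3)[OF T j(2)])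
  have "(\<Sum>k\<in>set js. row_mass w k + col_mass w k) \<le> (\<Sum>k\<in>set js. (row_mass u k + col_mass u k) +
      (\<bar>row_mass w k - row_mass u k\<bar> + \<bar>col_mass w k - col_mass u k\<bar>))" by (rule sum_mono) linarith
  then have P: "(\<Sum>k\<in>set js. row_mass w k + col_mass w k) \<le> (\<Sum>k\<in>set js. row_mass u k + col_mass u k) + X"
    unfolding X_def sum.distrib[of "\<lambda>k. row_mass u k + col_mass u k"] .
  have "(\<Sum>k\<in>set js. \<bar>row_mass u k - col_mass u k\<bar>) \<le> (\<Sum>k\<in>set js. \<bar>row_mass w k - col_mass w k\<bar> +
      (\<bar>row_mass w k - row_mass u k\<bar> + \<bar>col_mass w k - col_mass u k\<bar>))" by (rule sum_mono) linarith
  then have Q: "(\<Sum>k\<in>set js. \<bar>row_mass u k - col_mass u k\<bar>) \<le> (\<Sum>k\<in>set js. \<bar>row_mass w k - col_mass w k\<bar>) + X"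
    unfolding X_def sum.distrib[of "\<lambda>k. \<bar>row_mass w k - col_mass w k\<bar>"] .
  have split: "(\<Sum>k\<in>set (j # js). row_mass u k + col_mass u k) = b + (\<Sum>k\<in>set js. row_mass u k + col_mass u k)"
    "(\<Sum>k\<in>set (j # js). \<bar>row_mass u k - col_mass u k\<bar>) = f + (\<Sum>k\<in>set js. \<bar>row_mass u k - col_mass u k\<bar>)"
    using j(2) by (auto simp: b_def f_def)
  show ?case
  proof (rule exI[of _ "D + d"], rule exI[of _ "F + f"], rule exI[of _ "B + b"], intro conjI)
    show "mass v \<le> mass u - (D + d) + e\<^sup>2 * (B + b)"
      using DFB(4) est(1) by (simp add: algebra_simps)
    show "(F + f)\<^sup>2 \<le> 2 * (D + d) * (B + b)"
      by (rule square_sum_le) (use DFB est pos in auto)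
    show "B + b \<le> (\<Sum>j\<in>set (j # js). row_mass u j + col_mass u j) + (F + f) + 2 * e * (B + b)"
      unfolding split using P X DFB(6) by (simp add: algebra_simps)
    show "(\<Sum>j\<in>set (j # js). \<bar>row_mass u j - col_mass u j\<bar>) \<le> 2 * (F + f) + 2 * e * (B + b)"
      unfolding split using Q X DFB(7) by (simp add: algebra_simps)
  qed (use DFB pos in auto)
qed

text \<open>
  The decrease is bounded below through \<open>I \<le> 2 F + O(e S)\<close> for the imbalance \<open>I\<close>, and
  \<open>F\<^sup>2 \<le> 24 D S\<close>; the errors increase the mass by at most \<open>12 e\<^sup>2 S\<close>. The first part bounds the
  possible increase in a sweep that starts almost balanced, where the second part is silent.
\<close>

lemma mass_after_sweep:
  assumes "distinct js" "set js = {..<n}" "balance_sweep e js u v" "0 \<le> e" "e \<le> 1/16"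
  shows "mass v \<le> 2 * mass u"
    and "200 * e \<le> imbalance u / mass u \<Longrightarrow> mass v \<le> mass u * (1 - (imbalance u / mass u)\<^sup>2 / 800)"
proof -
  define S g where "S = mass u" and "g = imbalance u / mass u"
  have S: "0 < S" "mass u = S" using mass_pos by (auto simp: S_def)
  have sub: "set js \<subseteq> {..<n}" and e4: "e \<le> 1/4" using assms by auto
  obtain D F B where DFB: "0 \<le> D" "0 \<le> F" "0 \<le> B" "mass v \<le> S - D + e\<^sup>2 * B" "F\<^sup>2 \<le> 2 * D * B"
      "B \<le> (\<Sum>j\<in>set js. row_mass u j + col_mass u j) + F + 2 * e * B"
      "(\<Sum>j\<in>set js. \<bar>row_mass u j - col_mass u j\<bar>) \<le> 2 * F + 2 * e * B"
    using sweep_estimates[OF assms(1) sub assms(3,4) e4] S by auto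
  have "(\<Sum>j\<in>set js. row_mass u j + col_mass u j) = 2 * S"
    unfolding assms(2) sum.distrib by (simp add: S_def mass_eq_col_mass[of u]) (simp add: mass_eq_col_mass[symmetric] mass_def)
  then have B1: "B \<le> 2 * S + F + 2 * e * B" using DFB by simp
  have I1: "g * S \<le> 2 * F + 2 * e * B" using DFB(7) S unfolding assms(2) g_def imbalance_def[symmetric] by simp
  have eB: "e * B \<le> B / 16" using assms(4,5) DFB(3) mult_right_mono[of e "1/16" B] by simp
  \<comment> \<open>the decrease of the mass cannot exceed the mass\<close>
  have D1: "D \<le> S + e\<^sup>2 * B" using DFB(4) mass_pos[of v] by simp
  \<comment> \<open>a bound on \<open>F\<close> with coefficient of \<open>B\<close> below 1, so that \<open>B\<close> can be absorbed\<close>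
  have "F\<^sup>2 \<le> 2 * (S + e\<^sup>2 * B) * B"
    using DFB(5) mult_right_mono[OF D1 DFB(3)] by (simp add: algebra_simps)
  also have "\<dots> \<le> (S + B / 2 + 2 * e * B)\<^sup>2"
  proof -
    have "(S + B / 2 + 2 * e * B)\<^sup>2 - 2 * (S + e\<^sup>2 * B) * B
        = (S - B / 2)\<^sup>2 + 2 * e\<^sup>2 * B\<^sup>2 + 4 * e * B * S + 2 * e * B\<^sup>2"
      by (simp add: power2_eq_square algebra_simps)
    moreover have "0 \<le> 2 * e\<^sup>2 * B\<^sup>2" "0 \<le> 4 * e * B * S" "0 \<le> 2 * e * B\<^sup>2" "0 \<le> (S - B / 2)\<^sup>2"
      using assms(4) DFB(3) S by auto
    ultimately show ?thesis by linarith
  qed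
  finally have "F \<le> S + B / 2 + 2 * e * B"
    by (rule power2_le_imp_le) (use S DFB(3) assms(4) in auto)
  then have B2: "B \<le> 12 * S" using B1 eB by linarith
  have E: "e\<^sup>2 * B \<le> 12 * e\<^sup>2 * S" using mult_left_mono[OF B2, of "e\<^sup>2"] by simp
  have "e\<^sup>2 \<le> (1/16)\<^sup>2" using assms(4,5) by (intro power_mono) auto
  then have "12 * e\<^sup>2 * S \<le> 1 * S" using S by (intro mult_right_mono) (auto simp: power2_eq_square)
  then show "mass v \<le> 2 * mass u" using E DFB(1,4) S by linarith
  assume "200 * e \<le> imbalance u / mass u"
  then have g: "200 * e \<le> g" "0 \<le> g" using assms(4) by (auto simp: g_def)
  have "2 * e * B \<le> 24 * (e * S)" using mult_left_mono[OF B2, of "2 * e"] assms(4) by simp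
  also have "\<dots> \<le> 24 * (g / 200 * S)" using g S by (intro mult_left_mono mult_right_mono) auto
  \<comment> \<open>\<open>24 / 200 = 12 / 100\<close> of the imbalance may be due to errors, and \<open>(44 / 100)\<^sup>2 = 1936 / 10000\<close>\<close>
  finally have "2 * F \<ge> g * S * (88 / 100)" using I1 by (simp add: algebra_simps)
  then have "F \<ge> g * S * (44/100)" by (simp add: algebra_simps)
  then have "(g * S * (44/100))\<^sup>2 \<le> F\<^sup>2" using g S by (intro power_mono) auto
  also have "\<dots> \<le> 24 * D * S" using DFB(1,5) mult_left_mono[OF B2, of "2 * D"] by (simp add: algebra_simps)
  finally have "S * (g\<^sup>2 * S * (1936/10000)) \<le> S * (24 * D)"
    by (simp add: power2_eq_square algebra_simps)
  then have D2: "g\<^sup>2 * S * (1936/10000) \<le> 24 * D" using S by simp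
  have "e\<^sup>2 \<le> (g / 200)\<^sup>2" using g assms(4) by (intro power_mono) auto
  then have "12 * e\<^sup>2 * S \<le> 12 * (g / 200)\<^sup>2 * S" using S by simp
  also have "\<dots> = g\<^sup>2 * S * (3 / 10000)" by (simp add: power2_eq_square)
  finally have "mass v \<le> S - g\<^sup>2 * S * (1936/240000) + g\<^sup>2 * S * (3 / 10000)"
    using DFB(4) E D2 by linarith
  also have "\<dots> \<le> S - g\<^sup>2 * S * (1/800)"
  proof -
    have "0 \<le> g\<^sup>2 * S" using S by simp
    then show ?thesis by linarith
  qed
  finally show "mass v \<le> mass u * (1 - (imbalance u / mass u)\<^sup>2 / 800)"
    unfolding g_def[symmetric] unfolding S_def[symmetric] by (simp add: algebra_simps)
qed

section \<open>Inexact updates as perturbed exact updates\<close>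

lemma row_mass_edges: "j < n \<Longrightarrow> row_mass u j = (\<Sum>i\<in>{i. (j, i) \<in> edges n A}. weight u j i)"
  unfolding row_mass_def by (rule sum.mono_neutral_right) (auto simp: edges_def weight_def)

lemma col_mass_edges: "j < n \<Longrightarrow> col_mass u j = (\<Sum>i\<in>{i. (i, j) \<in> edges n A}. weight u i j)"
  unfolding col_mass_def by (rule sum.mono_neutral_right) (auto simp: edges_def weight_def)

text \<open>
  The normalisation \<open>s\<close> shifts both logarithms by the same amount, so it cancels in an update.
\<close>

lemma log_sums_close:
  assumes s: "0 < s" and j: "j < n"
    and L: "\<forall>(i, j)\<in>edges n A. \<bar>L i j - ln (A $$ (i, j) / s)\<bar> \<le> \<gamma>"
  shows "\<bar>log_row n A L u j - (ln (row_mass u j) - ln s)\<bar> \<le> \<gamma>"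
    and "\<bar>log_col n A L u j - (ln (col_mass u j) - ln s)\<bar> \<le> \<gamma>"
proof -
  have close: "\<bar>(u i - u j + L i j) - ln (weight u i j / s)\<bar> \<le> \<gamma>" if "(i, j) \<in> edges n A" for i j
  proof -
    have "ln (weight u i j / s) = u i - u j + ln (A $$ (i, j) / s)"
      using edge_pos[OF that] s by (simp add: weight_def ln_mult ln_div)
    then show ?thesis using L that by auto
  qed
  have fin: "finite {i. (j, i) \<in> edges n A}" "finite {i. (i, j) \<in> edges n A}"
    by (rule finite_subset[of _ "{..<n}"]; auto simp: edges_def)+
  have "\<bar>log_row n A L u j - ln (\<Sum>i\<in>{i. (j, i) \<in> edges n A}. weight u j i / s)\<bar> \<le> \<gamma>"
    unfolding log_row_def
    by (rule ln_sum_perturb) (use fin out_edge[OF j] close s edge_weight_pos in auto)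
  then show "\<bar>log_row n A L u j - (ln (row_mass u j) - ln s)\<bar> \<le> \<gamma>"
    using s row_mass_pos[OF j, of u] by (simp add: row_mass_edges[OF j] ln_div flip: sum_divide_distrib)
  have "\<bar>log_col n A L u j - ln (\<Sum>i\<in>{i. (i, j) \<in> edges n A}. weight u i j / s)\<bar> \<le> \<gamma>"
    unfolding log_col_def
    by (rule ln_sum_perturb) (use fin in_edge[OF j] close s edge_weight_pos in auto)
  then show "\<bar>log_col n A L u j - (ln (col_mass u j) - ln s)\<bar> \<le> \<gamma>"
    using s col_mass_pos[OF j, of u] by (simp add: col_mass_edges[OF j] ln_div flip: sum_divide_distrib)
qed

lemma inexact_update_balance_step:
  assumes s: "0 < s" and j: "j < n"
    and L: "\<forall>(i, j)\<in>edges n A. \<bar>L i j - ln (A $$ (i, j) / s)\<bar> \<le> \<gamma>"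
    and up: "inexact_update n A L \<gamma>' j u v"
  shows "balance_step (\<gamma> + 2 * \<gamma>') j u v"
proof -
  obtain y z where yz: "\<bar>y - (u j + log_col n A L u j / 2 - log_row n A L u j / 2)\<bar> \<le> \<gamma>'"
     "\<bar>z - y\<bar> \<le> \<gamma>'" "v = u(j := z)" using up unfolding inexact_update_def by auto
  have "\<bar>z - (u j + ln (col_mass u j) / 2 - ln (row_mass u j) / 2)\<bar> \<le> \<gamma> + 2 * \<gamma>'"
    using yz(1,2) log_sums_close[OF s j L, of u] unfolding abs_le_iff by argo
  then show ?thesis unfolding balance_step_def yz(3)
    by (intro exI[of _ "z - (u j + ln (col_mass u j) / 2 - ln (row_mass u j) / 2)"]) auto
qed

lemma inexact_sweep_balance_sweep:
  assumes s: "0 < s" and L: "\<forall>(i, j)\<in>edges n A. \<bar>L i j - ln (A $$ (i, j) / s)\<bar> \<le> \<gamma>"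
    and "set js \<subseteq> {..<n}" "inexact_sweep n A L \<gamma>' js u v"
  shows "balance_sweep (\<gamma> + 2 * \<gamma>') js u v"
  using assms(3,4)
proof (induction js arbitrary: u)
  case (Cons j js)
  then show ?case using inexact_update_balance_step[OF s _ L] by fastforce
qed simp

section \<open>Diameter and convexity\<close>

text \<open>
  The weight of a single edge is at most the mass.
\<close>

lemma edge_difference_le:
  assumes "mass u \<le> 2 * mass (\<lambda>_. 0)" "(i, j) \<in> edges n A"
  shows "u i - u j \<le> ln (2 * kappa n A)"
proof -
  note ij = edge_bounds[OF assms(2)]
  have "min_entry n A * exp (u i - u j) \<le> weight u i j"
    unfolding weight_def using min_entry_le[OF assms(2)] by (intro mult_right_mono) auto
  also have "\<dots> \<le> 2 * entry_sum n A"
    using weight_le_row_mass[of i j u] row_mass_le_mass[of i u] ij assms(1) mass_zero by linarith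
  finally have "exp (u i - u j) \<le> 2 * kappa n A"
    unfolding kappa_def using min_entry_pos by (simp add: field_simps)
  then show ?thesis using kappa_ge_2 by (subst ln_ge_iff) auto
qed

lemma walk_difference_le:
  assumes "mass u \<le> 2 * mass (\<lambda>_. 0)" "(i, j) \<in> edges n A ^^ l"
  shows "u i - u j \<le> real l * ln (2 * kappa n A)"
  using assms(2)
proof (induction l arbitrary: j)
  case (Suc l)
  then obtain k where "(i, k) \<in> edges n A ^^ l" "(k, j) \<in> edges n A" by auto
  with Suc.IH[of k] edge_difference_le[OF assms(1), of k j] show ?case by (simp add: algebra_simps)
qed auto

lemma path_dist_walk:
  assumes "i < n" "j < n" shows "(i, j) \<in> edges n A ^^ path_dist n A i j"
proof -
  have "(i, j) \<in> (edges n A)\<^sup>*" using assms balanceable by (auto simp: balanceable_def)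
  then obtain l where "(i, j) \<in> edges n A ^^ l" by (auto dest: rtrancl_imp_relpow)
  then show ?thesis unfolding path_dist_def by (rule LeastI)
qed

lemma path_dist_le_diameter: "i < n \<Longrightarrow> j < n \<Longrightarrow> path_dist n A i j \<le> graph_diameter n A"
  unfolding graph_diameter_def by (rule Max_ge) auto

lemma graph_diameter_pos: "1 \<le> graph_diameter n A"
proof -
  have "path_dist n A 0 1 \<noteq> 0" using path_dist_walk[of 0 1] n_ge_2 by (auto intro: ccontr)
  then show ?thesis using path_dist_le_diameter[of 0 1] n_ge_2 by simp
qed

lemma oscillation_le:
  assumes "mass u \<le> 2 * mass (\<lambda>_. 0)" "i < n" "j < n"
  shows "\<bar>u i - u j\<bar> \<le> 2 * real (graph_diameter n A) * ln (kappa n A)"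
proof -
  have k: "ln (2 * kappa n A) \<le> 2 * ln (kappa n A)" "0 \<le> ln (2 * kappa n A)"
    using kappa_ge_2 by (auto simp: ln_mult)
  have "u i - u j \<le> 2 * real (graph_diameter n A) * ln (kappa n A)" if "i < n" "j < n" for i j
  proof -
    have "u i - u j \<le> real (path_dist n A i j) * ln (2 * kappa n A)"
      by (rule walk_difference_le[OF assms(1) path_dist_walk[OF that]])
    also have "\<dots> \<le> real (graph_diameter n A) * (2 * ln (kappa n A))"
      using k path_dist_le_diameter[OF that] by (intro mult_mono) auto
    finally show ?thesis by simp
  qed
  from this[OF assms(2,3)] this[OF assms(3,2)] show ?thesis by linarith
qed

text \<open>
  The tangent inequality of the convex function \<open>ln S\<close> at \<open>u\<close>, whose gradient is
  \<open>(r - c) / S(u)\<close>. It is proved as Jensen's inequality for \<open>exp\<close> with the weights of \<open>u\<close>.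
\<close>

lemma ln_mass_convex:
  "ln (mass u) - ln (mass v) \<le> (\<Sum>j<n. (row_mass u j - col_mass u j) * (u j - v j)) / mass u"
proof -
  define y where "y = (\<lambda>i. v i - u i)"
  define a where "a = (\<Sum>j<n. (row_mass u j - col_mass u j) * y j) / mass u"
  have aS: "a * mass u = (\<Sum>j<n. (row_mass u j - col_mass u j) * y j)"
    using mass_pos[of u] by (simp add: a_def)
  have "(\<Sum>i<n. \<Sum>j<n. weight u i j * (y i - y j)) = (\<Sum>i<n. \<Sum>j<n. weight u i j * y i) - (\<Sum>i<n. \<Sum>j<n. weight u i j * y j)"
    by (simp add: right_diff_distrib sum_subtractf)
  also have "(\<Sum>i<n. \<Sum>j<n. weight u i j * y j) = (\<Sum>j<n. \<Sum>i<n. weight u i j * y j)" by (rule sum.swap)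
  also have "(\<Sum>i<n. \<Sum>j<n. weight u i j * y i) - \<dots> = a * mass u"
    unfolding aS by (simp add: row_mass_def col_mass_def left_diff_distrib sum_subtractf sum_distrib_right)
  finally have lin: "(\<Sum>i<n. \<Sum>j<n. weight u i j * (y i - y j)) = a * mass u" .
  \<comment> \<open>the terms linear in \<open>y i - y j - a\<close> cancel, as \<open>a\<close> is the weighted mean of \<open>y i - y j\<close>\<close>
  have "mass u * exp a = (\<Sum>i<n. \<Sum>j<n. weight u i j * (exp a * (1 + (y i - y j) - a)))"
  proof -
    have "(\<Sum>i<n. \<Sum>j<n. weight u i j * (exp a * (1 + (y i - y j) - a)))
        = (\<Sum>i<n. \<Sum>j<n. (exp a * (1 - a)) * weight u i j + exp a * (weight u i j * (y i - y j)))"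
      by (intro sum.cong refl) (simp add: algebra_simps)
    also have "\<dots> = (exp a * (1 - a)) * mass u + exp a * (a * mass u)"
      unfolding sum.distrib sum_distrib_left[symmetric] lin by (simp add: mass_def row_mass_def)
    finally show ?thesis by (simp add: algebra_simps)
  qed
  also have "\<dots> \<le> (\<Sum>i<n. \<Sum>j<n. weight v i j)"
  proof (intro sum_mono)
    fix i j assume ij: "i \<in> {..<n}" "j \<in> {..<n}"
    have "exp a * (1 + (y i - y j) - a) \<le> exp a * exp (y i - y j - a)"
      using exp_ge_add_one_self[of "y i - y j - a"] by (intro mult_left_mono) (linarith | simp)+
    also have "\<dots> = exp (y i - y j)" by (simp flip: exp_add)
    finally have "weight u i j * (exp a * (1 + (y i - y j) - a)) \<le> weight u i j * exp (y i - y j)"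
      using ij weight_nonneg by (intro mult_left_mono) auto
    also have "\<dots> = weight v i j" by (simp add: weight_def y_def algebra_simps flip: exp_add)
    finally show "weight u i j * (exp a * (1 + (y i - y j) - a)) \<le> weight v i j" .
  qed
  also have "\<dots> = mass v" by (simp add: mass_def row_mass_def)
  finally have "ln (mass u * exp a) \<le> ln (mass v)" using mass_pos by simp
  then have "ln (mass u) + a \<le> ln (mass v)" using mass_pos[of u] by (simp add: ln_mult)
  moreover have "- a = (\<Sum>j<n. (row_mass u j - col_mass u j) * (u j - v j)) / mass u"
    unfolding a_def y_def minus_divide_left sum_negf[symmetric] by (simp add: algebra_simps)
  ultimately show ?thesis by linarith
qed

text \<open>
  Since the gradient has coordinate sum \<open>0\<close>, only the oscillations of \<open>u\<close> and \<open>v\<close> matter and not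
  their size. Comparing with an arbitrary \<open>v\<close> instead of a minimiser means that no exact balancing
  has to be constructed.
\<close>

lemma ln_mass_gap_le:
  assumes "mass u \<le> 2 * mass (\<lambda>_. 0)" "mass v \<le> 2 * mass (\<lambda>_. 0)"
  shows "ln (mass u) - ln (mass v)
    \<le> 4 * real (graph_diameter n A) * ln (kappa n A) * (imbalance u / mass u)"
proof -
  define R where "R = 4 * real (graph_diameter n A) * ln (kappa n A)"
  define y where "y = (\<lambda>j. u j - v j)"
  have z: "0 < n" using n_ge_2 by simp
  have y: "\<bar>y j - y 0\<bar> \<le> R" if "j < n" for j
    using oscillation_le[OF assms(1) that z] oscillation_le[OF assms(2) that z]
    unfolding y_def R_def by linarith
  \<comment> \<open>the gradient is orthogonal to constant vectors\<close>
  have "(\<Sum>j<n. (row_mass u j - col_mass u j)) = 0"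
    by (simp add: sum_subtractf flip: mass_def mass_eq_col_mass)
  then have "(\<Sum>j<n. (row_mass u j - col_mass u j) * y j) = (\<Sum>j<n. (row_mass u j - col_mass u j) * (y j - y 0))"
    by (simp add: right_diff_distrib sum_subtractf flip: sum_distrib_right)
  also have "\<dots> \<le> (\<Sum>j<n. \<bar>row_mass u j - col_mass u j\<bar> * R)"
  proof (rule sum_mono)
    fix j assume "j \<in> {..<n}"
    then have "\<bar>row_mass u j - col_mass u j\<bar> * \<bar>y j - y 0\<bar> \<le> \<bar>row_mass u j - col_mass u j\<bar> * R"
      using y by (intro mult_left_mono) auto
    then show "(row_mass u j - col_mass u j) * (y j - y 0) \<le> \<bar>row_mass u j - col_mass u j\<bar> * R"
      unfolding abs_mult[symmetric] by linarith
  qed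
  also have "\<dots> = imbalance u * R" by (simp add: imbalance_def sum_distrib_right)
  finally have "(\<Sum>j<n. (row_mass u j - col_mass u j) * y j) / mass u \<le> imbalance u * R / mass u"
    using mass_pos[of u] by (intro divide_right_mono) auto
  then show ?thesis using ln_mass_convex[of u v] unfolding y_def R_def[symmetric]
    by (simp add: mult.commute)
qed

section \<open>The number of sweeps\<close>

text \<open>
  The algorithm performs no test before the first sweep, so this sweep is only known not to more
  than double the mass; the count starts after it. The second bound
  applies \<open>quadratic_decrease\<close> to \<open>x = \<phi> k - \<phi> K + R a\<close> with \<open>R = 4 d ln \<kappa>\<close> and \<open>\<phi> = ln S\<close>. Adding
  \<open>R a\<close> to the gap covers in one argument the phase in which the gap dominates and the phase in
  which the lower bound \<open>a\<close> on the imbalance does.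
\<close>

lemma cycles_bound:
  assumes U0: "U 0 = (\<lambda>_. 0)"
    and sweeps: "\<And>k. k < K \<Longrightarrow> \<exists>js. distinct js \<and> set js = {..<n} \<and> balance_sweep e js (U k) (U (Suc k))"
    and large: "\<And>k. 1 \<le> k \<Longrightarrow> k < K \<Longrightarrow> a \<le> imbalance (U k) / mass (U k)"
    and e: "0 \<le> e" "e \<le> 1 / 16" "200 * e \<le> a" and a: "0 < a" and K: "1 \<le> K"
  shows "real K - 1 \<le> 1600 * ln (kappa n A) / a\<^sup>2"
    and "real K - 1 \<le> 12800 * real (graph_diameter n A) * ln (kappa n A) / a"
proof -
  define \<phi> where "\<phi> = (\<lambda>k. ln (mass (U k)))"
  define g where "g = (\<lambda>k. imbalance (U k) / mass (U k))"
  have first: "mass (U 1) \<le> 2 * mass (\<lambda>_. 0)"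
    using sweeps[of 0] K mass_after_sweep(1)[OF _ _ _ e(1,2)] U0 by force
  have dec: "mass (U (Suc k)) \<le> mass (U k) * (1 - (g k)\<^sup>2 / 800)" if k: "1 \<le> k" "k < K" for k
  proof -
    obtain js where js: "distinct js" "set js = {..<n}" "balance_sweep e js (U k) (U (Suc k))"
      using sweeps[OF k(2)] by auto
    show ?thesis unfolding g_def
      by (rule mass_after_sweep(2)[OF js e(1,2)]) (use large[OF k] e in auto)
  qed
  have \<phi>: "\<phi> (Suc k) \<le> \<phi> k - (g k)\<^sup>2 / 800" if k: "1 \<le> k" "k < K" for k
  proof -
    have p: "0 < mass (U k) * (1 - (g k)\<^sup>2 / 800)" using dec[OF k] mass_pos[of "U (Suc k)"] by linarith
    then have q: "0 < 1 - (g k)\<^sup>2 / 800" using mass_pos[of "U k"] by (simp add: zero_less_mult_iff)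
    have "\<phi> (Suc k) \<le> ln (mass (U k) * (1 - (g k)\<^sup>2 / 800))"
      unfolding \<phi>_def using dec[OF k] mass_pos[of "U (Suc k)"] p by simp
    also have "\<dots> = \<phi> k + ln (1 - (g k)\<^sup>2 / 800)"
      unfolding \<phi>_def using mass_pos[of "U k"] q by (simp add: ln_mult)
    finally show ?thesis using ln_le_minus_one[OF q] by simp
  qed
  have mass_le: "k \<le> K \<longrightarrow> mass (U k) \<le> 2 * mass (\<lambda>_. 0)" if "1 \<le> k" for k
    using that
  proof (induction k rule: dec_induct)
    case (step k)
    show ?case
    proof
      assume k: "Suc k \<le> K"
      have "mass (U (Suc k)) \<le> mass (U k) * (1 - (g k)\<^sup>2 / 800)" using dec step k by auto
      also have "\<dots> \<le> mass (U k) * 1" using mass_pos[of "U k"] by (intro mult_left_mono) auto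
      finally show "mass (U (Suc k)) \<le> 2 * mass (\<lambda>_. 0)" using step k by auto
    qed
  qed (use first in auto)
  have lk: "1 / 2 \<le> ln (kappa n A)" by (rule ln_kappa_ge)
  have "\<phi> 1 \<le> ln (2 * mass (\<lambda>_. 0))" unfolding \<phi>_def using first mass_pos by simp
  also have "\<dots> = ln 2 + ln (mass (\<lambda>_. 0))" using mass_pos[of "\<lambda>_. 0"] by (simp add: ln_mult)
  also have "ln 2 \<le> ln (kappa n A)" using kappa_ge_2 by simp
  finally have range: "\<phi> 1 - \<phi> K \<le> 2 * ln (kappa n A)"
    using ln_mass_range[of "U K"] unfolding \<phi>_def by linarith
  have ag: "a \<le> g k" if "1 \<le> k" "k < K" for k using large[OF that] by (simp add: g_def)
  have "k \<le> K \<longrightarrow> (real k - 1) * (a\<^sup>2 / 800) \<le> \<phi> 1 - \<phi> k" if "1 \<le> k" for k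
    using that
  proof (induction k rule: dec_induct)
    case (step k)
    show ?case
    proof
      assume k: "Suc k \<le> K"
      have "a\<^sup>2 \<le> (g k)\<^sup>2" using ag[of k] k step a by (intro power_mono) auto
      then have "\<phi> (Suc k) \<le> \<phi> k - a\<^sup>2 / 800" using \<phi>[of k] k step by simp
      moreover have "(real k - 1) * (a\<^sup>2 / 800) \<le> \<phi> 1 - \<phi> k" using step k by simp
      moreover have "(real (Suc k) - 1) * (a\<^sup>2 / 800) = (real k - 1) * (a\<^sup>2 / 800) + a\<^sup>2 / 800"
        by (simp add: field_simps)
      ultimately show "(real (Suc k) - 1) * (a\<^sup>2 / 800) \<le> \<phi> 1 - \<phi> (Suc k)" by linarith
    qed
  qed simp
  then have "(real K - 1) * (a\<^sup>2 / 800) \<le> 2 * ln (kappa n A)" using K range by force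
  then show "real K - 1 \<le> 1600 * ln (kappa n A) / a\<^sup>2" using a by (simp add: field_simps)
  define R where "R = 4 * real (graph_diameter n A) * ln (kappa n A)"
  have R: "0 < R" unfolding R_def using graph_diameter_pos lk by simp
  define x where "x = (\<lambda>k. \<phi> k - \<phi> K + R * a)"
  have "antimono_on {1..K} \<phi>"
  proof -
    have "k \<le> K \<longrightarrow> \<phi> k \<le> \<phi> j" if "1 \<le> j" "j \<le> k" for j k
      using that(2)
    proof (induction k rule: dec_induct)
      case (step k)
      then show ?case using \<phi>[of k] that(1) by (smt (verit) Suc_le_lessD le_trans less_imp_le_nat zero_le_power2 divide_nonneg_nonneg)
    qed simp
    then show ?thesis by (auto simp: monotone_on_def)
  qed
  then have xpos: "0 < x k" if "1 \<le> k" "k \<le> K" for k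
    using that R a K mult_pos_pos[OF R a] unfolding x_def monotone_on_def by (smt (verit) atLeastAtMost_iff order_refl)
  have xstep: "x (Suc k) \<le> x k - (1 / (3200 * R\<^sup>2)) * (x k)\<^sup>2" if k: "1 \<le> k" "k < K" for k
  proof -
    \<comment> \<open>the imbalance dominates both summands of \<open>x k\<close>\<close>
    have "\<phi> k - \<phi> K \<le> R * g k" unfolding \<phi>_def g_def R_def
      by (rule ln_mass_gap_le) (use mass_le k K in auto)
    moreover have "R * a \<le> R * g k" using ag[OF k] R by simp
    ultimately have "x k \<le> 2 * R * g k" unfolding x_def by simp
    then have "(x k)\<^sup>2 \<le> (2 * R * g k)\<^sup>2" using xpos[of k] k by (intro power_mono) auto
    then have "(x k)\<^sup>2 / (3200 * R\<^sup>2) \<le> (g k)\<^sup>2 / 800" using R by (simp add: field_simps power_mult_distrib)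
    then show ?thesis using \<phi>[OF k] unfolding x_def by simp
  qed
  have "(1 / (3200 * R\<^sup>2)) * (real K - 1) \<le> 1 / x K"
    by (rule quadratic_decrease) (use xpos xstep K in auto)
  also have "x K = R * a" by (simp add: x_def)
  finally have "(1 / (3200 * R\<^sup>2)) * (real K - 1) * (3200 * R\<^sup>2) \<le> 1 / (R * a) * (3200 * R\<^sup>2)"
    using R by (intro mult_right_mono) auto
  then have "real K - 1 \<le> 3200 * R / a" using R a by (simp add: power2_eq_square)
  then show "real K - 1 \<le> 12800 * real (graph_diameter n A) * ln (kappa n A) / a"
    by (simp add: R_def)
qed

text \<open>
  Absorbs the first sweep into the asymptotic bound.
\<close>

lemma one_le_cycle_bound:
  assumes "0 < \<epsilon>" "\<epsilon> < 1"
  shows "1 \<le> 2 * (ln (kappa n A) / \<epsilon> * min (1 / \<epsilon>) (real (graph_diameter n A)))"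
proof -
  have m: "1 \<le> min (1 / \<epsilon>) (real (graph_diameter n A))" using assms graph_diameter_pos by simp
  have "1 / 2 / 1 \<le> ln (kappa n A) / \<epsilon>" using ln_kappa_ge assms by (intro frac_le) auto
  then have "1 / 2 * 1 \<le> ln (kappa n A) / \<epsilon> * min (1 / \<epsilon>) (real (graph_diameter n A))"
    using m ln_kappa_ge assms by (intro mult_mono) (auto intro!: divide_nonneg_nonneg)
  then show ?thesis by (simp add: mult_ac)
qed

text \<open>
  While the estimate exceeds the threshold \<open>\<epsilon> / 3\<close>, the imbalance is at least
  \<open>(\<epsilon> / 3 - \<epsilon> / 6) / 2 = \<epsilon> / 12\<close>. Once it does not, the imbalance is at most
  \<open>2 (\<epsilon> / 3 + \<epsilon> / 6) = \<epsilon>\<close>.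
\<close>

lemma inexact_run_bounds:
  assumes s: "0 < s" and \<epsilon>: "0 < \<epsilon>" "\<epsilon> < 1" and perm: "\<And>k. bij_betw (\<pi> k) {..<n} {..<n}"
    and \<gamma>: "0 \<le> \<gamma>" "0 \<le> \<gamma>'" "\<gamma> + 2 * \<gamma>' \<le> \<epsilon> / 2400"
    and run: "inexact_run n A s \<pi> \<gamma> \<gamma>' (\<epsilon> / 3) (\<epsilon> / 3) L U g K"
  shows "real K \<le> 240000 * (ln (kappa n A) / \<epsilon> * min (1 / \<epsilon>) (real (graph_diameter n A)))"
    and "1 \<le> K \<Longrightarrow> g K \<le> \<epsilon> / 3 \<Longrightarrow> eps_balancing n A \<epsilon> (U K)"
proof -
  have L: "\<forall>(i, j)\<in>edges n A. \<bar>L i j - ln (A $$ (i, j) / s)\<bar> \<le> \<gamma>" and U0: "U 0 = (\<lambda>_. 0)"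
    and sweep: "\<And>k. k < K \<Longrightarrow> inexact_sweep n A L \<gamma>' (map (\<pi> k) [0..<n]) (U k) (U (Suc k))"
    and est: "\<And>k. 1 \<le> k \<Longrightarrow> k \<le> K \<Longrightarrow> rel_imbalance n A (U k) / 2 - \<epsilon> / 3 / 2 \<le> g k"
      "\<And>k. 1 \<le> k \<Longrightarrow> k \<le> K \<Longrightarrow> g k \<le> 2 * rel_imbalance n A (U k) + \<epsilon> / 3 / 2"
    and cont: "\<And>k. 1 \<le> k \<Longrightarrow> k < K \<Longrightarrow> \<epsilon> / 3 < g k"
    using run unfolding inexact_run_def by auto
  define B where "B = ln (kappa n A) / \<epsilon> * min (1 / \<epsilon>) (real (graph_diameter n A))"
  show "real K \<le> 240000 * (ln (kappa n A) / \<epsilon> * min (1 / \<epsilon>) (real (graph_diameter n A)))"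
  proof (cases "1 \<le> K")
    case True
    have sw: "\<exists>js. distinct js \<and> set js = {..<n} \<and> balance_sweep (\<gamma> + 2 * \<gamma>') js (U k) (U (Suc k))" if "k < K" for k
    proof (intro exI conjI)
      have "inj_on (\<pi> k) {0..<n}" "\<pi> k ` {0..<n} = {..<n}"
        using perm[of k] by (auto simp: bij_betw_def lessThan_atLeast0)
      then show "distinct (map (\<pi> k) [0..<n])" and set: "set (map (\<pi> k) [0..<n]) = {..<n}"
        by (auto simp: distinct_map)
      show "balance_sweep (\<gamma> + 2 * \<gamma>') (map (\<pi> k) [0..<n]) (U k) (U (Suc k))"
        by (rule inexact_sweep_balance_sweep[OF s L]) (use set sweep[OF that] in auto)
    qed
    have large: "\<epsilon> / 12 \<le> imbalance (U k) / mass (U k)" if "1 \<le> k" "k < K" for k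
      using est(2)[of k] cont[OF that] that by (simp flip: rel_imbalance_eq)
    note bounds = cycles_bound[of U K "\<gamma> + 2 * \<gamma>'" "\<epsilon> / 12", OF U0 sw large]
    have b1: "real K - 1 \<le> 230400 * (ln (kappa n A) / \<epsilon> * (1 / \<epsilon>))"
      using bounds(1) \<gamma> \<epsilon> True by (simp add: power2_eq_square)
    have b2: "real K - 1 \<le> 230400 * (ln (kappa n A) / \<epsilon> * real (graph_diameter n A))"
    proof -
      have "real K - 1 \<le> 153600 * (ln (kappa n A) / \<epsilon> * real (graph_diameter n A))"
        using bounds(2) \<gamma> \<epsilon> True by (simp add: algebra_simps)
      also have "\<dots> \<le> 230400 * (ln (kappa n A) / \<epsilon> * real (graph_diameter n A))"
        using ln_kappa_ge \<epsilon> by (intro mult_right_mono) auto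
      finally show ?thesis .
    qed
    have "real K - 1 \<le> 230400 * B" unfolding B_def min_def using b1 b2 by auto
    moreover have "1 \<le> 2 * B" using one_le_cycle_bound[OF \<epsilon>] by (simp add: B_def)
    ultimately have "real K \<le> 240000 * B" by linarith
    then show ?thesis by (simp add: B_def)
  next
    case False
    then show ?thesis using one_le_cycle_bound[OF \<epsilon>] by auto
  qed
  assume K: "1 \<le> K" "g K \<le> \<epsilon> / 3"
  then have "rel_imbalance n A (U K) \<le> \<epsilon>" using est(1)[OF K(1) order_refl] by simp
  then have "imbalance (U K) / mass (U K) \<le> \<epsilon>" by (simp add: rel_imbalance_eq)
  then show "eps_balancing n A \<epsilon> (U K)"
    unfolding eps_balancing_def l1_imbalance_scaled entry_sum_scaled using mass_pos[of "U K"] by (simp add: field_simps)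
qed

end

section \<open>Fixed-point arithmetic\<close>

lemma run_state_bind: "run_state (m \<bind> f) tr = (case run_state m tr of (x, tr') \<Rightarrow> run_state (f x) tr')"
  by (simp add: State_Monad.bind_def)

lemma run_state_return: "run_state (State_Monad.return x) tr = (x, tr)"
  by (simp add: State_Monad.return_def)

lemma run_state_fx: "run_state (fx p x) tr = (round_down (int p) x, round_down (int p) x # tr)"
  by (simp add: fx_def Let_def run_state_bind run_state_return State_Monad.get_def State_Monad.set_def)

text \<open>
  Value, cost and a property of all intermediate results are tracked in one judgement that does
  not refer to the operations performed before; thus it composes along a program.
\<close>

definition computes :: "'a arith \<Rightarrow> nat \<Rightarrow> (real \<Rightarrow> bool) \<Rightarrow> 'a \<Rightarrow> bool" where
  "computes m N Q x \<longleftrightarrow>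
     (\<exists>ws. (\<forall>tr. run_state m tr = (x, ws @ tr)) \<and> length ws \<le> N \<and> (\<forall>w\<in>set ws. Q w))"

lemma computes_return: "computes (State_Monad.return x) N Q x"
  unfolding computes_def by (intro exI[of _ "[]"]) (simp add: run_state_return)

lemma computes_bind:
  assumes "computes m N Q x" "computes (f x) N' Q y" "N + N' \<le> M"
  shows "computes (m \<bind> f) M Q y"
proof -
  obtain ws where "\<forall>tr. run_state m tr = (x, ws @ tr)" "length ws \<le> N" "\<forall>w\<in>set ws. Q w"
    using assms(1) unfolding computes_def by auto
  moreover obtain vs where "\<forall>tr. run_state (f x) tr = (y, vs @ tr)" "length vs \<le> N'" "\<forall>w\<in>set vs. Q w"
    using assms(2) unfolding computes_def by auto
  ultimately show ?thesis unfolding computes_def using assms(3)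
    by (intro exI[of _ "vs @ ws"]) (auto simp: run_state_bind)
qed

text \<open>
  Variant of \<open>computes_bind\<close> for stepping through a program with a given operation budget \<open>M\<close>.
\<close>

lemma computes_step:
  "computes m N Q x \<Longrightarrow> computes (f x) (M - N) Q y \<Longrightarrow> N \<le> M \<Longrightarrow> computes (m \<bind> f) M Q y"
  by (rule computes_bind) auto

lemma computes_mono: "computes m N Q x \<Longrightarrow> N \<le> M \<Longrightarrow> computes m M Q x"
  unfolding computes_def by (meson order_trans)

lemma computes_fx:
  "round_down (int p) x = y \<Longrightarrow> Q y \<Longrightarrow> 1 \<le> N \<Longrightarrow> computes (fx p x) N Q y"
  unfolding computes_def by (intro exI[of _ "[y]"]) (auto simp: run_state_fx)

lemma computes_value: "computes m N Q x \<Longrightarrow> fst (run_state m tr) = x"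
  by (auto simp: computes_def)

lemma computes_map:
  assumes "\<And>x. x \<in> set xs \<Longrightarrow> computes (f x) (N x) Q (h x)"
  shows "computes (map_arith f xs) (\<Sum>x\<leftarrow>xs. N x) Q (map h xs)"
  using assms
proof (induction xs)
  case (Cons x xs)
  have "computes (map_arith f xs) (\<Sum>x\<leftarrow>xs. N x) Q (map h xs)" by (rule Cons.IH) (use Cons.prems in auto)
  then have "computes (map_arith f xs \<bind> (\<lambda>ys. State_Monad.return (h x # ys)))
      (\<Sum>x\<leftarrow>xs. N x) Q (h x # map h xs)"
    by (rule computes_bind[where N' = 0]) (auto intro: computes_return)
  then show ?case
    by (auto intro!: computes_bind[OF Cons.prems[of x]])
qed (simp add: computes_return)

definition on_grid :: "nat \<Rightarrow> real \<Rightarrow> bool" where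
  "on_grid p x \<longleftrightarrow> (\<exists>k::int. x = real_of_int k / 2 ^ p)"

lemma round_down_eq: "round_down (int p) x = real_of_int \<lfloor>x * 2 ^ p\<rfloor> / 2 ^ p"
  by (simp add: round_down_def powr_minus_divide powr_realpow)

lemma on_grid_round_down: "on_grid p (round_down (int p) x)"
  unfolding on_grid_def round_down_eq by blast

lemma round_down_on_grid: "on_grid p x \<Longrightarrow> round_down (int p) x = x"
  by (auto simp: on_grid_def round_down_eq)

lemma on_grid_mono: assumes "q \<le> p" "on_grid q x" shows "on_grid p x"
proof -
  obtain k :: int where "x = k / 2 ^ q" using assms(2) by (auto simp: on_grid_def)
  then have "x = real_of_int (k * 2 ^ (p - q)) / 2 ^ p"
    using assms(1) power_add[of "2::real" q "p - q"] by (simp add: field_simps)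
  then show ?thesis unfolding on_grid_def by blast
qed

lemma on_grid_of_int: "on_grid p (real_of_int k)"
  unfolding on_grid_def by (intro exI[of _ "k * 2 ^ p"]) simp

lemma on_grid_0: "on_grid p 0" and on_grid_1: "on_grid p 1"
  using on_grid_of_int[of p 0] on_grid_of_int[of p 1] by auto

lemma on_grid_add: "on_grid p x \<Longrightarrow> on_grid p y \<Longrightarrow> on_grid p (x + y)"
  unfolding on_grid_def by (metis add_divide_distrib of_int_add)

lemma on_grid_diff: "on_grid p x \<Longrightarrow> on_grid p y \<Longrightarrow> on_grid p (x - y)"
  unfolding on_grid_def by (metis diff_divide_distrib of_int_diff)

lemma on_grid_abs: "on_grid p x \<Longrightarrow> on_grid p \<bar>x\<bar>"
  unfolding on_grid_def by (metis abs_divide abs_numeral of_int_abs power_abs)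

lemma round_down_lower: "x - 1 / 2 ^ p \<le> round_down (int p) x"
proof -
  have "x * 2 ^ p - 1 \<le> real_of_int \<lfloor>x * 2 ^ p\<rfloor>" by linarith
  then have "(x * 2 ^ p - 1) / 2 ^ p \<le> real_of_int \<lfloor>x * 2 ^ p\<rfloor> / 2 ^ p" by (rule divide_right_mono) simp
  then show ?thesis by (simp add: round_down_eq diff_divide_distrib)
qed

lemma round_down_mono: "x \<le> y \<Longrightarrow> round_down (int p) x \<le> round_down (int p) y"
  unfolding round_down_eq by (intro divide_right_mono) (auto intro!: floor_mono)

definition fixed_point :: "nat \<Rightarrow> real \<Rightarrow> real \<Rightarrow> bool" where
  "fixed_point p W x \<longleftrightarrow> on_grid p x \<and> \<bar>x\<bar> \<le> W"

lemma computes_fadd: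
  "on_grid p x \<Longrightarrow> on_grid p y \<Longrightarrow> \<bar>x + y\<bar> \<le> W \<Longrightarrow> computes (fadd p x y) 1 (fixed_point p W) (x + y)"
  unfolding fadd_def by (rule computes_fx) (auto simp: fixed_point_def on_grid_add round_down_on_grid)

lemma computes_fsub:
  "on_grid p x \<Longrightarrow> on_grid p y \<Longrightarrow> \<bar>x - y\<bar> \<le> W \<Longrightarrow> computes (fsub p x y) 1 (fixed_point p W) (x - y)"
  unfolding fsub_def by (rule computes_fx) (auto simp: fixed_point_def on_grid_diff round_down_on_grid)

text \<open>
  The sums are exact on the grid. Nonnegativity of the summands makes every partial sum obey the
  bound \<open>W\<close> of the final one.
\<close>

lemma computes_fsum_acc:
  assumes "\<And>x. x \<in> set xs \<Longrightarrow> on_grid p x \<and> 0 \<le> x" "on_grid p a" "0 \<le> a" "a + sum_list xs \<le> W"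
  shows "computes (fold_arith (fadd p) xs a) (length xs) (fixed_point p W) (a + sum_list xs)"
  using assms
proof (induction xs arbitrary: a)
  case (Cons x xs)
  have s: "0 \<le> sum_list xs" by (rule sum_list_nonneg) (use Cons.prems in auto)
  have g: "on_grid p (x + a)" using Cons.prems by (auto intro: on_grid_add)
  have "computes (fold_arith (fadd p) xs (x + a)) (length xs) (fixed_point p W) (x + a + sum_list xs)"
    by (rule Cons.IH) (use Cons.prems g in auto)
  moreover have "computes (fadd p x a) 1 (fixed_point p W) (x + a)"
    by (rule computes_fadd) (use Cons.prems s in auto)
  ultimately show ?case by (auto intro!: computes_bind simp: algebra_simps)
qed (simp add: computes_return)

lemma computes_fsum:
  assumes "\<And>x. x \<in> set xs \<Longrightarrow> on_grid p x \<and> 0 \<le> x" "sum_list xs \<le> W"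
  shows "computes (fsum p xs) (length xs) (fixed_point p W) (sum_list xs)"
  using computes_fsum_acc[of xs p 0 W] assms by (simp add: fsum_def on_grid_0)

lemma computes_fmaximum:
  assumes "xs \<noteq> []" "\<And>x. x \<in> set xs \<Longrightarrow> fixed_point p W x"
  shows "computes (fmaximum p xs) (length xs) (fixed_point p W) (Max (set xs))"
proof -
  have fold: "computes (fold_arith (fmax p) ys b) (length ys) (fixed_point p W) (Max (insert b (set ys)))"
    if "\<And>x. x \<in> insert b (set ys) \<Longrightarrow> fixed_point p W x" for ys b
    using that
  proof (induction ys arbitrary: b)
    case (Cons y ys)
    have m: "fixed_point p W (max y b)" using Cons.prems[of y] Cons.prems[of b] by (auto simp: max_def)
    have "computes (fmax p y b) 1 (fixed_point p W) (max y b)"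
      unfolding fmax_def by (rule computes_fx) (use m in \<open>auto simp: fixed_point_def round_down_on_grid\<close>)
    moreover have "computes (fold_arith (fmax p) ys (max y b)) (length ys) (fixed_point p W)
        (Max (insert (max y b) (set ys)))"
      by (rule Cons.IH) (use m Cons.prems in auto)
    moreover have "Max (insert (max y b) (set ys)) = Max (insert b (set (y # ys)))"
      by (cases "ys = []") (auto simp: max.assoc max.commute max.left_commute)
    ultimately show ?case by (auto intro!: computes_bind)
  qed (simp add: computes_return)
  obtain y ys where xs: "xs = y # ys" using assms(1) by (cases xs) auto
  have "computes (fold_arith (fmax p) ys y) (length ys) (fixed_point p W) (Max (insert y (set ys)))"
    by (rule fold) (use assms(2) xs in auto)
  then obtain ws where "\<forall>tr. run_state (fold_arith (fmax p) ys y) tr = (Max (insert y (set ys)), ws @ tr)"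
    "length ws \<le> length ys" "\<forall>w\<in>set ws. fixed_point p W w" by (auto simp: computes_def)
  then show ?thesis unfolding fmaximum_def xs computes_def by auto
qed

text \<open>
  The exact value of the program \<open>sum_exp_shifted\<close>, in which only the exponentials are rounded.
\<close>

definition rounded_exp_sum :: "nat \<Rightarrow> real \<Rightarrow> real list \<Rightarrow> real" where
  "rounded_exp_sum p b xs = (\<Sum>x\<leftarrow>xs. round_down (int p) (exp (x - b)))"

lemma rounded_exp:
  assumes "y \<le> 0"
  shows "0 \<le> round_down (int p) (exp y)" "round_down (int p) (exp y) \<le> 1"
proof -
  show "0 \<le> round_down (int p) (exp y)" by (rule round_down_nonneg) simp
  have "exp y \<le> 1" using assms by simp
  then show "round_down (int p) (exp y) \<le> 1" using round_down[of "int p" "exp y"] by linarith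
qed

lemma rounded_exp_sum_bounds:
  assumes "\<And>x. x \<in> set xs \<Longrightarrow> x \<le> b"
  shows "0 \<le> rounded_exp_sum p b xs" "rounded_exp_sum p b xs \<le> length xs"
    "rounded_exp_sum p b xs \<le> (\<Sum>x\<leftarrow>xs. exp (x - b))"
    "(\<Sum>x\<leftarrow>xs. exp (x - b)) - length xs / 2 ^ p \<le> rounded_exp_sum p b xs"
    "on_grid p (rounded_exp_sum p b xs)"
proof -
  have "0 \<le> rounded_exp_sum p b xs \<and> rounded_exp_sum p b xs \<le> length xs \<and>
      rounded_exp_sum p b xs \<le> (\<Sum>x\<leftarrow>xs. exp (x - b)) \<and>
      (\<Sum>x\<leftarrow>xs. exp (x - b)) - length xs / 2 ^ p \<le> rounded_exp_sum p b xs \<and>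
      on_grid p (rounded_exp_sum p b xs)"
    using assms unfolding rounded_exp_sum_def
  proof (induction xs)
    case (Cons x xs)
    have x: "x - b \<le> 0" using Cons.prems by simp
    show ?case using Cons.IH Cons.prems rounded_exp[OF x, of p] round_down_lower[of "exp (x - b)" p]
        round_down[of "int p" "exp (x - b)"]
      by (auto simp: add_divide_distrib intro!: on_grid_add on_grid_round_down)
  qed (auto simp: on_grid_0)
  then show "0 \<le> rounded_exp_sum p b xs" "rounded_exp_sum p b xs \<le> length xs"
    "rounded_exp_sum p b xs \<le> (\<Sum>x\<leftarrow>xs. exp (x - b))"
    "(\<Sum>x\<leftarrow>xs. exp (x - b)) - length xs / 2 ^ p \<le> rounded_exp_sum p b xs"
    "on_grid p (rounded_exp_sum p b xs)" by auto
qed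

text \<open>
  The term \<open>exp (b - b) = 1\<close> is on the grid and survives rounding. This keeps logarithms and
  quotients of the rounded sums stable.
\<close>

lemma rounded_exp_sum_ge_1:
  assumes "b \<in> set xs" "\<And>x. x \<in> set xs \<Longrightarrow> x \<le> b"
  shows "1 \<le> rounded_exp_sum p b xs"
proof -
  have "round_down (int p) (exp (b - b)) = 1" by (simp add: round_down_on_grid on_grid_1)
  moreover have "round_down (int p) (exp (b - b)) \<le> rounded_exp_sum p b xs"
    unfolding rounded_exp_sum_def
  proof (rule member_le_sum_list)
    show "round_down (int p) (exp (b - b)) \<in> set (map (\<lambda>x. round_down (int p) (exp (x - b))) xs)"
      unfolding set_map by (rule imageI) (rule assms(1))
  qed (use assms(2) in \<open>auto intro!: rounded_exp(1)\<close>)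
  ultimately show ?thesis by simp
qed

lemma computes_sum_exp_shifted:
  assumes "\<And>x. x \<in> set xs \<Longrightarrow> on_grid p x \<and> x \<le> b \<and> b - x \<le> W" "on_grid p b"
    "real (length xs) \<le> W" "1 \<le> W"
  shows "computes (sum_exp_shifted p b xs) (3 * length xs) (fixed_point p W) (rounded_exp_sum p b xs)"
proof -
  have "computes (map_arith (\<lambda>x. fsub p x b \<bind> fexp p) xs) (\<Sum>x\<leftarrow>xs. 2) (fixed_point p W)
      (map (\<lambda>x. round_down (int p) (exp (x - b))) xs)"
  proof (rule computes_map)
    fix x assume x: "x \<in> set xs"
    have "computes (fsub p x b) 1 (fixed_point p W) (x - b)"
      by (rule computes_fsub) (use assms x in auto)
    moreover have "computes (fexp p (x - b)) 1 (fixed_point p W) (round_down (int p) (exp (x - b)))"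
      unfolding fexp_def using rounded_exp[of "x - b" p] assms(1)[OF x] assms(4)
      by (intro computes_fx) (auto simp: fixed_point_def on_grid_round_down)
    ultimately show "computes (fsub p x b \<bind> fexp p) 2 (fixed_point p W) (round_down (int p) (exp (x - b)))"
      by (rule computes_bind) simp
  qed
  moreover have "computes (fsum p (map (\<lambda>x. round_down (int p) (exp (x - b))) xs)) (length xs)
      (fixed_point p W) (rounded_exp_sum p b xs)"
    unfolding rounded_exp_sum_def
  proof (subst length_map[symmetric, of _ "\<lambda>x. round_down (int p) (exp (x - b))"], rule computes_fsum)
    show "(\<Sum>x\<leftarrow>xs. round_down (int p) (exp (x - b))) \<le> W"
      using rounded_exp_sum_bounds(2)[of xs b p] assms by (force simp: rounded_exp_sum_def)
  qed (use assms(1) in \<open>auto intro!: on_grid_round_down rounded_exp(1)\<close>)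
  ultimately show ?thesis unfolding sum_exp_shifted_def
    by (rule computes_bind) (simp add: sum_list_triv)
qed

text \<open>
  The rounded sum and the exact one are both at least \<open>1\<close>, where \<open>ln\<close> does not increase
  distances; one more rounding is caused by \<open>ln\<close> itself.
\<close>

lemma computes_log_sum_exp:
  assumes "xs \<noteq> []" "\<And>x. x \<in> set xs \<Longrightarrow> on_grid p x \<and> \<bar>x\<bar> \<le> V" "2 * V + real (length xs) \<le> W"
  obtains l where "computes (log_sum_exp p xs) (4 * length xs + 2) (fixed_point p W) l"
    "on_grid p l" "\<bar>l - ln (\<Sum>x\<leftarrow>xs. exp x)\<bar> \<le> (real (length xs) + 1) / 2 ^ p"
    "\<bar>l\<bar> \<le> V + real (length xs)"
proof -
  define b where "b = Max (set xs)"
  define N where "N = real (length xs)"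
  have b: "b \<in> set xs" "\<And>x. x \<in> set xs \<Longrightarrow> x \<le> b" unfolding b_def using assms(1) by auto
  have N: "1 \<le> N" using assms(1) by (cases xs) (auto simp: N_def)
  have V: "0 \<le> V" using assms(2)[OF b(1)] by auto
  have bg: "on_grid p b" "\<bar>b\<bar> \<le> V" using assms(2)[OF b(1)] by auto
  define S where "S = rounded_exp_sum p b xs"
  define T where "T = (\<Sum>x\<leftarrow>xs. exp (x - b))"
  define l where "l = round_down (int p) (ln S)"
  have S: "1 \<le> S" "S \<le> N" "S \<le> T" "T - N / 2 ^ p \<le> S" "on_grid p S"
    unfolding S_def T_def N_def using rounded_exp_sum_ge_1[OF b] rounded_exp_sum_bounds[of xs b p] b(2) by auto
  have lnS: "0 \<le> ln S" "ln S \<le> N" using S ln_le_minus_one[of S] by auto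
  have l: "on_grid p l" "0 \<le> l" "l \<le> N" "ln S - 1 / 2 ^ p \<le> l" "l \<le> ln S"
    unfolding l_def using lnS round_down_lower[of "ln S" p] round_down[of "int p" "ln S"] by (auto simp: on_grid_round_down round_down_nonneg)
  have m: "computes (fmaximum p xs) (length xs) (fixed_point p W) b"
    unfolding b_def by (rule computes_fmaximum[OF assms(1)])
      (use assms(2,3) V N in \<open>fastforce simp: fixed_point_def N_def\<close>)
  have s: "computes (sum_exp_shifted p b xs) (3 * length xs) (fixed_point p W) S"
    unfolding S_def
  proof (rule computes_sum_exp_shifted)
    fix x assume "x \<in> set xs"
    then show "on_grid p x \<and> x \<le> b \<and> b - x \<le> W"
      using assms(2)[of x] assms(3) b(2)[of x] bg N by (auto simp: N_def abs_le_iff)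
  qed (use bg assms(3) V N in \<open>auto simp: N_def\<close>)
  have n: "computes (fln p S) 1 (fixed_point p W) l" unfolding fln_def
    by (rule computes_fx) (use l assms(3) V in \<open>auto simp: fixed_point_def l_def[symmetric] N_def\<close>)
  have a: "computes (fadd p b l) 1 (fixed_point p W) (b + l)"
    by (rule computes_fadd) (use l bg assms(3) V in \<open>auto simp: N_def\<close>)
  have comp: "computes (log_sum_exp p xs) (4 * length xs + 2) (fixed_point p W) (b + l)"
    unfolding log_sum_exp_def
  proof (rule computes_bind[where x = b, OF m])
    show "computes (sum_exp_shifted p b xs \<bind> (\<lambda>S. fln p S \<bind> fadd p b)) (3 * length xs + 2)
        (fixed_point p W) (b + l)"
    proof (rule computes_bind[where x = S, OF s])
      show "computes (fln p S \<bind> fadd p b) 2 (fixed_point p W) (b + l)"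
        by (rule computes_bind[where x = l, OF n]) (rule a, simp)
    qed simp
  qed simp
  have T: "1 \<le> T" using S by linarith
  have "(\<Sum>x\<leftarrow>xs. exp x) = exp b * T"
    unfolding T_def sum_list_const_mult[symmetric] by (simp flip: exp_add)
  then have lnT: "ln (\<Sum>x\<leftarrow>xs. exp x) = b + ln T" using T by (simp add: ln_mult)
  have "ln T - ln S \<le> (T - S) / S" using ln_diff_le[of T S] S T by simp
  also have "\<dots> \<le> (T - S) / 1" using S by (intro divide_left_mono) auto
  finally have "ln T - ln S \<le> N / 2 ^ p" using S by simp
  moreover have "ln S \<le> ln T" using S T by simp
  ultimately have "\<bar>b + l - ln (\<Sum>x\<leftarrow>xs. exp x)\<bar> \<le> N / 2 ^ p + 1 / 2 ^ p"
    unfolding lnT using l by linarith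
  then show ?thesis
    using that[OF comp] l bg by (auto simp: on_grid_add N_def add_divide_distrib)
qed

lemma fixed_point_bit_number:
  assumes "fixed_point p W x" "0 < W" "real p + log 2 W < real b" "p \<le> b"
  shows "bit_number b x"
proof -
  obtain k :: int where k: "x = k / 2 ^ p" and x: "\<bar>x\<bar> \<le> W"
    using assms(1) by (auto simp: fixed_point_def on_grid_def)
  have "\<bar>real_of_int k\<bar> = \<bar>x\<bar> * 2 ^ p" by (simp add: k abs_mult)
  also have "\<dots> \<le> W * 2 ^ p" using x by (intro mult_right_mono) auto
  also have "\<dots> = 2 powr (log 2 W + real p)"
    using assms(2) by (simp add: powr_add powr_realpow)
  also have "\<dots> < 2 powr real b" using assms(3) by (intro powr_less_mono) auto
  also have "\<dots> = real_of_int (2 ^ b)" by (simp add: powr_realpow)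
  finally have "\<bar>k\<bar> < 2 ^ b" by linarith
  then show ?thesis unfolding bit_number_def using k assms(4) by blast
qed

section \<open>Updates and sweeps of the fixed-point program\<close>

context osborne_input
begin

definition grid_vector :: "nat \<Rightarrow> real \<Rightarrow> (nat \<Rightarrow> real) \<Rightarrow> bool" where
  "grid_vector p \<beta> u \<longleftrightarrow> (\<forall>i<n. on_grid p (u i) \<and> \<bar>u i\<bar> \<le> \<beta>)"

definition grid_logs :: "nat \<Rightarrow> real \<Rightarrow> (nat \<Rightarrow> nat \<Rightarrow> real) \<Rightarrow> bool" where
  "grid_logs p \<Lambda> L \<longleftrightarrow> (\<forall>(i, j)\<in>edges n A. on_grid p (L i j) \<and> \<bar>L i j\<bar> \<le> \<Lambda>)"

definition log_entry :: "(nat \<Rightarrow> nat \<Rightarrow> real) \<Rightarrow> (nat \<Rightarrow> real) \<Rightarrow> nat \<times> nat \<Rightarrow> real" where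
  "log_entry L u = (\<lambda>(i, j). u i - u j + L i j)"

lemma log_entry_bounds:
  assumes "grid_vector p \<beta> u" "grid_logs p \<Lambda> L" "e \<in> edges n A"
  shows "on_grid p (log_entry L u e)" "\<bar>log_entry L u e\<bar> \<le> 2 * \<beta> + \<Lambda>"
proof -
  obtain i j where e: "e = (i, j)" by (cases e)
  have ij: "i < n" "j < n" using assms(3) edge_bounds e by auto
  have L: "on_grid p (L i j)" "\<bar>L i j\<bar> \<le> \<Lambda>" using assms(2,3) e by (auto simp: grid_logs_def)
  have u: "on_grid p (u i)" "\<bar>u i\<bar> \<le> \<beta>" "on_grid p (u j)" "\<bar>u j\<bar> \<le> \<beta>"
    using assms(1) ij by (auto simp: grid_vector_def)
  show "on_grid p (log_entry L u e)" using L u by (auto simp: e log_entry_def on_grid_add on_grid_diff)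
  show "\<bar>log_entry L u e\<bar> \<le> 2 * \<beta> + \<Lambda>" using L u by (auto simp: e log_entry_def)
qed

lemma computes_log_entries:
  assumes u: "grid_vector p \<beta> u" and L: "grid_logs p \<Lambda> L" and es: "set es \<subseteq> edges n A"
    and W: "2 * \<beta> + \<Lambda> \<le> W"
  shows "computes (log_entries p L u es) (2 * length es) (fixed_point p W) (map (log_entry L u) es)"
proof -
  have "computes (log_entries p L u es) (\<Sum>e\<leftarrow>es. 2) (fixed_point p W) (map (log_entry L u) es)"
    unfolding log_entries_def
  proof (rule computes_map)
    fix e assume e: "e \<in> set es"
    obtain i j where ij: "e = (i, j)" by (cases e)
    have m: "(i, j) \<in> edges n A" using e es ij by auto
    have g: "on_grid p (u i)" "on_grid p (u j)" "on_grid p (L i j)" "\<bar>L i j\<bar> \<le> \<Lambda>" "\<bar>u i\<bar> \<le> \<beta>" "\<bar>u j\<bar> \<le> \<beta>"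
      using u L m edge_bounds[OF m] by (auto simp: grid_vector_def grid_logs_def)
    have "computes (fsub p (u i) (u j)) 1 (fixed_point p W) (u i - u j)"
      by (rule computes_fsub) (use g W in auto)
    moreover have "computes (fadd p (u i - u j) (L i j)) 1 (fixed_point p W) (log_entry L u e)"
      unfolding ij log_entry_def prod.case
      by (rule computes_fadd) (use g W in \<open>auto simp: on_grid_diff\<close>)
    ultimately show "computes (case e of (i, j) \<Rightarrow> fsub p (u i) (u j) \<bind> (\<lambda>t. fadd p t (L i j))) 2
        (fixed_point p W) (log_entry L u e)"
      by (auto simp: ij intro!: computes_bind)
  qed
  then show ?thesis by (simp add: sum_list_triv mult.commute)
qed

lemma set_row_edges: "j < n \<Longrightarrow> set (row_edges n A j) = {e \<in> edges n A. fst e = j}"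
  by (auto simp: row_edges_def edges_def)

lemma set_col_edges: "j < n \<Longrightarrow> set (col_edges n A j) = {e \<in> edges n A. snd e = j}"
  by (auto simp: col_edges_def edges_def)

lemma row_edges_nonempty: "j < n \<Longrightarrow> row_edges n A j \<noteq> []"
  using out_edge[of j] set_row_edges[of j] by fastforce

lemma col_edges_nonempty: "j < n \<Longrightarrow> col_edges n A j \<noteq> []"
  using in_edge[of j] set_col_edges[of j] by fastforce

lemma length_row_edges: "length (row_edges n A j) \<le> n" and length_col_edges: "length (col_edges n A j) \<le> n"
  unfolding row_edges_def col_edges_def by (auto intro: order_trans[OF length_filter_le])

lemma sum_row_edges:
  assumes "j < n"
  shows "(\<Sum>e\<leftarrow>row_edges n A j. f e) = (\<Sum>i\<in>{i. (j, i) \<in> edges n A}. f (j, i))"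
proof -
  have "(\<Sum>e\<leftarrow>row_edges n A j. f e) = (\<Sum>i\<leftarrow>filter (\<lambda>i. A $$ (j, i) \<noteq> 0) [0..<n]. f (j, i))"
    by (simp add: row_edges_def comp_def)
  also have "\<dots> = (\<Sum>i\<in>set (filter (\<lambda>i. A $$ (j, i) \<noteq> 0) [0..<n]). f (j, i))"
    by (rule sum_list_distinct_conv_sum_set) simp
  also have "set (filter (\<lambda>i. A $$ (j, i) \<noteq> 0) [0..<n]) = {i. (j, i) \<in> edges n A}"
    using assms by (auto simp: edges_def)
  finally show ?thesis .
qed

lemma sum_col_edges:
  assumes "j < n"
  shows "(\<Sum>e\<leftarrow>col_edges n A j. f e) = (\<Sum>i\<in>{i. (i, j) \<in> edges n A}. f (i, j))"
proof -
  have "(\<Sum>e\<leftarrow>col_edges n A j. f e) = (\<Sum>i\<leftarrow>filter (\<lambda>i. A $$ (i, j) \<noteq> 0) [0..<n]. f (i, j))"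
    by (simp add: col_edges_def comp_def)
  also have "\<dots> = (\<Sum>i\<in>set (filter (\<lambda>i. A $$ (i, j) \<noteq> 0) [0..<n]). f (i, j))"
    by (rule sum_list_distinct_conv_sum_set) simp
  also have "set (filter (\<lambda>i. A $$ (i, j) \<noteq> 0) [0..<n]) = {i. (i, j) \<in> edges n A}"
    using assms by (auto simp: edges_def)
  finally show ?thesis .
qed

text \<open>
  Every edge occurs in one row list and in one column list; with \<open>f = 1\<close> this counts degrees.
\<close>

lemma sum_row_col:
  fixes f :: "nat \<times> nat \<Rightarrow> 'b::comm_monoid_add"
  shows "(\<Sum>j<n. \<Sum>e\<leftarrow>row_edges n A j. f e) = (\<Sum>e\<in>edges n A. f e)"
    and "(\<Sum>j<n. \<Sum>e\<leftarrow>col_edges n A j. f e) = (\<Sum>e\<in>edges n A. f e)"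
proof -
  have fin: "finite {i. (j, i) \<in> edges n A}" "finite {i. (i, j) \<in> edges n A}" for j
    by (rule finite_subset[of _ "{..<n}"]; auto simp: edges_def)+
  have "(\<Sum>j<n. \<Sum>e\<leftarrow>row_edges n A j. f e) = (\<Sum>j<n. \<Sum>i\<in>{i. (j, i) \<in> edges n A}. f (j, i))"
    by (intro sum.cong refl) (simp add: sum_row_edges)
  also have "\<dots> = (\<Sum>e\<in>Sigma {..<n} (\<lambda>j. {i. (j, i) \<in> edges n A}). f e)"
    by (subst sum.Sigma) (use fin in auto)
  also have "Sigma {..<n} (\<lambda>j. {i. (j, i) \<in> edges n A}) = edges n A" by (auto simp: edges_def)
  finally show "(\<Sum>j<n. \<Sum>e\<leftarrow>row_edges n A j. f e) = (\<Sum>e\<in>edges n A. f e)" .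
  have "(\<Sum>j<n. \<Sum>e\<leftarrow>col_edges n A j. f e) = (\<Sum>j<n. \<Sum>i\<in>{i. (i, j) \<in> edges n A}. f (i, j))"
    by (intro sum.cong refl) (simp add: sum_col_edges)
  also have "\<dots> = (\<Sum>e\<in>Sigma {..<n} (\<lambda>j. {i. (i, j) \<in> edges n A}). f (prod.swap e))"
    by (subst sum.Sigma) (use fin in \<open>auto intro!: sum.cong\<close>)
  also have "\<dots> = (\<Sum>e\<in>edges n A. f e)"
    by (rule sum.reindex_bij_witness[of _ prod.swap prod.swap]) (auto simp: edges_def)
  finally show "(\<Sum>j<n. \<Sum>e\<leftarrow>col_edges n A j. f e) = (\<Sum>e\<in>edges n A. f e)" .
qed

lemma sum_degrees: "(\<Sum>j<n. length (row_edges n A j) + length (col_edges n A j)) = 2 * card (edges n A)"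
  using sum_row_col[of "\<lambda>_. 1 :: nat"] by (simp add: sum.distrib sum_list_triv)

lemma ln_sum_row_edges: "j < n \<Longrightarrow> ln (\<Sum>x\<leftarrow>map (log_entry L u) (row_edges n A j). exp x) = log_row n A L u j"
  using sum_row_edges[of j "\<lambda>e. exp (log_entry L u e)"] by (simp add: comp_def log_row_def log_entry_def)

lemma ln_sum_col_edges: "j < n \<Longrightarrow> ln (\<Sum>x\<leftarrow>map (log_entry L u) (col_edges n A j). exp x) = log_col n A L u j"
  using sum_col_edges[of j "\<lambda>e. exp (log_entry L u e)"] by (simp add: comp_def log_col_def log_entry_def)

text \<open>
  The coordinate \<open>u j\<close> cancels in an update, so its new value is bounded by the other coordinates
  plus a term that does not depend on \<open>u\<close>. Bounding the three summands separately would allow a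
  growth by a constant factor per update, hence exponentially large iterates.
\<close>

lemma exact_update_bound:
  assumes j: "j < n" and u: "grid_vector p \<beta> u" and L: "grid_logs p \<Lambda> L"
  shows "\<bar>u j + log_col n A L u j / 2 - log_row n A L u j / 2\<bar> \<le> \<beta> + \<Lambda> + real n - 1"
proof -
  define R C where "R = {i. (j, i) \<in> edges n A}" and "C = {i. (i, j) \<in> edges n A}"
  have sub: "R \<subseteq> {..<n}" "C \<subseteq> {..<n}" by (auto simp: R_def C_def edges_def)
  have fin: "finite R" "finite C" "card R \<le> n" "card C \<le> n"
    using finite_subset[OF sub(1)] finite_subset[OF sub(2)] card_mono[OF _ sub(1)] card_mono[OF _ sub(2)] by auto
  have ne: "R \<noteq> {}" "C \<noteq> {}" using out_edge[OF j] in_edge[OF j] by (auto simp: R_def C_def)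
  have r: "u j - \<beta> - \<Lambda> \<le> u j - u i + L j i \<and> u j - u i + L j i \<le> u j + \<beta> + \<Lambda>" if "i \<in> R" for i
  proof -
    have "\<bar>L j i\<bar> \<le> \<Lambda>" "\<bar>u i\<bar> \<le> \<beta>" using that u L sub by (auto simp: R_def grid_vector_def grid_logs_def)
    then show ?thesis by linarith
  qed
  have c: "- u j - \<beta> - \<Lambda> \<le> u i - u j + L i j \<and> u i - u j + L i j \<le> - u j + \<beta> + \<Lambda>" if "i \<in> C" for i
  proof -
    have "\<bar>L i j\<bar> \<le> \<Lambda>" "\<bar>u i\<bar> \<le> \<beta>" using that u L sub by (auto simp: C_def grid_vector_def grid_logs_def)
    then show ?thesis by linarith
  qed
  have "u j - \<beta> - \<Lambda> \<le> log_row n A L u j" "log_row n A L u j \<le> (u j + \<beta> + \<Lambda>) + real n - 1"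
    unfolding log_row_def R_def[symmetric] by (rule ln_sum_exp_range[OF fin(1) ne(1) fin(3)], rule r, assumption)+
  moreover have "- u j - \<beta> - \<Lambda> \<le> log_col n A L u j" "log_col n A L u j \<le> (- u j + \<beta> + \<Lambda>) + real n - 1"
    unfolding log_col_def C_def[symmetric] by (rule ln_sum_exp_range[OF fin(2) ne(2) fin(4)], rule c, assumption)+
  ultimately show ?thesis using n_ge_2 unfolding abs_le_iff by linarith
qed

text \<open>
  The error of the computed update \<open>y\<close> is at most \<open>(n + 1) 2\<^bsup>-p\<^esup>\<close> from the two logarithms, which
  are halved, and \<open>2\<^bsup>-p\<^esup>\<close> from the division by \<open>2\<close>. Since \<open>q' \<le> p\<close>, the truncated value is again on
  the grid, and so the invariant is preserved.
\<close>

lemma computes_fp_update: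
  assumes j: "j < n" and u: "grid_vector p \<beta> u" and L: "grid_logs p \<Lambda> L" and W: "8 * (\<beta> + \<Lambda> + real n) \<le> W"
    and q': "q' \<le> p" "1 / 2 ^ q' \<le> \<gamma>'" and p: "(real n + 2) / 2 ^ p \<le> \<gamma>'" and \<gamma>': "\<gamma>' \<le> 1"
  obtains v where
    "computes (fp_update n A q' p L j u) (10 * (length (row_edges n A j) + length (col_edges n A j)))
       (fixed_point p W) v"
    "inexact_update n A L \<gamma>' j u v" "grid_vector p (\<beta> + \<Lambda> + real n + 1) v"
proof -
  define h where "h = 1 / (2::real) ^ p"
  have h: "0 < h" "h \<le> 1" "(real n + 2) * h \<le> \<gamma>'" using p by (auto simp: h_def)
  define V where "V = 2 * \<beta> + \<Lambda>"
  have n: "2 \<le> real n" using n_ge_2 by simp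
  have \<beta>: "0 \<le> \<beta>" "\<bar>u j\<bar> \<le> \<beta>" "on_grid p (u j)" using u j by (auto simp: grid_vector_def)
  obtain i where i: "(j, i) \<in> edges n A" using out_edge[OF j] by auto
  have \<Lambda>: "0 \<le> \<Lambda>" using L i by (force simp: grid_logs_def)
  let ?R = "row_edges n A j" and ?C = "col_edges n A j"
  let ?xs = "map (log_entry L u)"
  have len: "real (length ?R) \<le> real n" "real (length ?C) \<le> real n" "1 \<le> length ?R" "1 \<le> length ?C"
    using length_row_edges length_col_edges row_edges_nonempty[OF j] col_edges_nonempty[OF j]
    by (auto simp: Suc_le_eq)
  have sub: "set ?R \<subseteq> edges n A" "set ?C \<subseteq> edges n A" using set_row_edges[OF j] set_col_edges[OF j] by auto
  have x: "on_grid p x \<and> \<bar>x\<bar> \<le> V" if "x \<in> set (?xs ?R) \<union> set (?xs ?C)" for x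
    using that sub log_entry_bounds[OF u L] unfolding V_def by auto
  obtain lr where lr: "computes (log_sum_exp p (?xs ?R)) (4 * length (?xs ?R) + 2) (fixed_point p W) lr"
    "on_grid p lr" "\<bar>lr - ln (\<Sum>x\<leftarrow>?xs ?R. exp x)\<bar> \<le> (real (length (?xs ?R)) + 1) / 2 ^ p"
    "\<bar>lr\<bar> \<le> V + real (length (?xs ?R))"
    by (rule computes_log_sum_exp[of "?xs ?R" p V W])
      (use x row_edges_nonempty[OF j] W \<beta> \<Lambda> len n in \<open>auto simp: V_def\<close>)
  obtain lc where lc: "computes (log_sum_exp p (?xs ?C)) (4 * length (?xs ?C) + 2) (fixed_point p W) lc"
    "on_grid p lc" "\<bar>lc - ln (\<Sum>x\<leftarrow>?xs ?C. exp x)\<bar> \<le> (real (length (?xs ?C)) + 1) / 2 ^ p"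
    "\<bar>lc\<bar> \<le> V + real (length (?xs ?C))"
    by (rule computes_log_sum_exp[of "?xs ?C" p V W])
      (use x col_edges_nonempty[OF j] W \<beta> \<Lambda> len n in \<open>auto simp: V_def\<close>)
  have "(real (length (?xs ?R)) + 1) / 2 ^ p \<le> (real n + 1) * h" "(real (length (?xs ?C)) + 1) / 2 ^ p \<le> (real n + 1) * h"
    using len by (auto simp: h_def intro!: divide_right_mono)
  then have err: "\<bar>lr - log_row n A L u j\<bar> \<le> (real n + 1) * h" "\<bar>lc - log_col n A L u j\<bar> \<le> (real n + 1) * h"
    using lr(3) lc(3) by (auto simp only: ln_sum_row_edges[OF j] ln_sum_col_edges[OF j])
  define t where "t = round_down (int p) ((lc - lr) / 2)"
  define y where "y = u j + t"
  define z where "z = round_down (int q') y"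
  have t: "on_grid p t" "\<bar>t - (lc - lr) / 2\<bar> \<le> h" unfolding t_def h_def
    using round_down_lower[of "(lc - lr) / 2" p] round_down[of "int p" "(lc - lr) / 2"]
    by (auto simp only: on_grid_round_down abs_le_iff)
  have lb: "\<bar>lr\<bar> \<le> V + real n" "\<bar>lc\<bar> \<le> V + real n" using lr(4) lc(4) len by auto
  have yg: "on_grid p y" unfolding y_def using t \<beta> by (auto intro: on_grid_add)
  have zg: "on_grid p z" unfolding z_def using on_grid_mono[OF q'(1) on_grid_round_down] .
  have zy: "\<bar>z - y\<bar> \<le> \<gamma>'" unfolding z_def
    using round_down_lower[of y q'] round_down[of "int q'" y] q'(2) by linarith
  have yerr: "\<bar>y - (u j + log_col n A L u j / 2 - log_row n A L u j / 2)\<bar> \<le> \<gamma>'"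
  proof -
    have "(real n + 1) * h + h \<le> \<gamma>'" using h(3) by (simp add: algebra_simps)
    then show ?thesis using t(2) err unfolding y_def abs_le_iff by argo
  qed
  have up: "inexact_update n A L \<gamma>' j u (u(j := z))"
    unfolding inexact_update_def using yerr zy by blast
  have zb: "\<bar>z\<bar> \<le> \<beta> + \<Lambda> + real n + 1"
    using yerr zy \<gamma>' exact_update_bound[OF j u L] by linarith
  have vec: "grid_vector p (\<beta> + \<Lambda> + real n + 1) (u(j := z))"
    using u zb zg \<Lambda> unfolding grid_vector_def by (auto intro: order_trans)
  have Vn: "4 * \<beta> + 2 * \<Lambda> + 2 * real n \<le> W" using W \<beta> \<Lambda> n by simp
  have tb: "\<bar>t\<bar> \<le> V + real n + 1" using t(2) lb h(1,2) unfolding abs_le_iff by argo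
  have c1: "computes (fsub p lc lr) 1 (fixed_point p W) (lc - lr)"
    by (rule computes_fsub) (use lb lr(2) lc(2) Vn in \<open>auto simp: V_def\<close>)
  have c2: "computes (fdiv p (lc - lr) 2) 1 (fixed_point p W) t" unfolding fdiv_def
    by (rule computes_fx) (use t tb W \<beta> \<Lambda> n in \<open>auto simp: t_def[symmetric] fixed_point_def V_def\<close>)
  have c3: "computes (fadd p (u j) t) 1 (fixed_point p W) y" unfolding y_def
    by (rule computes_fadd) (use t tb W \<beta> \<Lambda> n in \<open>auto simp: V_def\<close>)
  have c4: "computes (ftruncate q' y) 1 (fixed_point p W) z" unfolding ftruncate_def
    by (rule computes_fx) (use zg zb W \<beta> \<Lambda> n in \<open>auto simp: z_def[symmetric] fixed_point_def\<close>)
  have VW: "2 * \<beta> + \<Lambda> \<le> W" using W \<beta> \<Lambda> n by simp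
  have "computes (fp_update n A q' p L j u) (10 * (length ?R + length ?C)) (fixed_point p W) (u(j := z))"
    unfolding fp_update_def
    apply (rule computes_step[OF computes_log_entries[OF u L sub(2) VW]])
    apply (rule computes_step[OF lc(1)])
    apply (rule computes_step[OF computes_log_entries[OF u L sub(1) VW]])
    apply (rule computes_step[OF lr(1)])
    apply (rule computes_step[OF c1])
    apply (rule computes_step[OF c2])
    apply (rule computes_step[OF c3])
    apply (rule computes_step[OF c4])
    apply (rule computes_return)
    using len(3,4) by simp_all
  then show ?thesis using that up vec by blast
qed

lemma computes_fp_sweep:
  assumes L: "grid_logs p \<Lambda> L" and q': "q' \<le> p" "1 / 2 ^ q' \<le> \<gamma>'" and p: "(real n + 2) / 2 ^ p \<le> \<gamma>'"
    and \<gamma>': "\<gamma>' \<le> 1" and "set js \<subseteq> {..<n}" and "grid_vector p \<beta> u"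
    and "8 * (\<beta> + length js * (\<Lambda> + real n + 1) + \<Lambda> + real n) \<le> W"
  shows "\<exists>v. computes (fp_sweep n A q' p L js u)
       (\<Sum>j\<leftarrow>js. 10 * (length (row_edges n A j) + length (col_edges n A j))) (fixed_point p W) v \<and>
     inexact_sweep n A L \<gamma>' js u v \<and> grid_vector p (\<beta> + length js * (\<Lambda> + real n + 1)) v"
  using assms(6-8) unfolding fp_sweep_def
proof (induction js arbitrary: u \<beta>)
  case Nil
  then show ?case by (auto intro: computes_return)
next
  case (Cons j js u \<beta>)
  obtain e where "e \<in> edges n A" using edges_nonempty by auto
  then have \<Lambda>: "0 \<le> \<Lambda>" using L by (force simp: grid_logs_def)
  have j: "j < n" "set js \<subseteq> {..<n}" using Cons.prems by auto
  define X where "X = real (length (j # js)) * (\<Lambda> + real n + 1)"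
  have "0 \<le> X" unfolding X_def using \<Lambda> by simp
  moreover have p3: "8 * (\<beta> + X + \<Lambda> + real n) \<le> W" using Cons.prems(3) unfolding X_def by simp
  ultimately have W: "8 * (\<beta> + \<Lambda> + real n) \<le> W" by simp
  obtain w where w: "computes (fp_update n A q' p L j u)
      (10 * (length (row_edges n A j) + length (col_edges n A j))) (fixed_point p W) w"
    "inexact_update n A L \<gamma>' j u w" "grid_vector p (\<beta> + \<Lambda> + real n + 1) w"
    by (rule computes_fp_update[OF j(1) Cons.prems(2) L W q' p \<gamma>'])
  have "\<exists>v. computes (fold_arith (fp_update n A q' p L) js w)
       (\<Sum>j\<leftarrow>js. 10 * (length (row_edges n A j) + length (col_edges n A j))) (fixed_point p W) v \<and>
     inexact_sweep n A L \<gamma>' js w v \<and> grid_vector p ((\<beta> + \<Lambda> + real n + 1) + length js * (\<Lambda> + real n + 1)) v"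
    by (rule Cons.IH[OF j(2) w(3)]) (use Cons.prems(3) in \<open>simp add: algebra_simps\<close>)
  then obtain v where v: "computes (fold_arith (fp_update n A q' p L) js w)
       (\<Sum>j\<leftarrow>js. 10 * (length (row_edges n A j) + length (col_edges n A j))) (fixed_point p W) v"
     "inexact_sweep n A L \<gamma>' js w v" "grid_vector p ((\<beta> + \<Lambda> + real n + 1) + length js * (\<Lambda> + real n + 1)) v"
    by auto
  have "(\<beta> + \<Lambda> + real n + 1) + length js * (\<Lambda> + real n + 1) = \<beta> + length (j # js) * (\<Lambda> + real n + 1)"
    by (simp add: algebra_simps)
  with v w show ?case by (intro exI[of _ v]) (auto intro: computes_bind)
qed

section \<open>The estimate of the imbalance\<close>

lemma rounded_row_col:
  assumes "j < n" "\<And>e. e \<in> edges n A \<Longrightarrow> log_entry L u e \<le> b"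
  defines "w \<equiv> \<lambda>i j. if (i, j) \<in> edges n A then exp (log_entry L u (i, j) - b) else 0"
  shows "\<bar>rounded_exp_sum p b (map (log_entry L u) (row_edges n A j)) - (\<Sum>i<n. w j i)\<bar> \<le> real n / 2 ^ p"
    and "\<bar>rounded_exp_sum p b (map (log_entry L u) (col_edges n A j)) - (\<Sum>i<n. w i j)\<bar> \<le> real n / 2 ^ p"
proof -
  have le: "\<bar>rounded_exp_sum p b (map (log_entry L u) es) - (\<Sum>e\<leftarrow>es. exp (log_entry L u e - b))\<bar> \<le> real n / 2 ^ p"
    if es: "set es \<subseteq> edges n A" "length es \<le> n" for es
  proof -
    have "real (length es) / 2 ^ p \<le> real n / 2 ^ p" using es(2) by (intro divide_right_mono) auto
    moreover have "x \<le> b" if "x \<in> set (map (log_entry L u) es)" for x using that es(1) assms(2) by auto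
    ultimately show ?thesis
      using rounded_exp_sum_bounds(3,4)[of "map (log_entry L u) es" b p] by (simp add: comp_def abs_le_iff)
  qed
  have "(\<Sum>e\<leftarrow>row_edges n A j. exp (log_entry L u e - b)) = (\<Sum>i<n. w j i)"
    unfolding sum_row_edges[OF assms(1)] by (rule sum.mono_neutral_cong_left) (auto simp: w_def edges_def)
  then show "\<bar>rounded_exp_sum p b (map (log_entry L u) (row_edges n A j)) - (\<Sum>i<n. w j i)\<bar> \<le> real n / 2 ^ p"
    using le[of "row_edges n A j"] set_row_edges[OF assms(1)] length_row_edges by auto
  have "(\<Sum>e\<leftarrow>col_edges n A j. exp (log_entry L u e - b)) = (\<Sum>i<n. w i j)"
    unfolding sum_col_edges[OF assms(1)] by (rule sum.mono_neutral_cong_left) (auto simp: w_def edges_def)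
  then show "\<bar>rounded_exp_sum p b (map (log_entry L u) (col_edges n A j)) - (\<Sum>i<n. w i j)\<bar> \<le> real n / 2 ^ p"
    using le[of "col_edges n A j"] set_col_edges[OF assms(1)] length_col_edges by auto
qed

lemma edge_list: "set (edge_list n A) = edges n A" "length (edge_list n A) = card (edges n A)"
  "(\<Sum>e\<leftarrow>edge_list n A. f e) = (\<Sum>e\<in>edges n A. f e :: real)" "edge_list n A \<noteq> []"
proof -
  show s: "set (edge_list n A) = edges n A" by (auto simp: edge_list_def edges_def)
  have d: "distinct (edge_list n A)" by (simp add: edge_list_def distinct_product)
  show "length (edge_list n A) = card (edges n A)" using distinct_card[OF d] s by simp
  show "(\<Sum>e\<leftarrow>edge_list n A. f e) = (\<Sum>e\<in>edges n A. f e)"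
    using sum_list_distinct_conv_sum_set[OF d] s by simp
  show "edge_list n A \<noteq> []" using s edges_nonempty by auto
qed

lemma card_edges_le: "card (edges n A) \<le> n * n"
proof -
  have "card (edges n A) \<le> card ({..<n} \<times> {..<n})" by (rule card_mono) (auto simp: edges_def)
  then show ?thesis by (simp add: card_cartesian_product)
qed

text \<open>
  The factor \<open>c\<close> accounts for the normalisation of the input and for the shift by the maximum; it
  cancels in the quotient. The weights \<open>w\<close> play the role of the stored entries.
\<close>

lemma perturbed_imbalance:
  assumes "0 < c" "0 \<le> \<gamma>" "\<gamma> \<le> 1 / 4"
    and w: "\<And>i j. i < n \<Longrightarrow> j < n \<Longrightarrow> \<bar>w i j - c * weight u i j\<bar> \<le> 2 * \<gamma> * (c * weight u i j)"
  shows "\<bar>(\<Sum>j<n. \<bar>(\<Sum>i<n. w j i) - (\<Sum>i<n. w i j)\<bar>) / (\<Sum>j<n. \<Sum>i<n. w j i) - imbalance u / mass u\<bar> \<le> 16 * \<gamma>"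
    and "0 < (\<Sum>j<n. \<Sum>i<n. w j i)"
proof -
  define R C where "R = (\<lambda>j. \<Sum>i<n. w j i)" and "C = (\<lambda>j. \<Sum>i<n. w i j)"
  define S D where "S = (\<Sum>j<n. R j)" and "D = (\<Sum>j<n. \<bar>R j - C j\<bar>)"
  have R: "\<bar>R j - c * row_mass u j\<bar> \<le> 2 * \<gamma> * (c * row_mass u j)" if "j < n" for j
  proof -
    have "\<bar>R j - c * row_mass u j\<bar> \<le> (\<Sum>i<n. \<bar>w j i - c * weight u j i\<bar>)"
      unfolding R_def row_mass_def sum_distrib_left sum_subtractf[symmetric] by (rule sum_abs)
    also have "\<dots> \<le> (\<Sum>i<n. 2 * \<gamma> * (c * weight u j i))" by (rule sum_mono) (use that w in auto)
    finally show ?thesis by (simp add: row_mass_def sum_distrib_left)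
  qed
  have C: "\<bar>C j - c * col_mass u j\<bar> \<le> 2 * \<gamma> * (c * col_mass u j)" if "j < n" for j
  proof -
    have "\<bar>C j - c * col_mass u j\<bar> \<le> (\<Sum>i<n. \<bar>w i j - c * weight u i j\<bar>)"
      unfolding C_def col_mass_def sum_distrib_left sum_subtractf[symmetric] by (rule sum_abs)
    also have "\<dots> \<le> (\<Sum>i<n. 2 * \<gamma> * (c * weight u i j))" by (rule sum_mono) (use that w in auto)
    finally show ?thesis by (simp add: col_mass_def sum_distrib_left)
  qed
  define S0 D0 where "S0 = c * mass u" and "D0 = c * imbalance u"
  have S0: "0 < S0" using assms(1) mass_pos by (simp add: S0_def)
  have "\<bar>S - S0\<bar> \<le> (\<Sum>j<n. \<bar>R j - c * row_mass u j\<bar>)"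
    unfolding S_def S0_def mass_def sum_distrib_left sum_subtractf[symmetric] by (rule sum_abs)
  also have "\<dots> \<le> (\<Sum>j<n. 2 * \<gamma> * (c * row_mass u j))" by (rule sum_mono) (use R in auto)
  also have "\<dots> = 2 * \<gamma> * S0" by (simp add: S0_def mass_def sum_distrib_left)
  finally have SS: "\<bar>S - S0\<bar> \<le> 2 * \<gamma> * S0" .
  have "2 * \<gamma> * S0 \<le> 1 / 2 * S0" using assms(3) S0 by (intro mult_right_mono) auto
  then have half: "S0 \<le> 2 * S" using SS by linarith
  then have S: "0 < S" using S0 by linarith
  have g2: "2 * \<gamma> * S0 \<le> 4 * \<gamma> * S" using mult_left_mono[OF half, of "2 * \<gamma>"] assms(2) by simp
  have "\<bar>D - D0\<bar> \<le> (\<Sum>j<n. \<bar>\<bar>R j - C j\<bar> - c * \<bar>row_mass u j - col_mass u j\<bar>\<bar>)"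
    unfolding D_def D0_def imbalance_def sum_distrib_left sum_subtractf[symmetric] by (rule sum_abs)
  also have "\<dots> \<le> (\<Sum>j<n. 2 * \<gamma> * (c * row_mass u j) + 2 * \<gamma> * (c * col_mass u j))"
  proof (rule sum_mono)
    fix j assume "j \<in> {..<n}"
    moreover have "c * \<bar>row_mass u j - col_mass u j\<bar> = \<bar>c * row_mass u j - c * col_mass u j\<bar>"
      using assms(1) by (simp add: abs_mult flip: right_diff_distrib)
    ultimately show "\<bar>\<bar>R j - C j\<bar> - c * \<bar>row_mass u j - col_mass u j\<bar>\<bar> \<le> 2 * \<gamma> * (c * row_mass u j) + 2 * \<gamma> * (c * col_mass u j)"
      using R[of j] C[of j] by auto
  qed
  also have "\<dots> = 2 * \<gamma> * (c * (\<Sum>j<n. row_mass u j)) + 2 * \<gamma> * (c * (\<Sum>j<n. col_mass u j))"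
    by (simp add: sum.distrib sum_distrib_left)
  also have "\<dots> = 4 * \<gamma> * S0"
    unfolding mass_eq_col_mass[symmetric] mass_def[symmetric] S0_def by simp
  finally have DD: "\<bar>D - D0\<bar> \<le> 4 * \<gamma> * S0" .
  have "imbalance u \<le> (\<Sum>j<n. row_mass u j + col_mass u j)"
    unfolding imbalance_def
  proof (rule sum_mono)
    fix j assume "j \<in> {..<n}"
    then show "\<bar>row_mass u j - col_mass u j\<bar> \<le> row_mass u j + col_mass u j"
      using row_mass_nonneg[of j u] col_mass_nonneg[of j u] by auto
  qed
  also have "\<dots> = 2 * mass u"
    unfolding sum.distrib mass_eq_col_mass[symmetric] mass_def[symmetric] by simp
  finally have D2: "D0 \<le> 2 * S0" using assms(1) by (simp add: D0_def S0_def)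
  have "0 \<le> D0" using assms(1) by (simp add: D0_def imbalance_def sum_nonneg)
  then have "\<bar>D / S - D0 / S0\<bar> \<le> 8 * \<gamma> + 2 * (4 * \<gamma>)"
    by (intro ratio_error S0 S D2) (use SS DD g2 in linarith)+
  moreover have "D0 / S0 = imbalance u / mass u" using assms(1) by (simp add: D0_def S0_def)
  ultimately show "\<bar>(\<Sum>j<n. \<bar>(\<Sum>i<n. w j i) - (\<Sum>i<n. w i j)\<bar>) / (\<Sum>j<n. \<Sum>i<n. w j i) - imbalance u / mass u\<bar> \<le> 16 * \<gamma>"
    by (simp add: D_def S_def R_def C_def)
  show "0 < (\<Sum>j<n. \<Sum>i<n. w j i)" using S by (simp add: S_def R_def)
qed

text \<open>
  The error splits into the error of the stored logarithms (\<open>16 \<gamma>\<close>, from \<open>perturbed_imbalance\<close>), that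
  of the rounded sums (\<open>4 n\<^sup>2 2\<^bsup>-p\<^esup>\<close>, as there are at most \<open>n\<^sup>2\<close> edges), and that of the final division.
\<close>

lemma computes_fp_estimate:
  assumes u: "grid_vector p \<beta> u" and Lg: "grid_logs p \<Lambda> L" and W: "8 * (\<beta> + \<Lambda> + (real n)\<^sup>2) \<le> W"
    and s: "0 < s" and L: "\<forall>(i, j)\<in>edges n A. \<bar>L i j - ln (A $$ (i, j) / s)\<bar> \<le> \<gamma>"
    and \<gamma>: "0 \<le> \<gamma>" "\<gamma> \<le> 1 / 4"
  obtains g where "computes (fp_estimate n A p L u) (21 * card (edges n A)) (fixed_point p W) g"
    "on_grid p g" "\<bar>g - rel_imbalance n A u\<bar> \<le> 16 * \<gamma> + (4 * (real n)\<^sup>2 + 1) / 2 ^ p"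
    "\<bar>g\<bar> \<le> (real n)\<^sup>2"
proof -
  define m where "m = card (edges n A)"
  define h where "h = 1 / (2::real) ^ p"
  have h: "0 < h" by (simp add: h_def)
  have n: "2 \<le> real n" using n_ge_2 by simp
  have n2: "real n \<le> (real n)\<^sup>2" "1 \<le> (real n)\<^sup>2" 
    using mult_left_mono[of 1 "real n" "real n"] mult_mono[of 1 "real n" 1 "real n"] n by (auto simp: power2_eq_square)
  have mn: "real m \<le> (real n)\<^sup>2"
    using of_nat_mono[OF card_edges_le, where 'a = real] by (simp add: m_def power2_eq_square)
  have W8: "8 * \<beta> + 8 * \<Lambda> + 8 * (real n)\<^sup>2 \<le> W" using W by simp
  have nm: "n \<le> m" unfolding m_def by (rule n_le_card_edges)
  define x where "x = log_entry L u"
  define es where "es = edge_list n A"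
  define b where "b = Max (set (map x es))"
  have x: "on_grid p (x e)" "\<bar>x e\<bar> \<le> 2 * \<beta> + \<Lambda>" if "e \<in> edges n A" for e
    using log_entry_bounds[OF u Lg that] by (auto simp: x_def)
  have xb: "x e \<le> b" if "e \<in> edges n A" for e
    unfolding b_def es_def by (rule Max_ge) (use that finite_edges in \<open>auto simp: edge_list(1)\<close>)
  have "b \<in> set (map x es)" unfolding b_def using edge_list(4) by (intro Max_in) (auto simp: es_def)
  then obtain e0 where e0: "e0 \<in> edges n A" "b = x e0" by (auto simp: es_def edge_list(1))
  have \<beta>: "0 \<le> \<beta>" using u n_ge_2 by (force simp: grid_vector_def)
  have \<Lambda>: "0 \<le> \<Lambda>" using Lg edges_nonempty by (force simp: grid_logs_def)
  have bx: "on_grid p b" "\<bar>b\<bar> \<le> 2 * \<beta> + \<Lambda>" using x[OF e0(1)] e0(2) by auto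
  define rs cs where "rs = (\<lambda>j. map x (row_edges n A j))" and "cs = (\<lambda>j. map x (col_edges n A j))"
  define r c where "r = (\<lambda>j. rounded_exp_sum p b (rs j))" and "c = (\<lambda>j. rounded_exp_sum p b (cs j))"
  define S D where "S = rounded_exp_sum p b (map x es)" and "D = (\<Sum>j\<leftarrow>[0..<n]. \<bar>r j - c j\<bar>)"
  have shifted: "computes (sum_exp_shifted p b (map x fs)) (3 * length fs) (fixed_point p W) (rounded_exp_sum p b (map x fs))"
    if "set fs \<subseteq> edges n A" "real (length fs) \<le> (real n)\<^sup>2" for fs
  proof (subst length_map[of x fs, symmetric], rule computes_sum_exp_shifted)
    fix y assume "y \<in> set (map x fs)"
    then obtain e where e': "y = x e" "e \<in> set fs" unfolding set_map by (rule imageE)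
    then have e: "e \<in> edges n A" "y = x e" using that(1) by auto
    show "on_grid p y \<and> y \<le> b \<and> b - y \<le> W"
      using x[OF e(1)] xb[OF e(1)] bx W \<Lambda> \<beta> n2 unfolding e(2) abs_le_iff by auto
  next
    have nW: "(real n)\<^sup>2 \<le> W" using W8 \<beta> \<Lambda> n2 by linarith
    show "real (length (map x fs)) \<le> W" using order_trans[OF that(2) nW] by simp
    show "1 \<le> W" using nW n2 by linarith
  qed (use bx in auto)
  have rb: "0 \<le> r j" "r j \<le> real n" "on_grid p (r j)" "0 \<le> c j" "c j \<le> real n" "on_grid p (c j)" if j: "j < n" for j
  proof -
    have "y \<le> b" if "y \<in> set (rs j) \<union> set (cs j)" for y
      using that set_row_edges[OF j] set_col_edges[OF j] xb by (auto simp: rs_def cs_def)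
    then have "0 \<le> r j \<and> r j \<le> length (rs j) \<and> on_grid p (r j)" "0 \<le> c j \<and> c j \<le> length (cs j) \<and> on_grid p (c j)"
      using rounded_exp_sum_bounds[of "rs j" b p] rounded_exp_sum_bounds[of "cs j" b p] by (auto simp: r_def c_def)
    then show "0 \<le> r j" "r j \<le> real n" "on_grid p (r j)" "0 \<le> c j" "c j \<le> real n" "on_grid p (c j)"
      using length_row_edges[of j] length_col_edges[of j] by (auto simp: rs_def cs_def)
  qed
  have rc: "\<bar>r j - c j\<bar> \<le> real n" if "j < n" for j using rb[OF that] by (auto simp: abs_le_iff)
  have D_set: "D = (\<Sum>j<n. \<bar>r j - c j\<bar>)"
    unfolding D_def by (simp add: interv_sum_list_conv_sum_set_nat lessThan_atLeast0)
  have Dn: "0 \<le> D" "D \<le> (real n)\<^sup>2"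
  proof -
    show "0 \<le> D" by (simp add: D_set sum_nonneg)
    have "D \<le> (\<Sum>j<n. real n)" unfolding D_set by (rule sum_mono) (use rc in auto)
    then show "D \<le> (real n)\<^sup>2" by (simp add: power2_eq_square)
  qed
  have xbs: "y \<le> b" if "y \<in> set (map x es)" for y using that xb by (auto simp: es_def edge_list(1))
  have S1: "1 \<le> S" unfolding S_def by (rule rounded_exp_sum_ge_1) (use e0 xbs in \<open>auto simp: es_def edge_list(1)\<close>)
  define g where "g = round_down (int p) (D / S)"
  have "D / S \<le> D / 1" using S1 Dn by (intro divide_left_mono) auto
  then have gb: "0 \<le> g" "g \<le> (real n)\<^sup>2" "on_grid p g" "\<bar>g - D / S\<bar> \<le> h"
    using Dn S1 round_down[of "int p" "D / S"] round_down_lower[of "D / S" p]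
    by (auto simp: g_def h_def on_grid_round_down intro!: round_down_nonneg)
  have VW: "2 * \<beta> + \<Lambda> \<le> W" using W \<beta> \<Lambda> n2 by simp
  have row: "computes (log_entries p L u (row_edges n A j) \<bind> (\<lambda>rs. sum_exp_shifted p b rs \<bind>
       (\<lambda>r. log_entries p L u (col_edges n A j) \<bind> (\<lambda>cs. sum_exp_shifted p b cs \<bind>
       (\<lambda>c. fsub p r c \<bind> fabs p)))))
     (5 * (length (row_edges n A j) + length (col_edges n A j)) + 2) (fixed_point p W) \<bar>r j - c j\<bar>"
    if "j \<in> set [0..<n]" for j
  proof -
    have j: "j < n" using that by simp
    have sub: "set (row_edges n A j) \<subseteq> edges n A" "set (col_edges n A j) \<subseteq> edges n A"
      using set_row_edges[OF j] set_col_edges[OF j] by auto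
    have len: "real (length (row_edges n A j)) \<le> (real n)\<^sup>2" "real (length (col_edges n A j)) \<le> (real n)\<^sup>2"
      using length_row_edges[of j] length_col_edges[of j] n2 by linarith+
    have nW: "real n \<le> W" using W8 \<beta> \<Lambda> n2 by linarith
    have c1: "computes (fsub p (r j) (c j)) 1 (fixed_point p W) (r j - c j)"
      by (rule computes_fsub) (use rb[OF j] rc[OF j] nW in auto)
    have c2: "computes (fabs p (r j - c j)) 1 (fixed_point p W) \<bar>r j - c j\<bar>" unfolding fabs_def
      by (rule computes_fx)
        (use rb[OF j] rc[OF j] nW in \<open>auto simp: fixed_point_def on_grid_abs on_grid_diff round_down_on_grid\<close>)
    have s1: "computes (sum_exp_shifted p b (map (log_entry L u) (row_edges n A j)))
        (3 * length (row_edges n A j)) (fixed_point p W) (r j)"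
      using shifted[OF sub(1) len(1)] by (simp add: r_def rs_def x_def)
    have s2: "computes (sum_exp_shifted p b (map (log_entry L u) (col_edges n A j)))
        (3 * length (col_edges n A j)) (fixed_point p W) (c j)"
      using shifted[OF sub(2) len(2)] by (simp add: c_def cs_def x_def)
    show ?thesis
      apply (rule computes_step[OF computes_log_entries[OF u Lg sub(1) VW]])
       apply (rule computes_step[OF s1])
        apply (rule computes_step[OF computes_log_entries[OF u Lg sub(2) VW]])
         apply (rule computes_step[OF s2])
          apply (rule computes_step[OF c1])
           apply (rule computes_mono[OF c2])
      by simp_all
  qed
  have sumD: "computes (fsum p (map (\<lambda>j. \<bar>r j - c j\<bar>) [0..<n])) n (fixed_point p W) D"
  proof -
    have "computes (fsum p (map (\<lambda>j. \<bar>r j - c j\<bar>) [0..<n])) (length (map (\<lambda>j. \<bar>r j - c j\<bar>) [0..<n]))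
        (fixed_point p W) D"
      unfolding D_def
    proof (rule computes_fsum)
      show "(\<Sum>j\<leftarrow>[0..<n]. \<bar>r j - c j\<bar>) \<le> W" using Dn W8 \<beta> \<Lambda> n2 unfolding D_def by linarith
    qed (use rb in \<open>auto simp: on_grid_abs on_grid_diff\<close>)
    then show ?thesis by simp
  qed
  have quotient: "computes (fdiv p D S) 1 (fixed_point p W) g" unfolding fdiv_def
    by (rule computes_fx) (use gb W \<beta> \<Lambda> n2 in \<open>auto simp: g_def[symmetric] fixed_point_def\<close>)
  have sub: "set es \<subseteq> edges n A" and len: "length es = m" "real (length es) \<le> (real n)\<^sup>2"
    using edge_list mn by (auto simp: es_def m_def)
  have maximum: "computes (fmaximum p (map (log_entry L u) es)) m (fixed_point p W) b"
  proof -
    have "computes (fmaximum p (map x es)) (length (map x es)) (fixed_point p W) b"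
      unfolding b_def
    proof (rule computes_fmaximum)
      fix y assume "y \<in> set (map x es)"
      then obtain e where e: "y = x e" "e \<in> set es" unfolding set_map by (rule imageE)
      then have "e \<in> edges n A" using sub by auto
      then show "fixed_point p W y" using x[of e] VW e(1) by (auto simp: fixed_point_def)
    qed (simp add: es_def edge_list(4))
    then show ?thesis by (simp add: len x_def)
  qed
  have weights: "computes (sum_exp_shifted p b (map (log_entry L u) es)) (3 * m) (fixed_point p W) S"
    using shifted[OF sub len(2)] by (simp add: S_def x_def len)
  have "(\<Sum>j\<leftarrow>[0..<n]. 5 * (length (row_edges n A j) + length (col_edges n A j)) + 2)
      = 5 * (\<Sum>j<n. length (row_edges n A j) + length (col_edges n A j)) + 2 * n"
    unfolding interv_sum_list_conv_sum_set_nat sum.distrib[of _ "\<lambda>_. 2"] sum_distrib_left[symmetric]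
    by (simp add: lessThan_atLeast0)
  also have "\<dots> \<le> 12 * m" using sum_degrees nm by (simp add: m_def)
  finally have cost: "(\<Sum>j\<leftarrow>[0..<n]. 5 * (length (row_edges n A j) + length (col_edges n A j)) + 2) \<le> 12 * m" .
  note rows = computes_mono[OF computes_map[OF row, where xs = "[0..<n]"] cost]
  have comp: "computes (fp_estimate n A p L u) (21 * m) (fixed_point p W) g"
    unfolding fp_estimate_def es_def[symmetric]
    apply (rule computes_step[OF computes_log_entries[OF u Lg sub VW]])
     apply (rule computes_step[OF maximum])
      apply (rule computes_step[OF weights])
       apply (rule computes_step[OF rows], assumption)
        apply (rule computes_step[OF sumD])
         apply (rule computes_mono[OF quotient])
    using nm n_ge_2 by (simp_all add: len)
  \<comment> \<open>the shifted weights without rounding, between the rounded sums and the true imbalance\<close>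
  define w where "w = (\<lambda>i j. if (i, j) \<in> edges n A then exp (x (i, j) - b) else 0)"
  have "\<bar>w i j - exp (- b) / s * weight u i j\<bar> \<le> 2 * \<gamma> * (exp (- b) / s * weight u i j)" if "i < n" "j < n" for i j
  proof (cases "(i, j) \<in> edges n A")
    case True
    define t where "t = L i j - ln (A $$ (i, j) / s)"
    have t: "\<bar>t\<bar> \<le> \<gamma>" using L True by (auto simp: t_def)
    define M where "M = exp (- b) / s * weight u i j"
    have "exp (x (i, j) - b) = exp ((u i - u j) + ln (A $$ (i, j) / s) + (- b) + t)"
      by (simp add: x_def log_entry_def t_def)
    also have "\<dots> = exp (u i - u j) * (A $$ (i, j) / s) * exp (- b) * exp t"
      unfolding exp_add using edge_pos[OF True] s by simp
    finally have "w i j = M * exp t" using True by (simp add: w_def M_def weight_def)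
    then have "w i j - M = M * (exp t - 1)" by (simp add: algebra_simps)
    moreover have M: "0 \<le> M" using s weight_nonneg[OF that] by (simp add: M_def)
    ultimately have "\<bar>w i j - M\<bar> = M * \<bar>exp t - 1\<bar>" by (simp add: abs_mult)
    also have "\<dots> \<le> M * (2 * \<gamma>)"
      using exp_minus_one_abs_le[of t] t \<gamma> M by (intro mult_left_mono) auto
    finally show ?thesis unfolding M_def by (simp add: algebra_simps)
  next
    case False
    then show ?thesis using that by (simp add: w_def weight_def edges_def)
  qed
  note pert = perturbed_imbalance[OF _ \<gamma> this]
  define S' D' where "S' = (\<Sum>j<n. \<Sum>i<n. w j i)" and "D' = (\<Sum>j<n. \<bar>(\<Sum>i<n. w j i) - (\<Sum>i<n. w i j)\<bar>)"
  have S': "0 < S'" and DS: "\<bar>D' / S' - imbalance u / mass u\<bar> \<le> 16 * \<gamma>"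
    using pert s by (auto simp: S'_def D'_def)
  have w0: "0 \<le> w i j" for i j by (simp add: w_def)
  have RC: "\<bar>r j - (\<Sum>i<n. w j i)\<bar> \<le> real n * h" "\<bar>c j - (\<Sum>i<n. w i j)\<bar> \<le> real n * h" if "j < n" for j
    using rounded_row_col[OF that xb[unfolded x_def], of p]
    unfolding r_def rs_def c_def cs_def w_def x_def h_def by simp_all
  have "\<bar>D - D'\<bar> \<le> (\<Sum>j<n. \<bar>\<bar>r j - c j\<bar> - \<bar>(\<Sum>i<n. w j i) - (\<Sum>i<n. w i j)\<bar>\<bar>)"
    unfolding D_set D'_def sum_subtractf[symmetric] by (rule sum_abs)
  also have "\<dots> \<le> (\<Sum>j<n. 2 * (real n * h))"
  proof (rule sum_mono)
    fix j assume "j \<in> {..<n}"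
    then show "\<bar>\<bar>r j - c j\<bar> - \<bar>(\<Sum>i<n. w j i) - (\<Sum>i<n. w i j)\<bar>\<bar> \<le> 2 * (real n * h)"
      using RC[of j] by auto
  qed
  finally have D_err: "\<bar>D - D'\<bar> \<le> 2 * (real n)\<^sup>2 * h" by (simp add: power2_eq_square)
  have S'_eq: "S' = (\<Sum>y\<leftarrow>map x es. exp (y - b))"
  proof -
    have "S' = (\<Sum>e\<in>{..<n} \<times> {..<n}. w (fst e) (snd e))"
      unfolding S'_def by (simp add: sum.cartesian_product case_prod_beta)
    also have "\<dots> = (\<Sum>e\<in>edges n A. exp (x e - b))"
      by (rule sum.mono_neutral_cong_right) (auto simp: w_def edges_def)
    finally show ?thesis using edge_list(3)[of "\<lambda>e. exp (x e - b)"] by (simp add: es_def comp_def)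
  qed
  have "real m / 2 ^ p \<le> (real n)\<^sup>2 * h" using mn by (simp add: h_def divide_right_mono)
  then have S_err: "\<bar>S - S'\<bar> \<le> (real n)\<^sup>2 * h"
    using rounded_exp_sum_bounds(3,4)[of "map x es" b p] xbs unfolding S'_eq S_def by (simp add: len abs_le_iff)
  have D'2: "D' \<le> 2 * S'"
  proof -
    have "D' \<le> (\<Sum>j<n. (\<Sum>i<n. w j i) + (\<Sum>i<n. w i j))"
      unfolding D'_def
    proof (rule sum_mono)
      fix j
      have "0 \<le> (\<Sum>i<n. w j i)" "0 \<le> (\<Sum>i<n. w i j)" using w0 by (auto intro: sum_nonneg)
      then show "\<bar>(\<Sum>i<n. w j i) - (\<Sum>i<n. w i j)\<bar> \<le> (\<Sum>i<n. w j i) + (\<Sum>i<n. w i j)" by linarith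
    qed
    also have "\<dots> = 2 * S'" unfolding sum.distrib S'_def by (subst (2) sum.swap) simp
    finally show ?thesis .
  qed
  have "0 \<le> D'" by (simp add: D'_def sum_nonneg)
  moreover have "2 * (real n)\<^sup>2 * h \<le> 2 * (real n)\<^sup>2 * h * S" "(real n)\<^sup>2 * h \<le> (real n)\<^sup>2 * h * S"
    using mult_left_mono[OF S1, of "2 * (real n)\<^sup>2 * h"] mult_left_mono[OF S1, of "(real n)\<^sup>2 * h"] h by auto
  ultimately have "\<bar>D / S - D' / S'\<bar> \<le> 2 * (real n)\<^sup>2 * h + 2 * ((real n)\<^sup>2 * h)"
    using S1 S' D'2 D_err S_err by (intro ratio_error) linarith+
  then have "\<bar>g - imbalance u / mass u\<bar> \<le> 16 * \<gamma> + (4 * (real n)\<^sup>2 * h + h)" using gb(4) DS by linarith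
  then have "\<bar>g - rel_imbalance n A u\<bar> \<le> 16 * \<gamma> + (4 * (real n)\<^sup>2 + 1) / 2 ^ p"
    by (simp add: rel_imbalance_eq h_def add_divide_distrib)
  then show ?thesis using that comp gb by (auto simp: m_def)
qed

end

section \<open>Runs of the fixed-point program\<close>

text \<open>
  The conditions on the precisions are those under which rounding stays below the accuracies of
  an inexact implementation; the last one makes the estimate of the imbalance wrong by at most
  half of \<open>\<epsilon> / 3\<close>.
\<close>

locale fixed_point_osborne = osborne_input n A for n A +
  fixes \<epsilon> s \<gamma> \<gamma>' \<tau> :: real and \<pi> :: "nat \<Rightarrow> nat \<Rightarrow> nat" and q q' p :: nat
  assumes eps: "0 < \<epsilon>" "\<epsilon> < 1" and s_pos: "0 < s" and perm: "\<And>k. bij_betw (\<pi> k) {..<n} {..<n}"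
    and tolerance: "0 \<le> \<gamma>" "0 \<le> \<gamma>'" "\<gamma> + 2 * \<gamma>' \<le> \<epsilon> / 2400" "\<tau> = \<epsilon> / 3"
    and precision: "q \<le> p" "q' \<le> p" "1 / 2 ^ q \<le> \<gamma>" "1 / 2 ^ q' \<le> \<gamma>'" "(real n + 2) / 2 ^ p \<le> \<gamma>'"
      "16 * \<gamma> + (4 * (real n)\<^sup>2 + 1) / 2 ^ p \<le> \<epsilon> / 6"
begin

abbreviation "L \<equiv> fp_logs A s q"

abbreviation "U \<equiv> fp_iterate n A s \<pi> q q' p \<tau>"

abbreviation "g \<equiv> fp_estimates n A s \<pi> q q' p \<tau>"

abbreviation "m \<equiv> card (edges n A)"

abbreviation "cycle \<equiv> fp_cycle n A s \<pi> q q' p \<tau>"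

abbreviation "init \<equiv> fp_init n A s q p \<tau>"

lemma logs_close: "\<forall>(i, j)\<in>edges n A. \<bar>L i j - ln (A $$ (i, j) / s)\<bar> \<le> \<gamma>"
  unfolding fp_logs_def using round_down_lower[of _ q] round_down[of "int q"] precision(3)
  by (auto simp: abs_le_iff) (smt (verit, best))+

lemma logs_on_grid: "on_grid p (L i j)"
  unfolding fp_logs_def using on_grid_mono[OF precision(1) on_grid_round_down] .

text \<open>
  The operation count is \<open>20 m\<close> for the sweep, \<open>21 m\<close> for the estimate and \<open>1\<close> for the comparison.
  The comparison is decided correctly although \<open>\<tau>\<close> is rounded, because the estimate is on the grid.
\<close>

lemma cycle_step:
  assumes u: "grid_vector p \<beta> u" and Lg: "grid_logs p \<Lambda> L"
    and W: "8 * (\<beta> + n * (\<Lambda> + real n + 1) + \<Lambda> + (real n)\<^sup>2) \<le> W"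
  obtains v e where
    "\<And>h tr. \<exists>ws. cycle (k, u, h, tr) = (Suc k, v, e \<le> \<tau>, ws @ tr) \<and> length ws \<le> 42 * m \<and>
       (\<forall>x\<in>set ws. fixed_point p W x)"
    "inexact_sweep n A L \<gamma>' (map (\<pi> k) [0..<n]) u v"
    "grid_vector p (\<beta> + n * (\<Lambda> + real n + 1)) v"
    "fst (run_state (fp_estimate n A p L v) []) = e" "\<bar>e - rel_imbalance n A v\<bar> \<le> \<epsilon> / 6"
proof -
  define js where "js = map (\<pi> k) [0..<n]"
  have "inj_on (\<pi> k) {0..<n}" "\<pi> k ` {0..<n} = {..<n}"
    using perm[of k] by (auto simp: bij_betw_def lessThan_atLeast0)
  then have js: "distinct js" "set js = {..<n}" "length js = n" by (auto simp: js_def distinct_map)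
  have n: "2 \<le> real n" using n_ge_2 by simp
  then have n2: "real n \<le> (real n)\<^sup>2" "4 \<le> (real n)\<^sup>2"
    using mult_left_mono[of 1 "real n" "real n"] mult_mono[of 2 "real n" 2 "real n"] by (auto simp: power2_eq_square)
  define G where "G = n * (\<Lambda> + real n + 1)"
  have W8: "8 * \<beta> + 8 * G + 8 * \<Lambda> + 8 * (real n)\<^sup>2 \<le> W" using W unfolding G_def[symmetric] by simp
  have \<beta>: "0 \<le> \<beta>" using u n_ge_2 by (force simp: grid_vector_def)
  have \<Lambda>: "0 \<le> \<Lambda>" using Lg edges_nonempty by (force simp: grid_logs_def)
  have G: "0 \<le> G" unfolding G_def using \<Lambda> by simp
  have \<gamma>1: "\<gamma> \<le> 1 / 4" "\<gamma>' \<le> 1" using tolerance eps by auto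
  have "8 * \<beta> + 8 * G + 8 * \<Lambda> + 8 * real n \<le> W" using W8 n2 by linarith
  then have Wn: "8 * (\<beta> + G + \<Lambda> + real n) \<le> W" by simp
  have "\<exists>v. computes (fp_sweep n A q' p L js u)
       (\<Sum>j\<leftarrow>js. 10 * (length (row_edges n A j) + length (col_edges n A j))) (fixed_point p W) v \<and>
     inexact_sweep n A L \<gamma>' js u v \<and> grid_vector p (\<beta> + length js * (\<Lambda> + real n + 1)) v"
    by (rule computes_fp_sweep[OF Lg precision(2,4,5) \<gamma>1(2) _ u]) (use js Wn in \<open>auto simp: G_def\<close>)
  then obtain v where v: "computes (fp_sweep n A q' p L js u)
       (\<Sum>j\<leftarrow>js. 10 * (length (row_edges n A j) + length (col_edges n A j))) (fixed_point p W) v"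
     "inexact_sweep n A L \<gamma>' js u v" "grid_vector p (\<beta> + G) v"
    by (auto simp: js G_def)
  have cost: "(\<Sum>j\<leftarrow>js. 10 * (length (row_edges n A j) + length (col_edges n A j))) = 20 * m"
    unfolding sum_list_distinct_conv_sum_set[OF js(1)] js(2) sum_distrib_left[symmetric] sum_degrees by simp
  have We: "8 * (\<beta> + G + \<Lambda> + (real n)\<^sup>2) \<le> W" using W8 by simp
  obtain e where e: "computes (fp_estimate n A p L v) (21 * m) (fixed_point p W) e"
    "on_grid p e" "\<bar>e - rel_imbalance n A v\<bar> \<le> 16 * \<gamma> + (4 * (real n)\<^sup>2 + 1) / 2 ^ p" "\<bar>e\<bar> \<le> (real n)\<^sup>2"
    by (rule computes_fp_estimate[OF v(3) Lg We s_pos logs_close tolerance(1) \<gamma>1(1)])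
  define r where "r = round_down (int p) \<tau>"
  have \<tau>: "0 \<le> \<tau>" "\<tau> \<le> 1" using tolerance eps by auto
  have r: "on_grid p r" "0 \<le> r" "r \<le> 1"
    using \<tau> round_down[of "int p" \<tau>] by (auto simp: r_def on_grid_round_down intro!: round_down_nonneg)
  have stop: "e - r \<le> 0 \<longleftrightarrow> e \<le> \<tau>"
    using round_down_mono[of e \<tau> p] round_down_on_grid[OF e(2)] round_down[of "int p" \<tau>] by (auto simp: r_def)
  have "\<bar>e - r\<bar> \<le> W" using e(4) r W8 n2 \<beta> G \<Lambda> by (simp add: abs_le_iff)
  then have t: "computes (fsub p e r) 1 (fixed_point p W) (e - r)"
    by (intro computes_fsub e r)
  have nm: "1 \<le> m" using n_le_card_edges n_ge_2 by linarith
  have "computes (fp_sweep n A q' p L js u \<bind> (\<lambda>v. fp_estimate n A p L v \<bind> (\<lambda>g. fsub p g r \<bind>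
      (\<lambda>t. State_Monad.return (v, t \<le> 0))))) (42 * m) (fixed_point p W) (v, e - r \<le> 0)"
    apply (rule computes_step[OF v(1)[unfolded cost]])
     apply (rule computes_step[OF e(1)])
      apply (rule computes_step[OF t])
       apply (rule computes_return)
    using nm by simp_all
  then obtain ws where ws: "\<And>tr. run_state (fp_sweep n A q' p L js u \<bind> (\<lambda>v. fp_estimate n A p L v \<bind> (\<lambda>g. fsub p g r \<bind>
      (\<lambda>t. State_Monad.return (v, t \<le> 0))))) tr = ((v, e \<le> \<tau>), ws @ tr)"
    "length ws \<le> 42 * m" "\<forall>x\<in>set ws. fixed_point p W x"
    unfolding computes_def stop by auto
  show ?thesis
  proof (rule that)
    show "\<exists>ws. cycle (k, u, h, tr) = (Suc k, v, e \<le> \<tau>, ws @ tr) \<and> length ws \<le> 42 * m \<and>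
       (\<forall>x\<in>set ws. fixed_point p W x)" for h tr
      by (rule exI[of _ ws]) (use ws in \<open>simp add: fp_cycle_def flip: js_def r_def\<close>)
    show "inexact_sweep n A L \<gamma>' (map (\<pi> k) [0..<n]) u v" using v(2) by (simp add: js_def)
    show "grid_vector p (\<beta> + n * (\<Lambda> + real n + 1)) v" using v(3) by (simp add: G_def)
    show "fst (run_state (fp_estimate n A p L v) []) = e" by (rule computes_value[OF e(1)])
    show "\<bar>e - rel_imbalance n A v\<bar> \<le> \<epsilon> / 6" using e(3) precision(6) by linarith
  qed
qed

text \<open>
  The bound \<open>W\<close> on the numbers is fixed beforehand for \<open>K\<close> cycles, since the iterates may drift by
  \<open>n (\<Lambda> + n + 1)\<close> in each.
\<close>

lemma program_invariant:
  assumes Lg: "grid_logs p \<Lambda> L" and W: "8 * (real K * (n * (\<Lambda> + real n + 1)) + \<Lambda> + (real n)\<^sup>2) \<le> W"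
    and "k \<le> K"
  shows "(\<exists>h tr. (cycle ^^ k) init = (k, U k, h, tr) \<and> h = (1 \<le> k \<and> g k \<le> \<tau>) \<and>
      length tr \<le> 1 + m + k * (42 * m) \<and> (\<forall>x\<in>set tr. fixed_point p W x)) \<and>
    grid_vector p (real k * (n * (\<Lambda> + real n + 1))) (U k) \<and>
    (\<forall>i<k. inexact_sweep n A L \<gamma>' (map (\<pi> i) [0..<n]) (U i) (U (Suc i))) \<and>
    (\<forall>i\<in>{1..k}. \<bar>g i - rel_imbalance n A (U i)\<bar> \<le> \<epsilon> / 6)"
  using assms(3)
proof (induction k)
  case 0
  have \<Lambda>: "0 \<le> \<Lambda>" using Lg edges_nonempty by (force simp: grid_logs_def)
  define X where "X = real K * (n * (\<Lambda> + real n + 1))"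
  have "0 \<le> X" unfolding X_def using \<Lambda> by simp
  moreover have "8 * X + 8 * \<Lambda> + 8 * (real n)\<^sup>2 \<le> W" using W unfolding X_def[symmetric] by simp
  ultimately have W8: "\<Lambda> \<le> W" "(real n)\<^sup>2 \<le> W" using \<Lambda> zero_le_power2[of "real n"] by linarith+
  have n: "2 \<le> real n" using n_ge_2 by simp
  have "1 \<le> (real n)\<^sup>2" using n by simp
  then have "1 \<le> W" using W8 by linarith
  have \<tau>: "0 \<le> \<tau>" "\<tau> \<le> 1" using tolerance eps by auto
  have "fixed_point p W (round_down (int p) \<tau>)"
    using \<tau> round_down[of "int p" \<tau>] round_down_nonneg[OF \<tau>(1), of "int p"] \<open>1 \<le> W\<close>
    by (simp add: fixed_point_def on_grid_round_down)
  moreover have "fixed_point p W (L i j)" if "(i, j) \<in> edges n A" for i j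
    using Lg that W8 by (force simp: fixed_point_def grid_logs_def)
  ultimately show ?case
    by (auto simp: fp_init_def fp_iterate_def edge_list grid_vector_def on_grid_0)
next
  case (Suc k)
  define G where "G = n * (\<Lambda> + real n + 1)"
  have \<Lambda>: "0 \<le> \<Lambda>" using Lg edges_nonempty by (force simp: grid_logs_def)
  have G: "0 \<le> G" unfolding G_def using \<Lambda> by simp
  from Suc obtain h tr where IH: "(cycle ^^ k) init = (k, U k, h, tr)" "length tr \<le> 1 + m + k * (42 * m)"
      "\<forall>x\<in>set tr. fixed_point p W x" "grid_vector p (real k * G) (U k)"
      "\<forall>i<k. inexact_sweep n A L \<gamma>' (map (\<pi> i) [0..<n]) (U i) (U (Suc i))"
      "\<forall>i\<in>{1..k}. \<bar>g i - rel_imbalance n A (U i)\<bar> \<le> \<epsilon> / 6"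
    by (auto simp: G_def)
  have "real (Suc k) * G \<le> real K * G" using Suc.prems G by (intro mult_right_mono) auto
  then have "real k * G + G \<le> real K * G" by (simp add: algebra_simps)
  then have W': "8 * (real k * G + n * (\<Lambda> + real n + 1) + \<Lambda> + (real n)\<^sup>2) \<le> W"
    using W unfolding G_def[symmetric] by simp
  obtain v e where step:
    "\<And>h tr. \<exists>ws. cycle (k, U k, h, tr) = (Suc k, v, e \<le> \<tau>, ws @ tr) \<and> length ws \<le> 42 * m \<and>
       (\<forall>x\<in>set ws. fixed_point p W x)"
    "inexact_sweep n A L \<gamma>' (map (\<pi> k) [0..<n]) (U k) v"
    "grid_vector p (real k * G + n * (\<Lambda> + real n + 1)) v"
    "fst (run_state (fp_estimate n A p L v) []) = e" "\<bar>e - rel_imbalance n A v\<bar> \<le> \<epsilon> / 6"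
    using cycle_step[OF IH(4) Lg W', where k = k] by metis
  obtain ws where ws: "cycle (k, U k, h, tr) = (Suc k, v, e \<le> \<tau>, ws @ tr)" "length ws \<le> 42 * m"
       "\<forall>x\<in>set ws. fixed_point p W x" using step(1) by blast
  have st: "(cycle ^^ Suc k) init = (Suc k, v, e \<le> \<tau>, ws @ tr)" by (simp add: IH(1) ws(1))
  have v: "U (Suc k) = v" unfolding fp_iterate_def st by simp
  have e: "g (Suc k) = e" unfolding fp_estimates_def v by (rule step(4))
  have "real k * G + n * (\<Lambda> + real n + 1) = real (Suc k) * G" by (simp add: G_def algebra_simps)
  then have gv: "grid_vector p (real (Suc k) * G) (U (Suc k))" using step(3) v by simp
  show ?case
    unfolding G_def[symmetric] st
    using gv IH ws step v e by (auto simp: less_Suc_eq le_Suc_eq)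
qed

lemma grid_logs_exist: "\<exists>\<Lambda>. grid_logs p \<Lambda> L"
proof -
  have "grid_logs p (Max ((\<lambda>(i, j). \<bar>L i j\<bar>) ` edges n A)) L"
    unfolding grid_logs_def using finite_edges by (auto simp: logs_on_grid intro!: Max_ge)
  then show ?thesis ..
qed

lemma program_run:
  assumes "\<And>k. 1 \<le> k \<Longrightarrow> k < K \<Longrightarrow> \<tau> < g k"
  shows "inexact_run n A s \<pi> \<gamma> \<gamma>' (\<epsilon> / 3) (\<epsilon> / 3) L U g K"
proof -
  obtain \<Lambda> where \<Lambda>: "grid_logs p \<Lambda> L" using grid_logs_exist by blast
  note inv = program_invariant[OF \<Lambda> order_refl order_refl, of K]
  have "rel_imbalance n A (U k) / 2 - \<epsilon> / 3 / 2 \<le> g k \<and> g k \<le> 2 * rel_imbalance n A (U k) + \<epsilon> / 3 / 2"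
    if "k \<in> {1..K}" for k
  proof -
    have "\<bar>g k - rel_imbalance n A (U k)\<bar> \<le> \<epsilon> / 6" using inv that by blast
    moreover have "0 \<le> rel_imbalance n A (U k)"
      unfolding rel_imbalance_eq using mass_pos[of "U k"] by (simp add: imbalance_def sum_nonneg)
    ultimately show ?thesis unfolding abs_le_iff by (intro conjI) linarith+
  qed
  moreover have "U 0 = (\<lambda>_. 0)" by (simp add: fp_iterate_def fp_init_def)
  ultimately show ?thesis
    unfolding inexact_run_def using inv logs_close assms tolerance(4) by auto
qed

lemma run_bounds:
  assumes "inexact_run n A s \<pi> \<gamma> \<gamma>' (\<epsilon> / 3) (\<epsilon> / 3) L' U' g' K"
  shows "real K \<le> 240000 * (ln (kappa n A) / \<epsilon> * min (1 / \<epsilon>) (real (graph_diameter n A)))"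
    and "1 \<le> K \<Longrightarrow> g' K \<le> \<epsilon> / 3 \<Longrightarrow> eps_balancing n A \<epsilon> (U' K)"
  using inexact_run_bounds[OF s_pos eps perm tolerance(1-3) assms] by blast+

text \<open>
  A program that never stopped would yield inexact runs of every length.
\<close>

lemma terminates: "\<exists>K\<ge>1. g K \<le> \<tau> \<and> (\<forall>k\<in>{1..<K}. \<tau> < g k)"
proof -
  have "\<exists>K\<ge>1. g K \<le> \<tau>"
  proof (rule ccontr)
    assume "\<not> (\<exists>K\<ge>1. g K \<le> \<tau>)"
    then have "inexact_run n A s \<pi> \<gamma> \<gamma>' (\<epsilon> / 3) (\<epsilon> / 3) L U g K" for K
      by (intro program_run) force
    from run_bounds(1)[OF this] show False
      using reals_Archimedean2[of "240000 * (ln (kappa n A) / \<epsilon> * min (1 / \<epsilon>) (real (graph_diameter n A)))"]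
      by (meson not_le)
  qed
  then obtain K where K: "1 \<le> K \<and> g K \<le> \<tau>" by blast
  define K0 where "K0 = (LEAST k. 1 \<le> k \<and> g k \<le> \<tau>)"
  have "1 \<le> K0 \<and> g K0 \<le> \<tau>" unfolding K0_def by (rule LeastI[of _ K]) (rule K)
  moreover have "\<tau> < g k" if "k \<in> {1..<K0}" for k
    using not_less_Least[of k "\<lambda>k. 1 \<le> k \<and> g k \<le> \<tau>"] that unfolding K0_def by force
  ultimately show ?thesis by blast
qed

lemma program_result:
  assumes "1 \<le> K" "g K \<le> \<tau>" "\<And>k. k \<in> {1..<K} \<Longrightarrow> \<tau> < g k"
  shows "\<exists>tr. fp_osborne n A s \<pi> q q' p \<tau> = Some (K, U K, True, tr) \<and> length tr \<le> 44 * m * K \<and>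
    (\<forall>\<Lambda> W. grid_logs p \<Lambda> L \<longrightarrow> 8 * (real K * (n * (\<Lambda> + real n + 1)) + \<Lambda> + (real n)\<^sup>2) \<le> W \<longrightarrow>
       (\<forall>x\<in>set tr. fixed_point p W x))"
proof -
  define b where "b = (\<lambda>(k::nat, u::nat \<Rightarrow> real, halted, tr::real list). \<not> halted)"
  define tr where "tr = snd (snd (snd ((cycle ^^ K) init)))"
  obtain \<Lambda>0 where \<Lambda>0: "grid_logs p \<Lambda>0 L" using grid_logs_exist by blast
  \<comment> \<open>control flow and length do not depend on the bounds used for the numbers\<close>
  have state: "\<exists>tr. (cycle ^^ k) init = (k, U k, 1 \<le> k \<and> g k \<le> \<tau>, tr) \<and> length tr \<le> 1 + m + k * (42 * m)"
    if "k \<le> K" for k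
    using program_invariant[OF \<Lambda>0 order_refl that] by auto
  then obtain tr0 where tr0: "(cycle ^^ K) init = (K, U K, True, tr0)" "length tr0 \<le> 1 + m + K * (42 * m)"
    using assms(1,2) by force
  have K: "(cycle ^^ K) init = (K, U K, True, tr)" using tr0(1) by (simp add: tr_def)
  have before: "b ((cycle ^^ k) init)" if k: "k < K" for k
  proof -
    obtain tr' where "(cycle ^^ k) init = (k, U k, 1 \<le> k \<and> g k \<le> \<tau>, tr')"
      using state[OF less_imp_le[OF k]] by auto
    then show ?thesis using assms(3)[of k] k by (auto simp: b_def)
  qed
  have "(LEAST k. \<not> b ((cycle ^^ k) init)) = K"
  proof (rule Least_equality)
    show "\<not> b ((cycle ^^ K) init)" unfolding K by (simp add: b_def)
  qed (use before not_less in blast)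
  moreover have "\<exists>k. \<not> b ((cycle ^^ k) init)" using K by (intro exI[of _ K]) (simp add: b_def)
  ultimately have res: "fp_osborne n A s \<pi> q q' p \<tau> = Some (K, U K, True, tr)"
    unfolding fp_osborne_def b_def[symmetric] while_option_def by (simp add: K)
  have "1 \<le> m" using n_le_card_edges n_ge_2 by linarith
  moreover have "m \<le> m * K" using assms(1) by simp
  moreover have "K * (42 * m) = 42 * (m * K)" "44 * m * K = 44 * (m * K)" by simp_all
  ultimately have "1 + m + K * (42 * m) \<le> 44 * m * K" by linarith
  moreover have "tr = tr0" using tr0(1) K by simp
  ultimately have len: "length tr \<le> 44 * m * K" using tr0(2) by (metis order_trans)
  have "\<forall>x\<in>set tr. fixed_point p W x"
    if "grid_logs p \<Lambda> L" "8 * (real K * (n * (\<Lambda> + real n + 1)) + \<Lambda> + (real n)\<^sup>2) \<le> W" for \<Lambda> W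
    using program_invariant[OF that order_refl] K by auto
  then show ?thesis using res len by blast
qed

lemma logs_bound:
  assumes "min_entry n A \<le> s" "s \<le> entry_sum n A"
  shows "grid_logs p (ln (kappa n A) + 1) L"
  unfolding grid_logs_def
proof (intro ballI, clarify)
  fix i j assume e: "(i, j) \<in> edges n A"
  note ij = edge_bounds[OF e]
  have a: "min_entry n A \<le> A $$ (i, j)" "0 < A $$ (i, j)" by (rule min_entry_le[OF e], rule edge_pos[OF e])
  have b: "A $$ (i, j) \<le> entry_sum n A"
    using weight_le_row_mass[of i j "\<lambda>_. 0"] row_mass_le_mass[of i "\<lambda>_. 0"] ij by (simp add: weight_def flip: mass_zero)
  have pos: "0 < min_entry n A" "0 < entry_sum n A" using min_entry_pos a b by auto
  have "A $$ (i, j) / s \<le> kappa n A" "s / A $$ (i, j) \<le> kappa n A"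
    unfolding kappa_def by (intro frac_le; use a b assms pos in auto)+
  then have "ln (A $$ (i, j) / s) \<le> ln (kappa n A)" "ln (s / A $$ (i, j)) \<le> ln (kappa n A)"
    using a s_pos kappa_ge_2 by (subst ln_le_cancel_iff; simp)+
  then have "\<bar>ln (A $$ (i, j) / s)\<bar> \<le> ln (kappa n A)" using a s_pos by (simp add: ln_div abs_le_iff)
  moreover have "\<bar>L i j - ln (A $$ (i, j) / s)\<bar> \<le> \<gamma>" using logs_close e by auto
  ultimately show "on_grid p (L i j) \<and> \<bar>L i j\<bar> \<le> ln (kappa n A) + 1"
    using tolerance eps by (auto simp: logs_on_grid)
qed

text \<open>
  With \<open>X = n \<kappa> / \<epsilon> \<ge> 4\<close>, all of \<open>n\<close>, \<open>\<kappa>\<close>, \<open>\<Lambda>\<close> and \<open>1 / \<epsilon>\<close> are at most \<open>X\<close> and \<open>K = O(X\<^sup>2)\<close>, so the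
  numbers are bounded by \<open>O(X\<^sup>4)\<close>, the constant being below \<open>4 ^ 12 \<le> X ^ 12\<close>.
\<close>

lemma bit_length:
  assumes p: "real p \<le> 20 * log 2 (n / \<epsilon>) + 1" and s: "min_entry n A \<le> s" "s \<le> entry_sum n A"
    and K: "real K \<le> 240000 * (ln (kappa n A) / \<epsilon> * min (1 / \<epsilon>) (real (graph_diameter n A)))"
    and tr: "\<And>\<Lambda> W x. grid_logs p \<Lambda> L \<Longrightarrow>
      8 * (real K * (n * (\<Lambda> + real n + 1)) + \<Lambda> + (real n)\<^sup>2) \<le> W \<Longrightarrow> x \<in> set tr \<Longrightarrow> fixed_point p W x"
  shows "\<exists>b. real b \<le> 76 * ln (n * kappa n A / \<epsilon>) \<and> (\<forall>x\<in>set tr. bit_number b x)"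
proof -
  define \<kappa> where "\<kappa> = kappa n A"
  define X where "X = n * \<kappa> / \<epsilon>"
  have \<kappa>: "2 \<le> \<kappa>" unfolding \<kappa>_def by (rule kappa_ge_2)
  have n: "2 \<le> real n" using n_ge_2 by simp
  have ie: "1 \<le> 1 / \<epsilon>" using eps by simp
  have nk: "n \<le> n * \<kappa>" "\<kappa> \<le> n * \<kappa>" "2 * 2 \<le> n * \<kappa>"
    using n \<kappa> mult_left_mono[of 1 \<kappa> "real n"] mult_right_mono[of 1 "real n" \<kappa>] mult_mono[of 2 "real n" 2 \<kappa>] by auto
  have nkX: "n * \<kappa> \<le> X" unfolding X_def using mult_left_mono[OF ie, of "n * \<kappa>"] n \<kappa> by simp
  have X: "4 \<le> X" "n \<le> X" "\<kappa> \<le> X" using nk nkX by auto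
  have ieX: "\<kappa> / \<epsilon> \<le> X"
    unfolding X_def using nk(2) eps by (simp add: divide_right_mono)
  have ieX': "1 / \<epsilon> \<le> X" using \<kappa> eps ieX divide_right_mono[of 1 \<kappa> \<epsilon>] by simp
  have ln\<kappa>: "0 \<le> ln \<kappa>" "ln \<kappa> + 1 \<le> \<kappa>" using \<kappa> ln_le_minus_one[of \<kappa>] by auto
  define \<Lambda> where "\<Lambda> = ln \<kappa> + 1"
  define W where "W = 8 * (real K * (n * (\<Lambda> + real n + 1)) + \<Lambda> + (real n)\<^sup>2)"
  have "ln \<kappa> / \<epsilon> * min (1 / \<epsilon>) (real (graph_diameter n A)) \<le> \<kappa> / \<epsilon> * (1 / \<epsilon>)"
    using ln\<kappa> eps by (intro mult_mono divide_right_mono) auto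
  also have "\<dots> \<le> X * X" using ieX ieX' X eps by (intro mult_mono) auto
  finally have KX: "real K \<le> 240000 * (X * X)" using K unfolding \<kappa>_def by linarith
  have \<Lambda>: "1 \<le> \<Lambda>" "\<Lambda> \<le> X" using ln\<kappa> X unfolding \<Lambda>_def by auto
  have "real K * (n * (\<Lambda> + real n + 1)) \<le> 240000 * (X * X) * (X * (3 * X))"
    by (intro mult_mono KX X) (use \<Lambda> n X in auto)
  then have W1: "real K * (n * (\<Lambda> + real n + 1)) \<le> 720000 * X ^ 4" by (simp add: eval_nat_numeral)
  have "X \<le> X ^ 4" using X by (intro self_le_power) auto
  then have W2: "\<Lambda> \<le> X ^ 4" using \<Lambda> by linarith
  have "(real n)\<^sup>2 \<le> X\<^sup>2" using X n by (intro power_mono) auto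
  also have "\<dots> \<le> X ^ 4" using X by (intro power_increasing) auto
  finally have "real K * (n * (\<Lambda> + real n + 1)) + \<Lambda> + (real n)\<^sup>2 \<le> 720002 * X ^ 4"
    using W1 W2 by linarith
  then have "W \<le> 8 * 720002 * X ^ 4" unfolding W_def by simp
  also have "\<dots> \<le> 4 ^ 12 * X ^ 4" using X by (intro mult_right_mono) auto
  also have "\<dots> \<le> X ^ 12 * X ^ 4" using X by (intro mult_right_mono power_mono) auto
  finally have WX: "W \<le> X ^ 16" by (simp flip: power_add)
  have W: "0 < W" unfolding W_def using \<Lambda> n by (simp add: add_nonneg_pos)
  have lW: "log 2 W \<le> 16 * log 2 X"
  proof -
    have "log 2 W \<le> log 2 (X ^ 16)" using W WX X by (subst log_le_cancel_iff) auto
    also have "\<dots> = 16 * log 2 X" using X by (simp add: log_nat_power)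
    finally show ?thesis .
  qed
  have "log 2 (2 ^ 2) \<le> log 2 X" using X by (subst log_le_cancel_iff) auto
  then have lX: "2 \<le> log 2 X" by (subst (asm) log_nat_power) auto
  have "n / \<epsilon> \<le> X" unfolding X_def using nk eps by (intro divide_right_mono) auto
  then have "log 2 (n / \<epsilon>) \<le> log 2 X" using n eps X by (subst log_le_cancel_iff) auto
  then have pX: "real p \<le> 20 * log 2 X + 1" using p by linarith
  define b where "b = p + nat \<lceil>16 * log 2 X\<rceil> + 1"
  have c: "real (nat \<lceil>16 * log 2 X\<rceil>) < 16 * log 2 X + 1" "16 * log 2 X \<le> real (nat \<lceil>16 * log 2 X\<rceil>)"
    using lX by linarith+
  have breal: "real b = real p + real (nat \<lceil>16 * log 2 X\<rceil>) + 1" by (simp add: b_def)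
  have bX: "real b \<le> 38 * log 2 X" unfolding b_def using c pX lX by simp
  have "log 2 X \<le> 2 * ln X"
  proof -
    have "0 \<le> ln X" using X by simp
    then have "ln X * 1 \<le> ln X * (2 * ln 2)" using half_le_ln_2 by (intro mult_left_mono) auto
    then show ?thesis by (simp add: log_def field_simps)
  qed
  then have "real b \<le> 76 * ln X" using bX by linarith
  moreover have "bit_number b x" if "x \<in> set tr" for x
  proof (rule fixed_point_bit_number)
    show "fixed_point p W x" using tr[OF logs_bound[OF s] _ that] unfolding W_def \<Lambda>_def \<kappa>_def by blast
    show "real p + log 2 W < real b" using lW c(2) breal by linarith
  qed (use W in \<open>auto simp: b_def\<close>)
  ultimately show ?thesis unfolding X_def \<kappa>_def by blast
qed

end

section \<open>The choice of the accuracies\<close>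

lemma frac_bits_accuracy: "0 < \<delta> \<Longrightarrow> 1 / 2 ^ frac_bits \<delta> \<le> \<delta>"
proof -
  assume \<delta>: "0 < \<delta>"
  have "log 2 (1 / \<delta>) \<le> real (frac_bits \<delta>)" unfolding frac_bits_def by linarith
  then have "2 powr log 2 (1 / \<delta>) \<le> 2 powr real (frac_bits \<delta>)" by (intro powr_mono) auto
  then have "1 / \<delta> \<le> 2 ^ frac_bits \<delta>" using \<delta> by (simp add: powr_realpow)
  then show ?thesis using \<delta> by (simp add: field_simps)
qed

lemma frac_bits_le:
  assumes "0 < \<delta>" "0 < Y" "1 / \<delta> \<le> Y ^ k"
  shows "frac_bits \<delta> \<le> nat \<lceil>real k * log 2 Y\<rceil>"
proof -
  have "log 2 (1 / \<delta>) \<le> log 2 (Y ^ k)" using assms by (subst log_le_cancel_iff) auto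
  then show ?thesis unfolding frac_bits_def using assms(2)
    by (intro nat_mono ceiling_mono) (simp add: log_nat_power)
qed

text \<open>
  The precision \<open>20 log 2 Y\<close> with \<open>Y = n / \<epsilon> \<ge> 2\<close> makes \<open>2\<^bsup>-p\<^esup> \<le> 1 / Y ^ 20\<close>; two factors \<open>Y\<close> dominate the
  polynomial error terms, and the other eighteen, each at least \<open>2\<close>, the numerical constants.
\<close>

lemma working_precision:
  fixes Y :: real
  assumes "2 \<le> Y" defines "p \<equiv> nat \<lceil>20 * log 2 Y\<rceil>"
  shows "1 / 2 ^ p \<le> 1 / Y ^ 20" and "real p \<le> 20 * log 2 Y + 1"
proof -
  have l: "0 \<le> log 2 Y" using assms by simp
  then show "real p \<le> 20 * log 2 Y + 1" unfolding p_def by linarith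
  have "20 * log 2 Y \<le> real p" unfolding p_def by linarith
  then have "2 powr (20 * log 2 Y) \<le> 2 powr real p" by (intro powr_mono) auto
  moreover have "2 powr (20 * log 2 Y) = (2 powr log 2 Y) powr 20" by (simp add: powr_powr mult.commute)
  then have "2 powr (20 * log 2 Y) = Y ^ 20" using assms by (simp add: powr_numeral)
  ultimately have "Y ^ 20 \<le> 2 ^ p" by (simp add: powr_realpow)
  then show "1 / 2 ^ p \<le> 1 / Y ^ 20" using assms by (intro divide_left_mono) auto
qed

lemma (in osborne_input) fixed_point_osborneI:
  assumes \<epsilon>: "0 < \<epsilon>" "\<epsilon> < 1" and s: "0 < s" and perm: "\<And>k. bij_betw (\<pi> k) {..<n} {..<n}"
  shows "fixed_point_osborne n A \<epsilon> s (1 / 10000 * \<epsilon> / n) (1 / 10000 * \<epsilon>\<^sup>2) (1 * (1 / 3 * \<epsilon>)) \<pi>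
    (frac_bits (1 / 10000 * \<epsilon> / n)) (frac_bits (1 / 10000 * \<epsilon>\<^sup>2)) (nat \<lceil>20 * log 2 (n / \<epsilon>)\<rceil>)"
proof -
  define Y where "Y = n / \<epsilon>"
  have n: "2 \<le> real n" using n_ge_2 by simp
  have nY: "n \<le> Y" unfolding Y_def using n \<epsilon> by (simp add: field_simps mult_left_le)
  then have Y: "2 \<le> Y" using n by linarith
  have \<epsilon>Y: "\<epsilon> = n / Y" using \<epsilon> n by (simp add: Y_def)
  note wp = working_precision[OF Y]
  have Yk: "2 ^ k \<le> Y ^ k" for k using Y by (intro power_mono) auto
  have Ypos: "0 < Y ^ k" for k using Y by simp
  show ?thesis
    unfolding Y_def[symmetric]
  proof unfold_locales
    have "\<epsilon> / n \<le> \<epsilon> / 2" using \<epsilon> n by (intro divide_left_mono) auto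
    moreover have "\<epsilon>\<^sup>2 \<le> \<epsilon>" using \<epsilon> by (simp add: power2_eq_square mult_left_le)
    ultimately show "1 / 10000 * \<epsilon> / n + 2 * (1 / 10000 * \<epsilon>\<^sup>2) \<le> \<epsilon> / 2400" using \<epsilon> by simp
    have "10000 * Y \<le> Y ^ 19 * Y" using Yk[of 19] Y by (intro mult_right_mono) auto
    then show "frac_bits (1 / 10000 * \<epsilon> / n) \<le> nat \<lceil>20 * log 2 Y\<rceil>"
      using frac_bits_le[of "1 / 10000 * \<epsilon> / n" Y 20] \<epsilon> n Y by (simp add: Y_def eval_nat_numeral)
    have "10000 / \<epsilon>\<^sup>2 \<le> Y ^ 20"
    proof -
      have "10000 * 1 \<le> Y ^ 18 * (real n)\<^sup>2" using Yk[of 18] n by (intro mult_mono) auto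
      then show ?thesis unfolding \<epsilon>Y using n Y by (simp add: field_simps power_divide) (simp add: eval_nat_numeral)
    qed
    then show "frac_bits (1 / 10000 * \<epsilon>\<^sup>2) \<le> nat \<lceil>20 * log 2 Y\<rceil>"
      using frac_bits_le[of "1 / 10000 * \<epsilon>\<^sup>2" Y 20] \<epsilon> Y by simp
    show "1 / 2 ^ frac_bits (1 / 10000 * \<epsilon> / n) \<le> 1 / 10000 * \<epsilon> / n"
      by (rule frac_bits_accuracy) (use \<epsilon> n in simp)
    show "1 / 2 ^ frac_bits (1 / 10000 * \<epsilon>\<^sup>2) \<le> 1 / 10000 * \<epsilon>\<^sup>2"
      by (rule frac_bits_accuracy) (use \<epsilon> in simp)
    have Y20: "Y ^ 20 = Y ^ 18 * (Y * Y)" by (simp add: eval_nat_numeral)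
    have "(real n + 2) / 2 ^ nat \<lceil>20 * log 2 Y\<rceil> \<le> (real n + 2) * (1 / Y ^ 20)"
      using mult_left_mono[OF wp(1), of "real n + 2"] by simp
    also have "\<dots> \<le> (real n * real n * Y ^ 18 / 10000) * (1 / Y ^ 20)"
    proof (rule mult_right_mono)
      have "(real n + 2) * 10000 \<le> (2 * real n) * 10000" using n by simp
      also have "\<dots> \<le> (real n * real n) * 2 ^ 18" using n by (intro mult_mono) auto
      also have "\<dots> \<le> (real n * real n) * Y ^ 18" using Yk[of 18] by (intro mult_left_mono) auto
      finally show "real n + 2 \<le> real n * real n * Y ^ 18 / 10000" by simp
    qed (use Y in simp)
    also have "\<dots> = 1 / 10000 * \<epsilon>\<^sup>2"
      unfolding \<epsilon>Y Y20 using Y by (simp add: power2_eq_square)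
    finally show "(real n + 2) / 2 ^ nat \<lceil>20 * log 2 Y\<rceil> \<le> 1 / 10000 * \<epsilon>\<^sup>2" .
    have "(4 * (real n)\<^sup>2 + 1) / 2 ^ nat \<lceil>20 * log 2 Y\<rceil> \<le> (4 * (real n)\<^sup>2 + 1) * (1 / Y ^ 20)"
      using mult_left_mono[OF wp(1), of "4 * (real n)\<^sup>2 + 1"] by simp
    also have "\<dots> \<le> (Y ^ 18 * (Y * real n) / 10) * (1 / Y ^ 20)"
    proof (rule mult_right_mono)
      have "1 \<le> (real n)\<^sup>2" using n by simp
      then have "(4 * (real n)\<^sup>2 + 1) * 10 \<le> 50 * (real n * real n)" by (simp add: power2_eq_square)
      also have "\<dots> \<le> 2 ^ 18 * (Y * real n)" using n nY by (intro mult_mono) auto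
      also have "\<dots> \<le> Y ^ 18 * (Y * real n)" using Yk[of 18] Y by (intro mult_right_mono) auto
      finally show "4 * (real n)\<^sup>2 + 1 \<le> Y ^ 18 * (Y * real n) / 10" by simp
    qed (use Y in simp)
    also have "\<dots> = \<epsilon> / 10" unfolding \<epsilon>Y Y20 using Y by simp
    finally have "(4 * (real n)\<^sup>2 + 1) / 2 ^ nat \<lceil>20 * log 2 Y\<rceil> \<le> \<epsilon> / 10" .
    moreover have "\<epsilon> / n \<le> \<epsilon>" using \<epsilon> n by (simp add: field_simps)
    ultimately show "16 * (1 / 10000 * \<epsilon> / n) + (4 * (real n)\<^sup>2 + 1) / 2 ^ nat \<lceil>20 * log 2 Y\<rceil> \<le> \<epsilon> / 6"
      using \<epsilon> by linarith
  qed (use \<epsilon> s perm in auto)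
qed

theorem theorem2:
  "\<exists>(c1::real)>0. \<exists>(c2::real)>0. \<exists>(c3::real)>0. \<exists>(c4::real)>0. \<exists>(c5::real)>0. \<exists>(C::real)>0.
   \<forall>(n::nat) (A::real mat) (\<epsilon>::real) (\<pi>::nat \<Rightarrow> nat \<Rightarrow> nat) (s::real).
     n \<ge> 2 \<longrightarrow> A \<in> carrier_mat n n \<longrightarrow>
     (\<forall>i<n. \<forall>j<n. A $$ (i, j) \<ge> 0) \<longrightarrow> (\<forall>i<n. A $$ (i, i) = 0) \<longrightarrow>
     balanceable n A \<longrightarrow> 0 < \<epsilon> \<longrightarrow> \<epsilon> < 1 \<longrightarrow>
     (\<forall>k. bij_betw (\<pi> k) {..<n} {..<n}) \<longrightarrow> s > 0 \<longrightarrow>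
     (let m = real (card (edges n A)); \<kappa> = kappa n A; d = real (graph_diameter n A);
          \<gamma> = c1 * \<epsilon> / real n; \<gamma>' = c2 * \<epsilon>\<^sup>2; \<epsilon>b = c3 * \<epsilon>; \<tau> = c4 * \<epsilon>b;
          q = frac_bits \<gamma>; q' = frac_bits \<gamma>'; p = nat \<lceil>c5 * log 2 (real n / \<epsilon>)\<rceil>;
          U = fp_iterate n A s \<pi> q q' p \<tau>; g = fp_estimates n A s \<pi> q q' p \<tau>
      in
        \<comment> \<open>every implementation with these accuracies\<close>
        (\<forall>L' U' g' K. inexact_run n A s \<pi> \<gamma> \<gamma>' \<epsilon>b \<tau> L' U' g' K \<longrightarrow>
            real K \<le> C * ln \<kappa> / \<epsilon> * min (1 / \<epsilon>) d \<and>
            (K \<ge> 1 \<longrightarrow> g' K \<le> \<tau> \<longrightarrow> eps_balancing n A \<epsilon> (U' K))) \<and>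
        \<comment> \<open>the fixed-point program is such an implementation; operation count and bit length\<close>
        (\<exists>K tr. fp_osborne n A s \<pi> q q' p \<tau> = Some (K, U K, True, tr) \<and>
            K \<ge> 1 \<and> inexact_run n A s \<pi> \<gamma> \<gamma>' \<epsilon>b \<tau> (fp_logs A s q) U g K \<and> g K \<le> \<tau> \<and>
            eps_balancing n A \<epsilon> (U K) \<and>
            real (length tr) \<le> C * (m * ln \<kappa> / \<epsilon> * min (1 / \<epsilon>) d) \<and>
            (min_entry n A \<le> s \<and> s \<le> entry_sum n A \<longrightarrow>
              (\<exists>b. real b \<le> C * ln (real n * \<kappa> / \<epsilon>) \<and> (\<forall>x\<in>set tr. bit_number b x)))))"
proof (rule exI[of _ "1 / 10000"], rule conjI, simp, rule exI[of _ "1 / 10000"], rule conjI, simp,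
    rule exI[of _ "1 / 3"], rule conjI, simp, rule exI[of _ 1], rule conjI, simp,
    rule exI[of _ 20], rule conjI, simp, rule exI[of _ 10560000], rule conjI, simp, intro allI impI)
  fix n :: nat and A :: "real mat" and \<epsilon> s :: real and \<pi> :: "nat \<Rightarrow> nat \<Rightarrow> nat"
  assume a: "2 \<le> n" "A \<in> carrier_mat n n" "\<forall>i<n. \<forall>j<n. 0 \<le> A $$ (i, j)" "\<forall>i<n. A $$ (i, i) = 0"
    "balanceable n A" "0 < \<epsilon>" "\<epsilon> < 1" "\<forall>k. bij_betw (\<pi> k) {..<n} {..<n}" "0 < s"
  interpret osborne_input n A by unfold_locales (use a in auto)
  define \<gamma> \<gamma>' \<tau> where "\<gamma> = 1 / 10000 * \<epsilon> / n" and "\<gamma>' = 1 / 10000 * \<epsilon>\<^sup>2" and "\<tau> = 1 * (1 / 3 * \<epsilon>)"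
  define q q' p where "q = frac_bits \<gamma>" and "q' = frac_bits \<gamma>'" and "p = nat \<lceil>20 * log 2 (n / \<epsilon>)\<rceil>"
  interpret fixed_point_osborne n A \<epsilon> s \<gamma> \<gamma>' \<tau> \<pi> q q' p
    unfolding q_def q'_def p_def unfolding \<gamma>_def \<gamma>'_def \<tau>_def
    by (rule fixed_point_osborneI) (use a in auto)
  \<comment> \<open>\<open>10560000 = 44 * 240000\<close>: operations per edge and cycle, times the constant for cycles\<close>
  define B where "B = ln (kappa n A) / \<epsilon> * min (1 / \<epsilon>) (real (graph_diameter n A))"
  have B0: "0 \<le> B" using one_le_cycle_bound[OF a(6,7)] by (simp add: B_def)
  have thirds: "1 / 3 * \<epsilon> = \<epsilon> / 3" and \<tau>: "\<tau> = \<epsilon> / 3" by (simp_all add: \<tau>_def)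
  have every: "real K \<le> 10560000 * ln (kappa n A) / \<epsilon> * min (1 / \<epsilon>) (real (graph_diameter n A)) \<and>
      (K \<ge> 1 \<longrightarrow> g' K \<le> \<tau> \<longrightarrow> eps_balancing n A \<epsilon> (U' K))"
    if "inexact_run n A s \<pi> \<gamma> \<gamma>' (1 / 3 * \<epsilon>) \<tau> L' U' g' K" for L' U' g' K
  proof -
    note rb = run_bounds[OF that[unfolded thirds \<tau>]]
    have "real K \<le> 240000 * B" using rb(1) by (simp add: B_def)
    then have "real K \<le> 10560000 * B" using B0 by linarith
    then show ?thesis using rb(2) by (simp add: B_def \<tau>)
  qed
  obtain K where K: "1 \<le> K" "g K \<le> \<tau>" "\<forall>k\<in>{1..<K}. \<tau> < g k" using terminates by blast
  have run: "inexact_run n A s \<pi> \<gamma> \<gamma>' (\<epsilon> / 3) (\<epsilon> / 3) L U g K" by (rule program_run) (use K in auto)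
  note rb = run_bounds[OF run]
  obtain tr where tr: "fp_osborne n A s \<pi> q q' p \<tau> = Some (K, U K, True, tr)" "length tr \<le> 44 * m * K"
    "\<forall>\<Lambda> W. grid_logs p \<Lambda> L \<longrightarrow> 8 * (real K * (n * (\<Lambda> + real n + 1)) + \<Lambda> + (real n)\<^sup>2) \<le> W \<longrightarrow>
       (\<forall>x\<in>set tr. fixed_point p W x)"
    using program_result[OF K(1,2)] K(3) by blast
  have ops: "real (length tr) \<le> 10560000 * (real m * ln (kappa n A) / \<epsilon> * min (1 / \<epsilon>) (real (graph_diameter n A)))"
  proof -
    have "real (length tr) \<le> real (44 * m * K)" using tr(2) by (rule of_nat_mono)
    also have "\<dots> = 44 * real m * real K" by simp
    also have "\<dots> \<le> 44 * real m * (240000 * B)" using rb(1) unfolding B_def by (intro mult_left_mono) auto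
    finally show ?thesis by (simp add: B_def mult_ac)
  qed
  have bits: "\<exists>b. real b \<le> 10560000 * ln (real n * kappa n A / \<epsilon>) \<and> (\<forall>x\<in>set tr. bit_number b x)"
    if s: "min_entry n A \<le> s \<and> s \<le> entry_sum n A"
  proof -
    have Y: "2 \<le> n / \<epsilon>" using a by (simp add: field_simps)
    have "\<exists>b. real b \<le> 76 * ln (n * kappa n A / \<epsilon>) \<and> (\<forall>x\<in>set tr. bit_number b x)"
      by (rule bit_length[OF _ _ _ rb(1)]) (use s tr(3) working_precision(2)[OF Y] in \<open>auto simp: p_def\<close>)
    moreover have "0 \<le> ln (n * kappa n A / \<epsilon>)"
    proof -
      have "1 * 1 \<le> n / \<epsilon> * kappa n A" using Y kappa_ge_2 by (intro mult_mono) auto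
      then show ?thesis by simp
    qed
    then have "76 * ln (n * kappa n A / \<epsilon>) \<le> 10560000 * ln (n * kappa n A / \<epsilon>)"
      by (intro mult_right_mono) auto
    ultimately show ?thesis using order_trans by blast
  qed
  show "let m = real (card (edges n A)); \<kappa> = kappa n A; d = real (graph_diameter n A);
          \<gamma> = 1 / 10000 * \<epsilon> / real n; \<gamma>' = 1 / 10000 * \<epsilon>\<^sup>2; \<epsilon>b = 1 / 3 * \<epsilon>; \<tau> = 1 * \<epsilon>b;
          q = frac_bits \<gamma>; q' = frac_bits \<gamma>'; p = nat \<lceil>20 * log 2 (real n / \<epsilon>)\<rceil>;
          U = fp_iterate n A s \<pi> q q' p \<tau>; g = fp_estimates n A s \<pi> q q' p \<tau>
      in
        (\<forall>L' U' g' K. inexact_run n A s \<pi> \<gamma> \<gamma>' \<epsilon>b \<tau> L' U' g' K \<longrightarrow>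
            real K \<le> 10560000 * ln \<kappa> / \<epsilon> * min (1 / \<epsilon>) d \<and>
            (K \<ge> 1 \<longrightarrow> g' K \<le> \<tau> \<longrightarrow> eps_balancing n A \<epsilon> (U' K))) \<and>
        (\<exists>K tr. fp_osborne n A s \<pi> q q' p \<tau> = Some (K, U K, True, tr) \<and>
            K \<ge> 1 \<and> inexact_run n A s \<pi> \<gamma> \<gamma>' \<epsilon>b \<tau> (fp_logs A s q) U g K \<and> g K \<le> \<tau> \<and>
            eps_balancing n A \<epsilon> (U K) \<and>
            real (length tr) \<le> 10560000 * (m * ln \<kappa> / \<epsilon> * min (1 / \<epsilon>) d) \<and>
            (min_entry n A \<le> s \<and> s \<le> entry_sum n A \<longrightarrow>
              (\<exists>b. real b \<le> 10560000 * ln (real n * \<kappa> / \<epsilon>) \<and> (\<forall>x\<in>set tr. bit_number b x))))"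
    unfolding Let_def \<gamma>_def[symmetric] \<gamma>'_def[symmetric] \<tau>_def[symmetric]
    unfolding q_def[symmetric] q'_def[symmetric] p_def[symmetric]
    using every tr(1) K(1,2) run rb(2) ops bits unfolding thirds \<tau> by blast
qed

end
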